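(* Let $G_\Gamma$ be a graph product of finite groups and let $\mathbb E(\Gamma)$ be its electrification. (1) $\mathbb E(\Gamma)$ has bounded diameter if and only if $\Gamma$ is either a complete graph, a minsquare graph, or the join of a minsquare graph and a complete graph. (2) $\mathbb E(\Gamma)$ is a quasi-line if and only if $G_\Gamma$ is virtually cyclic.
   Context: Let $\Gamma$ be a finite simplicial graph with each vertex $v$ labelled by a group $G_v$; vertex groups are always assumed non-trivial. The graph product is $G_\Gamma=\left(\ast_{v\in V(\Gamma)}G_v\right)/\langle\langle [g_v,g_w] : g_v\in G_v,\ g_w\in G_w,\ \{v,w\}\in E(\Gamma)\rangle\rangle$; it is a graph product of finite groups if every $G_v$ is finite. Subgraphs are non-empty and induced. For a subgraph $\Lambda\subseteq\Gamma$, $\langle\Lambda\rangle\le G_\Gamma$ is the subgroup generated by $\{G_v:v\in V(\Lambda)\}$. A graph is the join of disjoint subgraphs $\Lambda_1,\Lambda_2$ if its vertex set is $V(\Lambda_1)\cup V(\Lambda_2)$ and every vertex of $\Lambda_1$ is adjacent to every vertex of $\Lambda_2$. An induced subgraph $\Lambda\subseteq\Gamma$ is square-complete if every induced square (4-cycle) of $\Gamma$ sharing two non-adjacent vertices with $\Lambda$ is a subgraph of $\Lambda$. A subgraph is minsquare if it is a minimal square-complete subgraph containing at least one induced square (i.e. minimal under inclusion among such subgraphs). A graph is minsquare if it is a minsquare subgraph of itself. The electrification $\mathbb E(\Gamma)$ is the graph with vertex set $G_\Gamma$ in which $g,h$ are joined by an edge if $g^{-1}h$ is an element of a vertex group, or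 $g^{-1}h\in\langle\Lambda\rangle$ for some minsquare subgraph $\Lambda$ of $\Gamma$. A quasi-line is a space quasi-isometric to $\mathbb R$.
   Formalization: In (2), "virtually cyclic" is taken to mean having an infinite cyclic subgroup of finite index; if finite groups counted as virtually cyclic, (2) would fail, e.g. for a single vertex labelled Z/2, where the electrification is bounded. *)

theory Defs
  imports
    Complex_Main
    "HOL-Algebra.Elementary_Groups"
    "Graph_Theory.Digraph_Component"
    "Graph_Theory.Kuratowski"
    "Graph_Theory.Shortest_Path"
begin

section \<open>Graphs\<close>

text \<open>
  Finite simplicial graphs are modelled by the locale \<^locale>\<open>graph\<close> (finite, loop-free, without
  multiple arcs, symmetric); the induced subgraphs of a graph then correspond bijectively to its
  sets of vertices.  Following the convention that subgraphs are induced and non-empty, the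
  word subgraph always refers to \<open>nonempty_induced_subgraph\<close> below.
\<close>

definition nonempty_induced_subgraph :: "('v,'e) pre_digraph \<Rightarrow> ('v,'e) pre_digraph \<Rightarrow> bool" where
  "nonempty_induced_subgraph \<Lambda> \<Gamma> \<longleftrightarrow> induced_subgraph \<Lambda> \<Gamma> \<and> verts \<Lambda> \<noteq> {}"

definition complete_graph :: "('v,'e) pre_digraph \<Rightarrow> bool" where
  "complete_graph \<Gamma> \<longleftrightarrow> (\<exists>n. complete_digraph n \<Gamma>)"

definition induced_square :: "('v,'e) pre_digraph \<Rightarrow> ('v,'e) pre_digraph \<Rightarrow> bool" where
  "induced_square S \<Gamma> \<longleftrightarrow> nonempty_induced_subgraph S \<Gamma> \<and>
     (\<exists>a b c d. distinct [a, b, c, d] \<and> verts S = {a, b, c, d} \<and>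
        a \<rightarrow>\<^bsub>\<Gamma>\<^esub> b \<and> b \<rightarrow>\<^bsub>\<Gamma>\<^esub> c \<and> c \<rightarrow>\<^bsub>\<Gamma>\<^esub> d \<and> d \<rightarrow>\<^bsub>\<Gamma>\<^esub> a \<and>
        \<not> a \<rightarrow>\<^bsub>\<Gamma>\<^esub> c \<and> \<not> b \<rightarrow>\<^bsub>\<Gamma>\<^esub> d)"

definition square_complete :: "('v,'e) pre_digraph \<Rightarrow> ('v,'e) pre_digraph \<Rightarrow> bool" where
  "square_complete \<Lambda> \<Gamma> \<longleftrightarrow> nonempty_induced_subgraph \<Lambda> \<Gamma> \<and>
     (\<forall>S. induced_square S \<Gamma> \<and>
          (\<exists>x y. x \<in> verts S \<inter> verts \<Lambda> \<and> y \<in> verts S \<inter> verts \<Lambda> \<and> x \<noteq> y \<and> \<not> x \<rightarrow>\<^bsub>\<Gamma>\<^esub> y)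
          \<longrightarrow> subgraph S \<Lambda>)"

definition square_complete_with_square :: "('v,'e) pre_digraph \<Rightarrow> ('v,'e) pre_digraph \<Rightarrow> bool" where
  "square_complete_with_square \<Lambda> \<Gamma> \<longleftrightarrow> square_complete \<Lambda> \<Gamma> \<and> (\<exists>S. induced_square S \<Lambda>)"

definition minsquare_subgraph :: "('v,'e) pre_digraph \<Rightarrow> ('v,'e) pre_digraph \<Rightarrow> bool" where
  "minsquare_subgraph \<Lambda> \<Gamma> \<longleftrightarrow> square_complete_with_square \<Lambda> \<Gamma> \<and>
     (\<forall>\<Lambda>'. square_complete_with_square \<Lambda>' \<Gamma> \<and> subgraph \<Lambda>' \<Lambda> \<longrightarrow> \<Lambda>' = \<Lambda>)"

definition minsquare_graph :: "('v,'e) pre_digraph \<Rightarrow> bool" where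
  "minsquare_graph \<Gamma> \<longleftrightarrow> minsquare_subgraph \<Gamma> \<Gamma>"

definition is_join :: "('v,'e) pre_digraph \<Rightarrow> ('v,'e) pre_digraph \<Rightarrow> ('v,'e) pre_digraph \<Rightarrow> bool" where
  "is_join \<Gamma> \<Lambda>\<^sub>1 \<Lambda>\<^sub>2 \<longleftrightarrow>
     nonempty_induced_subgraph \<Lambda>\<^sub>1 \<Gamma> \<and> nonempty_induced_subgraph \<Lambda>\<^sub>2 \<Gamma> \<and>
     verts \<Lambda>\<^sub>1 \<inter> verts \<Lambda>\<^sub>2 = {} \<and> verts \<Gamma> = verts \<Lambda>\<^sub>1 \<union> verts \<Lambda>\<^sub>2 \<and>
     (\<forall>x\<in>verts \<Lambda>\<^sub>1. \<forall>y\<in>verts \<Lambda>\<^sub>2. x \<rightarrow>\<^bsub>\<Gamma>\<^esub> y)"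


section \<open>Graph products of groups\<close>

text \<open>
  The free product of a family of groups is realised on words of syllables \<open>(v, g)\<close> with
  \<open>g\<close> in the group of index \<open>v\<close>, modulo the congruence generated by deleting trivial
  syllables and multiplying consecutive syllables of the same index.
\<close>

definition syllable_words :: "'v set \<Rightarrow> ('v \<Rightarrow> ('a,'b) monoid_scheme) \<Rightarrow> ('v \<times> 'a) list set" where
  "syllable_words I G = lists (SIGMA v:I. carrier (G v))"

inductive_set word_rel :: "'v set \<Rightarrow> ('v \<Rightarrow> ('a,'b) monoid_scheme) \<Rightarrow> (('v \<times> 'a) list \<times> ('v \<times> 'a) list) set"
  for I G where
  refl: "x \<in> syllable_words I G \<Longrightarrow> (x, x) \<in> word_rel I G"
| sym: "(x, y) \<in> word_rel I G \<Longrightarrow> (y, x) \<in> word_rel I G"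
| trans: "(x, y) \<in> word_rel I G \<Longrightarrow> (y, z) \<in> word_rel I G \<Longrightarrow> (x, z) \<in> word_rel I G"
| unit: "x \<in> syllable_words I G \<Longrightarrow> y \<in> syllable_words I G \<Longrightarrow> v \<in> I \<Longrightarrow>
    (x @ [(v, \<one>\<^bsub>G v\<^esub>)] @ y, x @ y) \<in> word_rel I G"
| mult: "x \<in> syllable_words I G \<Longrightarrow> y \<in> syllable_words I G \<Longrightarrow> v \<in> I \<Longrightarrow>
    g \<in> carrier (G v) \<Longrightarrow> h \<in> carrier (G v) \<Longrightarrow>
    (x @ [(v, g), (v, h)] @ y, x @ [(v, g \<otimes>\<^bsub>G v\<^esub> h)] @ y) \<in> word_rel I G"

definition free_product :: "'v set \<Rightarrow> ('v \<Rightarrow> ('a,'b) monoid_scheme) \<Rightarrow> ('v \<times> 'a) list set monoid" where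
  "free_product I G =
     \<lparr>carrier = syllable_words I G // word_rel I G,
      monoid.mult = (\<lambda>A B. \<Union>x\<in>A. \<Union>y\<in>B. word_rel I G `` {x @ y}),
      one = word_rel I G `` {[]}\<rparr>"

definition free_product_inj ::
  "'v set \<Rightarrow> ('v \<Rightarrow> ('a,'b) monoid_scheme) \<Rightarrow> 'v \<Rightarrow> 'a \<Rightarrow> ('v \<times> 'a) list set" where
  "free_product_inj I G v g = word_rel I G `` {[(v, g)]}"

definition normal_closure :: "('a,'b) monoid_scheme \<Rightarrow> 'a set \<Rightarrow> 'a set" where
  "normal_closure G S = \<Inter>{N. N \<lhd> G \<and> S \<subseteq> N}"

definition graph_product_relators ::
  "('v,'e) pre_digraph \<Rightarrow> ('v \<Rightarrow> ('a,'b) monoid_scheme) \<Rightarrow> ('v \<times> 'a) list set set" where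
  "graph_product_relators \<Gamma> G =
     (let F = free_product (verts \<Gamma>) G; \<iota> = free_product_inj (verts \<Gamma>) G in
      {\<iota> v g \<otimes>\<^bsub>F\<^esub> \<iota> w h \<otimes>\<^bsub>F\<^esub> inv\<^bsub>F\<^esub> (\<iota> v g) \<otimes>\<^bsub>F\<^esub> inv\<^bsub>F\<^esub> (\<iota> w h) | v w g h.
         v \<rightarrow>\<^bsub>\<Gamma>\<^esub> w \<and> g \<in> carrier (G v) \<and> h \<in> carrier (G w)})"

definition graph_product ::
  "('v,'e) pre_digraph \<Rightarrow> ('v \<Rightarrow> ('a,'b) monoid_scheme) \<Rightarrow> ('v \<times> 'a) list set set monoid" where
  "graph_product \<Gamma> G =
     free_product (verts \<Gamma>) G Mod
       normal_closure (free_product (verts \<Gamma>) G) (graph_product_relators \<Gamma> G)"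

text \<open>The image in the graph product of the vertex group at \<open>v\<close>.\<close>

definition vertex_group ::
  "('v,'e) pre_digraph \<Rightarrow> ('v \<Rightarrow> ('a,'b) monoid_scheme) \<Rightarrow> 'v \<Rightarrow> ('v \<times> 'a) list set set set" where
  "vertex_group \<Gamma> G v =
     (\<lambda>g. normal_closure (free_product (verts \<Gamma>) G) (graph_product_relators \<Gamma> G)
            #>\<^bsub>free_product (verts \<Gamma>) G\<^esub> free_product_inj (verts \<Gamma>) G v g) ` carrier (G v)"

definition special_subgroup ::
  "('v,'e) pre_digraph \<Rightarrow> ('v \<Rightarrow> ('a,'b) monoid_scheme) \<Rightarrow> ('v,'e) pre_digraph \<Rightarrow>
     ('v \<times> 'a) list set set set" where
  "special_subgroup \<Gamma> G \<Lambda> = generate (graph_product \<Gamma> G) (\<Union>v\<in>verts \<Lambda>. vertex_group \<Gamma> G v)"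

text \<open>
  Finite groups count as virtually cyclic under some conventions; here the cyclic subgroup
  of finite index is required to be infinite.
\<close>

definition virtually_infinite_cyclic :: "('a,'b) monoid_scheme \<Rightarrow> bool" where
  "virtually_infinite_cyclic G \<longleftrightarrow>
     (\<exists>H. subgroup H G \<and> finite (rcosets\<^bsub>G\<^esub> H) \<and> subgroup_generated G H \<cong> integer_group)"


section \<open>The electrification and its large-scale geometry\<close>

definition electrification ::
  "('v,'e) pre_digraph \<Rightarrow> ('v \<Rightarrow> ('a,'b) monoid_scheme) \<Rightarrow>
     (('v \<times> 'a) list set set, ('v \<times> 'a) list set set \<times> ('v \<times> 'a) list set set) pre_digraph" where
  "electrification \<Gamma> G =
     \<lparr>verts = carrier (graph_product \<Gamma> G),
      arcs = {(g, h). g \<in> carrier (graph_product \<Gamma> G) \<and> h \<in> carrier (graph_product \<Gamma> G) \<and> g \<noteq> h \<and>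
        ((\<exists>v\<in>verts \<Gamma>. inv\<^bsub>graph_product \<Gamma> G\<^esub> g \<otimes>\<^bsub>graph_product \<Gamma> G\<^esub> h \<in> vertex_group \<Gamma> G v) \<or>
         (\<exists>\<Lambda>. minsquare_subgraph \<Lambda> \<Gamma> \<and>
            inv\<^bsub>graph_product \<Gamma> G\<^esub> g \<otimes>\<^bsub>graph_product \<Gamma> G\<^esub> h \<in> special_subgroup \<Gamma> G \<Lambda>))},
      tail = fst, head = snd\<rparr>"

text \<open>
  The path metric of a graph, every edge having length one.  The conversion from
  \<^typ>\<open>ereal\<close> is only meaningful for connected graphs (electrifications are connected, since the
  vertex groups generate the graph product).
\<close>

definition graph_dist :: "('v,'e) pre_digraph \<Rightarrow> 'v \<Rightarrow> 'v \<Rightarrow> real" where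
  "graph_dist D u v = real_of_ereal (wf_digraph.\<mu> D (\<lambda>_. 1) u v)"

definition bounded_diameter :: "'x set \<Rightarrow> ('x \<Rightarrow> 'x \<Rightarrow> real) \<Rightarrow> bool" where
  "bounded_diameter X d \<longleftrightarrow> (\<exists>B. \<forall>x\<in>X. \<forall>y\<in>X. d x y \<le> B)"

definition quasi_isometry ::
  "'x set \<Rightarrow> ('x \<Rightarrow> 'x \<Rightarrow> real) \<Rightarrow> 'y set \<Rightarrow> ('y \<Rightarrow> 'y \<Rightarrow> real) \<Rightarrow> ('x \<Rightarrow> 'y) \<Rightarrow> bool" where
  "quasi_isometry X dX Y dY f \<longleftrightarrow> f ` X \<subseteq> Y \<and>
     (\<exists>L\<ge>1. \<exists>C\<ge>0.
        (\<forall>x\<in>X. \<forall>x'\<in>X. dX x x' / L - C \<le> dY (f x) (f x') \<and> dY (f x) (f x') \<le> L * dX x x' + C) \<and>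
        (\<forall>y\<in>Y. \<exists>x\<in>X. dY (f x) y \<le> C))"

definition quasi_line :: "'x set \<Rightarrow> ('x \<Rightarrow> 'x \<Rightarrow> real) \<Rightarrow> bool" where
  "quasi_line X d \<longleftrightarrow> (\<exists>f. quasi_isometry X d (UNIV :: real set) dist f)"

end

theory Submission
  imports Defs
begin

text \<open>
  Call a vertex a core vertex if it is non-adjacent to some other vertex.  Squares only involve core
  vertices, and the other vertices contribute a finite direct factor.  If the core is minsquare it
  spans a subgroup of diameter one in the electrification, which is therefore bounded.  Otherwise
  the complement graph is connected on the core, so there are periodic walks through all of the core
  whose consecutive vertices are non-adjacent.  The words read along such a walk are reduced and
  define a nested sequence of half-spaces of the graph product.  An edge of the electrification
  lies in a coset that misses some core vertex, so it cannot cross a full period of half-spaces;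
  hence distances along the word grow linearly.

  Three such words with distinct first syllables form a tripod, which does not embed
  quasi-isometrically into the line.  So if the electrification is a quasi-line, the core consists
  of two vertices with groups of order two and the graph product is the infinite dihedral group
  times a finite group.  Conversely, in a virtually infinite cyclic graph product there is no
  square, and the electrification is a Cayley graph for a finite generating set.
\<close>

section \<open>Reduced words up to shuffling\<close>

text \<open>The obstacle is that a lower bound on distances must survive right multiplication by
  elements of whole minsquare subgroups, whereas normal forms are computed by left multiplication.
  The bridge is \<open>proj v\<close>, the syllable at \<open>v\<close> that leads the normal form:
  right multiplication by the group of another vertex changes a normal form at most in a last
  syllable at that vertex, and so leaves \<open>proj v\<close> alone. A generator supported away
  from \<open>v\<close> therefore preserves all half-spaces labelled \<open>v\<close>, wherever they
  are based. Which core vertex a generator misses is not known in advance. A walk of period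
  \<open>r\<close> through the whole core meets every label within \<open>r\<close> steps, so one
  edge changes the depth by at most \<open>r\<close>, whichever generator it carries. That
  \<open>proj\<close> is well defined on group elements is the normal form theorem up to shuffling.
  It is obtained by letting words act on reduced words and checking that the commutator relators act
  trivially.\<close>

locale vertex_groups =
  fixes V :: "'v set" and adj :: "'v \<Rightarrow> 'v \<Rightarrow> bool" and G :: "'v \<Rightarrow> ('a,'b) monoid_scheme"
  assumes adj_sym: "adj u v \<Longrightarrow> adj v u"
    and adj_irrefl: "\<not> adj v v"
    and group_G: "v \<in> V \<Longrightarrow> group (G v)"
begin

text \<open>The syllable at \<open>v\<close> of a word that can be shuffled to the front, and the word left after removing it.\<close>

primrec lead :: "'v \<Rightarrow> ('v \<times> 'a) list \<Rightarrow> 'a" where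
  "lead v [] = \<one>\<^bsub>G v\<^esub>"
| "lead v (s # w) = (if fst s = v then snd s else if adj (fst s) v then lead v w else \<one>\<^bsub>G v\<^esub>)"

primrec rest :: "'v \<Rightarrow> ('v \<times> 'a) list \<Rightarrow> ('v \<times> 'a) list" where
  "rest v [] = []"
| "rest v (s # w) = (if fst s = v then w else if adj (fst s) v then s # rest v w else s # w)"

text \<open>In a reduced word all syllables are non-trivial, so the value one of
  \<open>lead v\<close> encodes that no syllable at \<open>v\<close> can be shuffled to the front.
  The condition on \<open>lead\<close> thus forbids a syllable that could be merged with a later
  one.\<close>

primrec reduced :: "('v \<times> 'a) list \<Rightarrow> bool" where
  "reduced [] = True"
| "reduced (s # w) \<longleftrightarrow> fst s \<in> V \<and> snd s \<in> carrier (G (fst s)) \<and> snd s \<noteq> \<one>\<^bsub>G (fst s)\<^esub> \<and>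
     lead (fst s) w = \<one>\<^bsub>G (fst s)\<^esub> \<and> reduced w"

text \<open>Left multiplication by a syllable, carried out on normal forms: the new syllable merges
  with the one at the same vertex that can be brought to the front, and a trivial product
  disappears.\<close>

definition act :: "'v \<times> 'a \<Rightarrow> ('v \<times> 'a) list \<Rightarrow> ('v \<times> 'a) list" where
  "act s w = (let c = snd s \<otimes>\<^bsub>G (fst s)\<^esub> lead (fst s) w in
     if c = \<one>\<^bsub>G (fst s)\<^esub> then rest (fst s) w
     else if lead (fst s) w = \<one>\<^bsub>G (fst s)\<^esub> then (fst s, c) # w
     else (fst s, c) # rest (fst s) w)"

inductive shuffle :: "('v \<times> 'a) list \<Rightarrow> ('v \<times> 'a) list \<Rightarrow> bool" where
  refl: "shuffle w w"
| swap: "adj (fst s) (fst t) \<Longrightarrow> shuffle (s # t # w) (t # s # w)"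
| Cons: "shuffle w w' \<Longrightarrow> shuffle (s # w) (s # w')"
| trans: "shuffle w w' \<Longrightarrow> shuffle w' w'' \<Longrightarrow> shuffle w w''"

section \<open>Invariance under shuffling\<close>

lemma shuffle_sym: "shuffle w w' \<Longrightarrow> shuffle w' w"
  by (induction rule: shuffle.induct) (auto intro: shuffle.intros adj_sym)

lemma shuffle_lead: "shuffle w w' \<Longrightarrow> lead v w = lead v w'"
  by (induction rule: shuffle.induct) (auto dest: adj_sym simp: adj_irrefl)

lemma shuffle_rest: "shuffle w w' \<Longrightarrow> shuffle (rest v w) (rest v w')"
proof (induction rule: shuffle.induct)
  case (swap s t w)
  then show ?case
    using adj_sym[of "fst s" "fst t"] by (auto simp: adj_irrefl intro: shuffle.intros)
qed (auto intro: shuffle.intros)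

lemma shuffle_reduced: "shuffle w w' \<Longrightarrow> reduced w \<Longrightarrow> reduced w'"
proof (induction rule: shuffle.induct)
  case (swap s t w)
  then show ?case using adj_sym[of "fst s" "fst t"] by (auto simp: adj_irrefl split: if_splits)
next
  case (Cons w w' s)
  then show ?case using shuffle_lead[of w w' "fst s"] by auto
qed auto

lemma lead_closed: "reduced w \<Longrightarrow> v \<in> V \<Longrightarrow> lead v w \<in> carrier (G v)"
  by (induction w) (auto simp: group_G group.is_monoid)

text \<open>If two syllables at distinct vertices can both be brought to the front, one of them
  passes the other, which requires adjacent vertices. Nestedness of the half-spaces rests on
  this.\<close>

lemma lead_nonadj:
  assumes "lead u w \<noteq> \<one>\<^bsub>G u\<^esub>" "u \<noteq> v" "\<not> adj u v"
  shows "lead v w = \<one>\<^bsub>G v\<^esub>"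
  using assms by (induction w) (auto dest: adj_sym split: if_splits)

lemma shuffle_lead_rest:
  "lead v w \<noteq> \<one>\<^bsub>G v\<^esub> \<Longrightarrow> shuffle w ((v, lead v w) # rest v w)"
proof (induction w)
  case (Cons s w)
  then show ?case
    using shuffle.trans[OF shuffle.Cons shuffle.swap, of w "(v, lead v w)" "rest v w" s]
    by (auto intro: shuffle.refl split: if_splits)
qed simp

lemma lead_rest_eq_one: "reduced w \<Longrightarrow> lead v w \<noteq> \<one>\<^bsub>G v\<^esub> \<Longrightarrow> lead v (rest v w) = \<one>\<^bsub>G v\<^esub>"
  by (induction w) (auto split: if_splits)

lemma lead_rest_adj: "adj u v \<Longrightarrow> lead u (rest v w) = lead u w"
  by (induction w) (auto dest: adj_sym simp: adj_irrefl)

lemma rest_rest_adj: "adj u v \<Longrightarrow> rest u (rest v w) = rest v (rest u w)"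
  by (induction w) (auto dest: adj_sym simp: adj_irrefl)

lemma rest_trivial: "reduced w \<Longrightarrow> lead v w = \<one>\<^bsub>G v\<^esub> \<Longrightarrow> rest v w = w"
  by (induction w) (auto split: if_splits)

lemma reduced_rest: "reduced w \<Longrightarrow> reduced (rest v w)"
proof (induction w)
  case (Cons s w)
  then show ?case by (auto simp: lead_rest_adj)
qed simp

section \<open>Left multiplication by a syllable on reduced words\<close>

lemma act_eq:
  assumes "reduced w"
  shows "act s w = (let c = snd s \<otimes>\<^bsub>G (fst s)\<^esub> lead (fst s) w in
    if c = \<one>\<^bsub>G (fst s)\<^esub> then rest (fst s) w else (fst s, c) # rest (fst s) w)"
  using assms by (auto simp: act_def Let_def rest_trivial)

definition syllable :: "'v \<times> 'a \<Rightarrow> bool" where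
  "syllable s \<longleftrightarrow> fst s \<in> V \<and> snd s \<in> carrier (G (fst s))"

lemma lead_rest: "reduced w \<Longrightarrow> lead v (rest v w) = \<one>\<^bsub>G v\<^esub>"
  by (metis lead_rest_eq_one rest_trivial)

lemma reduced_act: "reduced w \<Longrightarrow> syllable s \<Longrightarrow> reduced (act s w)"
  by (auto simp: act_eq Let_def reduced_rest lead_rest syllable_def lead_closed group_G
        group.is_monoid monoid.m_closed)

lemma shuffle_act: "reduced w \<Longrightarrow> shuffle w w' \<Longrightarrow> shuffle (act s w) (act s w')"
  using shuffle_reduced[of w w'] shuffle_lead[of w w' "fst s"] shuffle_rest[of w w' "fst s"]
  by (auto simp: act_eq Let_def intro: shuffle.Cons)

lemma lead_act:
  assumes "reduced w" "syllable s"
  shows "lead (fst s) (act s w) = snd s \<otimes>\<^bsub>G (fst s)\<^esub> lead (fst s) w"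
  using assms by (auto simp: act_eq Let_def lead_rest)

lemma rest_act:
  assumes "reduced w"
  shows "rest (fst s) (act s w) = rest (fst s) w"
  using assms by (auto simp: act_eq Let_def rest_trivial[OF reduced_rest lead_rest])

lemma lead_act_adj:
  assumes "reduced w" "adj (fst s) v"
  shows "lead v (act s w) = lead v w"
  using assms by (auto simp: act_eq Let_def lead_rest_adj adj_sym adj_irrefl)

lemma act_mult:
  assumes "reduced w" "syllable (v, g)" "syllable (v, h)"
  shows "act (v, g) (act (v, h) w) = act (v, g \<otimes>\<^bsub>G v\<^esub> h) w"
proof -
  interpret group "G v" using assms group_G by (auto simp: syllable_def)
  show ?thesis
    using assms lead_act[of w "(v,h)"] rest_act[of w "(v,h)"] lead_closed[of w v]
    by (simp add: act_eq[OF reduced_act] act_eq[OF assms(1), of "(v, g \<otimes>\<^bsub>G v\<^esub> h)"] m_assoc syllable_def Let_def)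
qed

text \<open>A syllable at \<open>v\<close> that stands further back but can be brought to the front
  is moved there by \<open>act\<close>, so the trivial syllable acts as the identity only up to
  shuffling.\<close>

lemma act_one:
  assumes "reduced w" "v \<in> V"
  shows "shuffle (act (v, \<one>\<^bsub>G v\<^esub>) w) w"
proof -
  interpret group "G v" using assms group_G by auto
  show ?thesis
    using assms lead_closed[of w v] shuffle_lead_rest[of v w, THEN shuffle_sym]
    by (auto simp: act_eq Let_def rest_trivial intro: shuffle.refl)
qed

lemma act_commute:
  assumes "reduced w" "syllable s" "syllable t" "adj (fst s) (fst t)"
  shows "shuffle (act s (act t w)) (act t (act s w))"
proof -
  have *: "lead (fst s) (act t w) = lead (fst s) w" "lead (fst t) (act s w) = lead (fst t) w"
    using assms by (auto intro!: lead_act_adj dest: adj_sym)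
  have **: "fst s \<noteq> fst t" "adj (fst t) (fst s)" using assms adj_irrefl adj_sym by auto
  show ?thesis
    using assms * ** rest_rest_adj[of "fst s" "fst t" w]
    apply (subst (1 2) act_eq[OF reduced_act])
        apply (auto simp: Let_def)
    by (auto simp: act_eq Let_def intro: shuffle.intros)
qed

section \<open>Right multiplication changes at most a last syllable\<close>

lemma lead_append:
  "lead v w \<noteq> \<one>\<^bsub>G v\<^esub> \<Longrightarrow> lead v (w @ z) = lead v w"
  by (induction w) (auto split: if_splits)

lemma reduced_append: "reduced (w @ z) \<Longrightarrow> reduced w"
  by (induction w) (auto, metis lead_append)

lemma lead_rest_snoc:
  assumes "v \<noteq> u \<or> (\<exists>t\<in>set z. \<not> adj (fst t) v)"
  shows "lead v (z @ [(u, a)]) = lead v z" "rest v (z @ [(u, a)]) = rest v z @ [(u, a)]"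
  using assms by (induction z) auto

lemma lead_rest_snoc_adj:
  assumes "\<forall>t\<in>set z. adj (fst t) v"
  shows "lead v z = \<one>\<^bsub>G v\<^esub>" "rest v z = z" "lead v (z @ [(v, a)]) = a" "rest v (z @ [(v, a)]) = z"
  using assms by (induction z) (auto simp: adj_irrefl)

lemma shuffle_snoc_adj:
  assumes "\<forall>t\<in>set z. adj (fst t) v"
  shows "shuffle ((v, c) # z) (z @ [(v, c)])"
  using assms
proof (induction z)
  case (Cons s z)
  then have "shuffle ((v,c) # s # z) (s # (v,c) # z)"
    by (intro shuffle.swap) (auto intro: adj_sym)
  then show ?case using Cons by (auto intro: shuffle.intros)
qed (auto intro: shuffle.intros)

text \<open>Right multiplication has no direct description through \<open>act\<close>, which works
  from the left. This relation is stable under left multiplication and records that \<open>w\<close>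
  is \<open>z\<close> up to one syllable at \<open>u\<close> in last position.\<close>

definition up_to_last :: "'v \<Rightarrow> ('v \<times> 'a) list \<Rightarrow> ('v \<times> 'a) list \<Rightarrow> bool" where
  "up_to_last u z w \<longleftrightarrow> shuffle w z \<or> (\<exists>a. shuffle w (z @ [(u, a)]))"

lemma up_to_last_reduced: "up_to_last u z w \<Longrightarrow> reduced w \<Longrightarrow> reduced z"
  unfolding up_to_last_def using shuffle_reduced reduced_append by blast

text \<open>A syllable at \<open>u\<close> that commutes with all of \<open>z\<close> slides to the
  end and merges there; any other syllable acts on \<open>z\<close> and leaves a last syllable
  untouched. The new common part depends on \<open>z\<close> and \<open>s\<close> but not on
  \<open>w\<close>, so two words that share a common part continue to share one.\<close>

lemma up_to_last_act:
  assumes "up_to_last u z w" "reduced w" "syllable s"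
  shows "up_to_last u (if fst s = u \<and> (\<forall>t\<in>set z. adj (fst t) u) then z else act s z) (act s w)"
proof -
  have z: "reduced z" using assms up_to_last_reduced by blast
  consider "shuffle w z" | a where "shuffle w (z @ [(u, a)])"
    using assms unfolding up_to_last_def by blast
  then show ?thesis
  proof cases
    case 1
    then have 2: "shuffle (act s w) (act s z)" using assms shuffle_act by blast
    show ?thesis
    proof (cases "fst s = u \<and> (\<forall>t\<in>set z. adj (fst t) u)")
      case True
      interpret group "G u" using True assms group_G by (auto simp: syllable_def)
      have "act s z = (if snd s = \<one>\<^bsub>G u\<^esub> then z else (u, snd s) # z)"
        using lead_rest_snoc_adj[of z u] True assms(3)
        by (simp add: act_eq[OF z] Let_def syllable_def)
      moreover have "shuffle ((u, snd s) # z) (z @ [(u, snd s)])"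
        using True shuffle_snoc_adj by blast
      ultimately have "up_to_last u z (act s w)"
        using 2 shuffle.trans[OF 2, of "z @ [(u, snd s)]"]
        by (cases "snd s = \<one>\<^bsub>G u\<^esub>") (metis up_to_last_def)+
      then show ?thesis unfolding if_P[OF True] .
    next
      case False
      have "up_to_last u (act s z) (act s w)" using 2 by (simp add: up_to_last_def)
      then show ?thesis unfolding if_not_P[OF False] .
    qed
  next
    case 2
    let ?w = "z @ [(u, a)]"
    have 3: "shuffle (act s w) (act s ?w)" "reduced ?w" using 2 assms shuffle_act shuffle_reduced by auto
    show ?thesis
    proof (cases "fst s = u \<and> (\<forall>t\<in>set z. adj (fst t) u)")
      case True
      then have "act s ?w = (if snd s \<otimes>\<^bsub>G u\<^esub> a = \<one>\<^bsub>G u\<^esub> then z else (u, snd s \<otimes>\<^bsub>G u\<^esub> a) # z)"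
        using lead_rest_snoc_adj[of z u] by (simp add: act_eq[OF 3(2)] Let_def)
      moreover have "shuffle ((u, snd s \<otimes>\<^bsub>G u\<^esub> a) # z) (z @ [(u, snd s \<otimes>\<^bsub>G u\<^esub> a)])"
        using True shuffle_snoc_adj by blast
      ultimately have "up_to_last u z (act s w)"
        using 3(1) shuffle.trans[OF 3(1), of "z @ [(u, snd s \<otimes>\<^bsub>G u\<^esub> a)]"]
        by (cases "snd s \<otimes>\<^bsub>G u\<^esub> a = \<one>\<^bsub>G u\<^esub>") (metis up_to_last_def)+
      then show ?thesis unfolding if_P[OF True] .
    next
      case False
      then have "act s ?w = act s z @ [(u, a)]"
        using lead_rest_snoc[of "fst s" u z a] by (simp add: act_eq[OF 3(2)] act_eq[OF z] Let_def)
      then have "up_to_last u (act s z) (act s w)" using 3(1) by (metis up_to_last_def)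
      then show ?thesis unfolding if_not_P[OF False] .
    qed
  qed
qed

lemma reduced_foldr: "reduced w \<Longrightarrow> \<forall>s\<in>set x. syllable s \<Longrightarrow> reduced (foldr act x w)"
  by (induction x) (auto simp: reduced_act)

lemma shuffle_foldr:
  "reduced w \<Longrightarrow> shuffle w w' \<Longrightarrow> \<forall>s\<in>set x. syllable s \<Longrightarrow> shuffle (foldr act x w) (foldr act x w')"
  by (induction x) (auto simp: shuffle_act reduced_foldr)

definition nf :: "('v \<times> 'a) list \<Rightarrow> ('v \<times> 'a) list" where
  "nf x = foldr act x []"

lemma reduced_nf: "\<forall>s\<in>set x. syllable s \<Longrightarrow> reduced (nf x)"
  by (simp add: nf_def reduced_foldr)

text \<open>The normal forms of the empty word and of \<open>[s]\<close> have the common part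
  \<open>[]\<close>, and each further letter on the left preserves the existence of a common part. A
  last syllable at \<open>fst s\<close> is not seen by \<open>lead v\<close> for \<open>v\<close>
  different from \<open>fst s\<close>.\<close>

lemma lead_nf_snoc:
  assumes "\<forall>s\<in>set x. syllable s" "syllable s" "fst s \<noteq> v"
  shows "lead v (nf (x @ [s])) = lead v (nf x)"
proof -
  have "\<exists>z. up_to_last (fst s) z (nf x) \<and> up_to_last (fst s) z (nf (x @ [s]))"
    using assms(1)
  proof (induction x)
    case Nil
    have "up_to_last (fst s) [] []" by (auto simp: up_to_last_def intro: shuffle.refl)
    then show ?case using up_to_last_act[of "fst s" "[]" "[]" s] assms by (auto simp: nf_def)
  next
    case (Cons t x)
    then obtain z where z: "up_to_last (fst s) z (nf x)" "up_to_last (fst s) z (nf (x @ [s]))" by auto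
    have *: "nf (t # x) = act t (nf x)" "nf ((t # x) @ [s]) = act t (nf (x @ [s]))"
      by (simp_all add: nf_def)
    have "reduced (nf x)" "reduced (nf (x @ [s]))" "syllable t"
      using Cons assms by (auto intro!: reduced_nf)
    then show ?case unfolding * using up_to_last_act z by blast
  qed
  moreover have "lead v w = lead v z" if "up_to_last (fst s) z w" for z w
    using that shuffle_lead[of w _ v] lead_rest_snoc(1)[of v "fst s" z] assms(3)
    unfolding up_to_last_def by metis
  ultimately show ?thesis by metis
qed

end

section \<open>The action of the graph product on reduced words\<close>

context vertex_groups begin

section \<open>The free product as a group of classes of words\<close>

abbreviation words where "words \<equiv> syllable_words V G"
abbreviation wrel where "wrel \<equiv> word_rel V G"

lemma words_iff: "x \<in> words \<longleftrightarrow> (\<forall>s\<in>set x. syllable s)"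
  by (auto simp: syllable_words_def syllable_def in_lists_conv_set mem_Sigma_iff split: prod.splits)

lemma words_simps [simp]:
  "[] \<in> words" "s # x \<in> words \<longleftrightarrow> syllable s \<and> x \<in> words" "x @ y \<in> words \<longleftrightarrow> x \<in> words \<and> y \<in> words"
  by (auto simp: words_iff)

lemma wrel_words: "(x, y) \<in> wrel \<Longrightarrow> x \<in> words \<and> y \<in> words"
proof (induction rule: word_rel.induct)
  case (unit x y v)
  then show ?case by (auto simp: syllable_def group_G group.is_monoid)
next
  case (mult x y v g h)
  then show ?case by (auto simp: syllable_def group_G group.is_monoid monoid.m_closed)
qed auto

lemma equiv_wrel: "equiv words wrel"
  by (rule equivI) (auto simp: refl_on_def sym_def trans_def dest: wrel_words intro: word_rel.intros)

lemma wrel_append_left: "(x, y) \<in> wrel \<Longrightarrow> z \<in> words \<Longrightarrow> (z @ x, z @ y) \<in> wrel"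
proof (induction rule: word_rel.induct)
  case (unit x y v)
  then show ?case using word_rel.unit[of "z @ x" V G y v] by simp
next
  case (mult x y v g h)
  then show ?case using word_rel.mult[of "z @ x" V G y v g h] by simp
qed (auto intro: word_rel.intros)

lemma wrel_append_right: "(x, y) \<in> wrel \<Longrightarrow> z \<in> words \<Longrightarrow> (x @ z, y @ z) \<in> wrel"
proof (induction rule: word_rel.induct)
  case (unit x y v)
  then show ?case using word_rel.unit[of x V G "y @ z" v] by simp
next
  case (mult x y v g h)
  then show ?case using word_rel.mult[of x V G "y @ z" v g h] by simp
qed (auto intro: word_rel.intros)

definition cls where "cls x = wrel `` {x}"

lemma cls_eq_iff: "x \<in> words \<Longrightarrow> y \<in> words \<Longrightarrow> cls x = cls y \<longleftrightarrow> (x, y) \<in> wrel"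
  unfolding cls_def using eq_equiv_class_iff[OF equiv_wrel] by blast

abbreviation F where "F \<equiv> free_product V G"

lemma carrier_F: "carrier F = cls ` words"
  by (auto simp: free_product_def cls_def quotient_def)

lemma one_F: "\<one>\<^bsub>F\<^esub> = cls []"
  by (simp add: free_product_def cls_def)

lemma mult_F: "x \<in> words \<Longrightarrow> y \<in> words \<Longrightarrow> cls x \<otimes>\<^bsub>F\<^esub> cls y = cls (x @ y)"
proof -
  assume xy: "x \<in> words" "y \<in> words"
  have "congruent2 wrel wrel (\<lambda>x y. wrel `` {x @ y})"
    by (rule congruent2I[OF equiv_wrel equiv_wrel])
       (auto intro!: equiv_class_eq[OF equiv_wrel] wrel_append_left wrel_append_right)
  from UN_equiv_class2[OF equiv_wrel equiv_wrel this xy] show ?thesis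
    by (simp add: free_product_def cls_def)
qed

definition inv_word :: "('v \<times> 'a) list \<Rightarrow> ('v \<times> 'a) list" where
  "inv_word x = rev (map (\<lambda>s. (fst s, inv\<^bsub>G (fst s)\<^esub> snd s)) x)"

lemma inv_word_words: "x \<in> words \<Longrightarrow> inv_word x \<in> words"
  by (auto simp: words_iff inv_word_def syllable_def group_G)

lemma wrel_inv_word: "x \<in> words \<Longrightarrow> (inv_word x @ x, []) \<in> wrel"
proof (induction x)
  case (Cons s x)
  then have s: "fst s \<in> V" "snd s \<in> carrier (G (fst s))" "x \<in> words" by (auto simp: syllable_def)
  interpret group "G (fst s)" using s group_G by blast
  let ?v = "fst s" and ?g = "snd s"
  have "(inv_word x @ [(?v, inv\<^bsub>G ?v\<^esub> ?g), (?v, ?g)] @ x, inv_word x @ [(?v, \<one>\<^bsub>G ?v\<^esub>)] @ x) \<in> wrel"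
    using word_rel.mult[of "inv_word x" V G x ?v "inv\<^bsub>G ?v\<^esub> ?g" ?g] s inv_word_words by simp
  moreover have "(inv_word x @ [(?v, \<one>\<^bsub>G ?v\<^esub>)] @ x, inv_word x @ x) \<in> wrel"
    using s inv_word_words by (intro word_rel.unit) auto
  ultimately show ?case using Cons s by (auto simp: inv_word_def intro: word_rel.trans)
qed (auto simp: inv_word_def intro: word_rel.refl)

lemma group_F: "group F"
proof (rule groupI)
  show "\<exists>y\<in>carrier F. y \<otimes>\<^bsub>F\<^esub> x = \<one>\<^bsub>F\<^esub>" if "x \<in> carrier F" for x
  proof -
    obtain w where w: "x = cls w" "w \<in> words" using \<open>x \<in> carrier F\<close> by (auto simp: carrier_F)
    then show ?thesis
      by (intro bexI[of _ "cls (inv_word w)"])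
        (auto simp: mult_F inv_word_words one_F cls_eq_iff wrel_inv_word carrier_F)
  qed
qed (auto simp: carrier_F mult_F one_F)

sublocale F: group F by (rule group_F)

lemma inv_F: "x \<in> words \<Longrightarrow> inv\<^bsub>F\<^esub> (cls x) = cls (inv_word x)"
  by (rule F.inv_equality) (auto simp: mult_F inv_word_words one_F cls_eq_iff wrel_inv_word carrier_F)

section \<open>The action of words on reduced words and its kernel\<close>

lemma shuffle_wrel:
  "(x, y) \<in> wrel \<Longrightarrow> reduced w \<Longrightarrow> shuffle (foldr act x w) (foldr act y w)"
proof (induction arbitrary: w rule: word_rel.induct)
  \<comment> \<open>The two generating relations of the free product are respected by
    \<open>act_one\<close> and \<open>act_mult\<close>; letting the common left part
    \<open>x\<close> act afterwards preserves the shuffling.\<close>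
  case (unit x y v)
  then have "reduced (foldr act y w)" by (auto intro: reduced_foldr simp: words_iff)
  with unit show ?case
    by (auto intro!: shuffle_foldr act_one reduced_act simp: words_iff syllable_def group_G group.is_monoid)
next
  case (mult x y v g h)
  then have "reduced (foldr act y w)" by (auto intro: reduced_foldr simp: words_iff)
  with mult show ?case
    by (auto intro!: shuffle_foldr reduced_act shuffle.refl simp: act_mult words_iff syllable_def)
qed (auto intro: shuffle.refl shuffle.trans shuffle_sym)

definition acts_trivially where
  "acts_trivially x \<longleftrightarrow> (\<forall>w. reduced w \<longrightarrow> shuffle (foldr act x w) w)"

lemma acts_trivially_wrel: "(x, y) \<in> wrel \<Longrightarrow> acts_trivially x \<Longrightarrow> acts_trivially y"
  unfolding acts_trivially_def using shuffle_wrel shuffle_sym shuffle.trans by blast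

lemma acts_trivially_inv:
  assumes "x \<in> words" "acts_trivially x"
  shows "acts_trivially (inv_word x)"
  unfolding acts_trivially_def
proof safe
  fix w assume w: "reduced w"
  then have "shuffle (foldr act x w) w" using assms by (auto simp: acts_trivially_def)
  then have "shuffle (foldr act (inv_word x) (foldr act x w)) (foldr act (inv_word x) w)"
    using assms w inv_word_words by (intro shuffle_foldr reduced_foldr) (auto simp: words_iff)
  moreover have "shuffle (foldr act (inv_word x) (foldr act x w)) w"
    using shuffle_wrel[OF wrel_inv_word w] assms by simp
  ultimately show "shuffle (foldr act (inv_word x) w) w"
    by (blast intro: shuffle.trans shuffle_sym)
qed

lemma acts_trivially_conj:
  assumes "x \<in> words" "y \<in> words" "acts_trivially x"
  shows "acts_trivially (y @ x @ inv_word y)"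
  unfolding acts_trivially_def
proof safe
  fix w assume w: "reduced w"
  let ?w = "foldr act (inv_word y) w"
  have r: "reduced ?w" using assms w inv_word_words[of y] by (auto intro!: reduced_foldr simp: words_iff)
  then have "shuffle (foldr act y (foldr act x ?w)) (foldr act y ?w)"
    using assms by (intro shuffle_foldr reduced_foldr[OF r]) (auto simp: acts_trivially_def words_iff)
  moreover have "cls (y @ inv_word y) = cls []"
    using assms inv_word_words by (simp flip: mult_F inv_F one_F add: carrier_F)
  then have "(y @ inv_word y, []) \<in> wrel" using assms inv_word_words by (simp add: cls_eq_iff)
  then have "shuffle (foldr act y ?w) w" using shuffle_wrel w by fastforce
  ultimately show "shuffle (foldr act (y @ x @ inv_word y) w) w"
    by (auto intro: shuffle.trans)
qed

lemma acts_trivially_append: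
  "\<lbrakk>x \<in> words; y \<in> words; acts_trivially x; acts_trivially y\<rbrakk> \<Longrightarrow> acts_trivially (x @ y)"
  unfolding acts_trivially_def words_iff foldr_append comp_apply
  by (meson shuffle.trans reduced_foldr)

text \<open>This is the kernel of the action on reduced words modulo shuffling. Being normal, it
  contains the normal closure of the commutators as soon as it contains the commutators, and then
  the action descends to the graph product.\<close>

lemma normal_trivial: "cls ` {x \<in> words. acts_trivially x} \<lhd> F" (is "?N \<lhd> F")
proof (rule F.normal_invI)
  show "subgroup ?N F"
  proof (rule F.subgroupI)
    have "acts_trivially []" by (auto simp: acts_trivially_def intro: shuffle.refl)
    then show "?N \<noteq> {}" by (auto intro!: exI[of _ "[]"])
  qed (auto simp: carrier_F inv_F mult_F inv_word_words acts_trivially_inv acts_trivially_append)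
  fix x h assume "x \<in> carrier F" "h \<in> ?N"
  then obtain u w where uw: "x = cls u" "u \<in> words" "h = cls w" "w \<in> words" "acts_trivially w"
    by (auto simp: carrier_F)
  then have "x \<otimes>\<^bsub>F\<^esub> h \<otimes>\<^bsub>F\<^esub> inv\<^bsub>F\<^esub> x = cls (u @ w @ inv_word u)"
    by (simp add: mult_F inv_F inv_word_words)
  with uw show "x \<otimes>\<^bsub>F\<^esub> h \<otimes>\<^bsub>F\<^esub> inv\<^bsub>F\<^esub> x \<in> ?N"
    by (auto simp: inv_word_words acts_trivially_conj)
qed

lemma acts_trivially_commutator:
  assumes s: "syllable (u, g)" and t: "syllable (v, h)" and uv: "adj u v"
  shows "acts_trivially [(u, g), (v, h), (u, inv\<^bsub>G u\<^esub> g), (v, inv\<^bsub>G v\<^esub> h)]"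
  unfolding acts_trivially_def
proof safe
  fix w assume w: "reduced w"
  have V: "u \<in> V" "v \<in> V" "g \<in> carrier (G u)" "h \<in> carrier (G v)" using s t by (auto simp: syllable_def)
  interpret u: group "G u" using V group_G by blast
  interpret v: group "G v" using V group_G by blast
  let ?g' = "inv\<^bsub>G u\<^esub> g" and ?h' = "inv\<^bsub>G v\<^esub> h"
  have s': "syllable (u, ?g')" "syllable (v, ?h')" using V by (auto simp: syllable_def)
  let ?w = "act (v, ?h') w"
  have r: "reduced ?w" using w s' by (intro reduced_act)
  \<comment> \<open>Once \<open>h\<close> has been exchanged with \<open>g\<close>, the syllable
    \<open>g\<close> meets its inverse, and after their cancellation so does
    \<open>h\<close>.\<close>
  have "shuffle (act (u, g) (act (v, h) (act (u, ?g') ?w))) (act (v, h) (act (u, g) (act (u, ?g') ?w)))"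
    using act_commute[OF reduced_act[OF r s'(1)] s t] uv by simp
  moreover have "shuffle (act (v, h) (act (u, g) (act (u, ?g') ?w))) (act (v, h) ?w)"
    using act_one[OF r V(1)] V r shuffle_act[OF reduced_act[OF reduced_act[OF r s'(1)] s]]
    by (simp add: act_mult[OF r s s'(1)] u.r_inv)
  moreover have "shuffle (act (v, h) ?w) w"
    using act_one[OF w V(2)] V t s' w by (auto simp: act_mult)
  ultimately show "shuffle (foldr act [(u, g), (v, h), (u, ?g'), (v, ?h')] w) w"
    by (auto intro: shuffle.trans)
qed

end

section \<open>The graph product as a quotient, and its normal forms\<close>

locale graph_product_data = graph \<Gamma> + vertex_groups "verts \<Gamma>" "dominates \<Gamma>" G
  for \<Gamma> :: "('v,'e) pre_digraph" and G :: "'v \<Rightarrow> ('a,'b) monoid_scheme"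
begin

abbreviation N where "N \<equiv> normal_closure F (graph_product_relators \<Gamma> G)"

lemma relator_words:
  assumes "R \<in> graph_product_relators \<Gamma> G"
  obtains u v g h where "syllable (u, g)" "syllable (v, h)" "u \<rightarrow>\<^bsub>\<Gamma>\<^esub> v"
    "R = cls [(u, g), (v, h), (u, inv\<^bsub>G u\<^esub> g), (v, inv\<^bsub>G v\<^esub> h)]"
proof -
  from assms obtain u v g h where *: "u \<rightarrow>\<^bsub>\<Gamma>\<^esub> v" "g \<in> carrier (G u)" "h \<in> carrier (G v)"
    "R = cls [(u,g)] \<otimes>\<^bsub>F\<^esub> cls [(v,h)] \<otimes>\<^bsub>F\<^esub> inv\<^bsub>F\<^esub> cls [(u,g)] \<otimes>\<^bsub>F\<^esub> inv\<^bsub>F\<^esub> cls [(v,h)]"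
    by (auto simp: graph_product_relators_def Let_def free_product_inj_def cls_def)
  then have "u \<in> verts \<Gamma>" "v \<in> verts \<Gamma>" by auto
  with * have s: "syllable (u,g)" "syllable (v,h)" "syllable (u, inv\<^bsub>G u\<^esub> g)" "syllable (v, inv\<^bsub>G v\<^esub> h)"
    by (auto simp: syllable_def group_G)
  with * that[of u g v h] show ?thesis by (simp add: inv_F mult_F inv_word_def)
qed

lemma relators_carrier: "graph_product_relators \<Gamma> G \<subseteq> carrier F"
proof
  fix R assume "R \<in> graph_product_relators \<Gamma> G"
  then obtain u v g h where "syllable (u, g)" "syllable (v, h)"
    "R = cls [(u, g), (v, h), (u, inv\<^bsub>G u\<^esub> g), (v, inv\<^bsub>G v\<^esub> h)]" by (rule relator_words)
  then show "R \<in> carrier F" by (auto simp: carrier_F syllable_def group_G)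
qed

lemma normal_N: "N \<lhd> F"
proof (rule F.normal_invI)
  let ?S = "{N. N \<lhd> F \<and> graph_product_relators \<Gamma> G \<subseteq> N}"
  \<comment> \<open>The whole group belongs to the family, so the intersection defining the normal
    closure is over a non-empty family.\<close>
  have ne: "carrier F \<in> ?S" using relators_carrier F.normal_invI[OF F.subgroup_self] by auto
  show "subgroup N F" unfolding normal_closure_def
    using ne by (intro F.subgroups_Inter) (auto simp: normal_imp_subgroup)
  fix x h assume "x \<in> carrier F" "h \<in> N"
  then show "x \<otimes>\<^bsub>F\<^esub> h \<otimes>\<^bsub>F\<^esub> inv\<^bsub>F\<^esub> x \<in> N"
    by (auto simp: normal_closure_def intro: normal.inv_op_closed2)
qed

sublocale N: normal N F by (rule normal_N)

lemma relators_N: "graph_product_relators \<Gamma> G \<subseteq> N"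
  by (auto simp: normal_closure_def)

lemma N_trivial: "x \<in> words \<Longrightarrow> cls x \<in> N \<Longrightarrow> acts_trivially x"
proof -
  assume x: "x \<in> words" "cls x \<in> N"
  have "graph_product_relators \<Gamma> G \<subseteq> cls ` {x \<in> words. acts_trivially x}"
  proof
    fix R assume "R \<in> graph_product_relators \<Gamma> G"
    then obtain u v g h where "syllable (u, g)" "syllable (v, h)" "u \<rightarrow>\<^bsub>\<Gamma>\<^esub> v"
      "R = cls [(u, g), (v, h), (u, inv\<^bsub>G u\<^esub> g), (v, inv\<^bsub>G v\<^esub> h)]" by (rule relator_words)
    then show "R \<in> cls ` {x \<in> words. acts_trivially x}"
      by (intro image_eqI CollectI conjI) (auto intro!: acts_trivially_commutator simp: syllable_def group_G)
  qed
  then have "cls x \<in> cls ` {x \<in> words. acts_trivially x}"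
    using x normal_trivial unfolding normal_closure_def by blast
  then obtain y where "y \<in> words" "acts_trivially y" "cls x = cls y" by auto
  with x show ?thesis using acts_trivially_wrel cls_eq_iff by metis
qed

abbreviation P where "P \<equiv> graph_product \<Gamma> G"

sublocale P: group P
  unfolding graph_product_def by (rule N.factorgroup_is_group)

definition elt where "elt x = N #>\<^bsub>F\<^esub> cls x"

lemma carrier_P: "carrier P = elt ` words"
  by (auto simp: graph_product_def FactGroup_def RCOSETS_def carrier_F elt_def)

lemma elt_append: "x \<in> words \<Longrightarrow> y \<in> words \<Longrightarrow> elt (x @ y) = elt x \<otimes>\<^bsub>P\<^esub> elt y"
  by (simp add: graph_product_def FactGroup_def elt_def N.rcos_sum carrier_F mult_F)

lemma elt_Nil: "elt [] = \<one>\<^bsub>P\<^esub>"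
  using F.coset_mult_one[OF N.subset] by (simp add: graph_product_def FactGroup_def elt_def one_F)

lemma elt_closed [simp]: "x \<in> words \<Longrightarrow> elt x \<in> carrier P"
  by (auto simp: carrier_P)

lemma elt_wrel: "(x, y) \<in> wrel \<Longrightarrow> elt x = elt y"
  using wrel_words cls_eq_iff by (metis elt_def)

text \<open>Two words for the same element differ by an element of \<open>N\<close>, which acts
  trivially on reduced words. This is the uniqueness half of the normal form theorem; every later
  proof that an element is non-trivial comes from it through \<open>proj\<close>.\<close>

lemma elt_eq_shuffle:
  assumes "x \<in> words" "y \<in> words" "elt x = elt y"
  shows "shuffle (nf x) (nf y)"
proof -
  have "cls x \<in> N #>\<^bsub>F\<^esub> cls y"
    using assms F.rcos_self[OF _ N.is_subgroup, of "cls x"] by (auto simp: elt_def carrier_F)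
  then obtain n where n: "n \<in> N" "cls x = n \<otimes>\<^bsub>F\<^esub> cls y" by (auto simp: r_coset_def)
  then obtain z where z: "z \<in> words" "n = cls z" using N.subset carrier_F by auto
  with n assms have "(x, z @ y) \<in> wrel" by (simp add: mult_F flip: cls_eq_iff)
  then have "shuffle (nf x) (foldr act z (nf y))" using shuffle_wrel[of x "z @ y" "[]"]
    by (simp add: nf_def)
  moreover have "shuffle (foldr act z (nf y)) (nf y)"
    using N_trivial[of z] z n assms reduced_nf[of y] by (auto simp: acts_trivially_def words_iff)
  ultimately show ?thesis by (rule shuffle.trans)
qed

text \<open>Geometrically this is the nearest-point projection of \<open>X\<close> to the vertex
  group at \<open>v\<close>. The chosen word does not matter, because \<open>lead\<close> is
  invariant under shuffling and normal forms are unique up to shuffling.\<close>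

definition proj :: "'v \<Rightarrow> ('v \<times> 'a) list set set \<Rightarrow> 'a" where
  "proj v X = lead v (nf (SOME x. x \<in> words \<and> X = elt x))"

lemma proj_elt: "x \<in> words \<Longrightarrow> proj v (elt x) = lead v (nf x)"
proof -
  assume x: "x \<in> words"
  let ?y = "SOME y. y \<in> words \<and> elt x = elt y"
  have "?y \<in> words \<and> elt x = elt ?y" using x by (intro someI) auto
  then have "shuffle (nf x) (nf ?y)" using elt_eq_shuffle[OF x] by blast
  from shuffle_lead[OF this] show ?thesis by (simp add: proj_def)
qed

section \<open>Vertex groups inside the graph product\<close>

definition emb :: "'v \<Rightarrow> 'a \<Rightarrow> ('v \<times> 'a) list set set" where
  "emb v g = elt [(v, g)]"

lemma vertex_group_eq: "vertex_group \<Gamma> G v = emb v ` carrier (G v)"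
  by (auto simp: vertex_group_def emb_def elt_def free_product_inj_def cls_def)

lemma emb_closed: "v \<in> verts \<Gamma> \<Longrightarrow> g \<in> carrier (G v) \<Longrightarrow> emb v g \<in> carrier P"
  by (simp add: emb_def syllable_def)

lemma emb_one: "v \<in> verts \<Gamma> \<Longrightarrow> emb v \<one>\<^bsub>G v\<^esub> = \<one>\<^bsub>P\<^esub>"
  using elt_wrel[OF word_rel.unit[of "[]" "verts \<Gamma>" G "[]" v]] by (simp add: emb_def elt_Nil)

lemma emb_mult:
  assumes "v \<in> verts \<Gamma>" "g \<in> carrier (G v)" "h \<in> carrier (G v)"
  shows "emb v (g \<otimes>\<^bsub>G v\<^esub> h) = emb v g \<otimes>\<^bsub>P\<^esub> emb v h"
  using elt_wrel[OF word_rel.mult[of "[]" "verts \<Gamma>" G "[]" v g h]] assms elt_append[of "[(v,g)]" "[(v,h)]"]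
  by (simp add: emb_def syllable_def)

lemma emb_commute:
  assumes "u \<rightarrow>\<^bsub>\<Gamma>\<^esub> v" "g \<in> carrier (G u)" "h \<in> carrier (G v)"
  shows "emb u g \<otimes>\<^bsub>P\<^esub> emb v h = emb v h \<otimes>\<^bsub>P\<^esub> emb u g"
proof -
  have s: "syllable (u,g)" "syllable (v,h)" using assms by (auto simp: syllable_def)
  let ?a = "cls [(u,g)]" and ?b = "cls [(v,h)]"
  have c: "?a \<in> carrier F" "?b \<in> carrier F" using s by (auto simp: carrier_F)
  have "?a \<otimes>\<^bsub>F\<^esub> ?b \<otimes>\<^bsub>F\<^esub> inv\<^bsub>F\<^esub> ?a \<otimes>\<^bsub>F\<^esub> inv\<^bsub>F\<^esub> ?b \<in> N"
    using relators_N assms by (force simp: graph_product_relators_def Let_def free_product_inj_def cls_def)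
  moreover have "?a \<otimes>\<^bsub>F\<^esub> ?b \<otimes>\<^bsub>F\<^esub> inv\<^bsub>F\<^esub> ?a \<otimes>\<^bsub>F\<^esub> inv\<^bsub>F\<^esub> ?b = (?a \<otimes>\<^bsub>F\<^esub> ?b) \<otimes>\<^bsub>F\<^esub> inv\<^bsub>F\<^esub> (?b \<otimes>\<^bsub>F\<^esub> ?a)"
    using c by (simp add: F.m_assoc F.inv_mult_group)
  ultimately have "?a \<otimes>\<^bsub>F\<^esub> ?b \<in> N #>\<^bsub>F\<^esub> (?b \<otimes>\<^bsub>F\<^esub> ?a)"
    using N.rcos_module[OF F.is_group, of "?b \<otimes>\<^bsub>F\<^esub> ?a" "?a \<otimes>\<^bsub>F\<^esub> ?b"] c by simp
  then have "N #>\<^bsub>F\<^esub> (?a \<otimes>\<^bsub>F\<^esub> ?b) = N #>\<^bsub>F\<^esub> (?b \<otimes>\<^bsub>F\<^esub> ?a)"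
    using F.repr_independence[OF _ _ N.is_subgroup] c by simp
  then have "elt ([(u,g)] @ [(v,h)]) = elt ([(v,h)] @ [(u,g)])"
    using s mult_F[of "[(u,g)]" "[(v,h)]"] mult_F[of "[(v,h)]" "[(u,g)]"] by (simp add: elt_def)
  then show ?thesis using s elt_append[of "[(u,g)]" "[(v,h)]"] elt_append[of "[(v,h)]" "[(u,g)]"]
    by (simp add: emb_def)
qed

lemma generators_induct [consumes 1, case_names one mult]:
  assumes "X \<in> carrier P" "Q \<one>\<^bsub>P\<^esub>"
    and "\<And>v g Y. \<lbrakk>v \<in> verts \<Gamma>; g \<in> carrier (G v); Y \<in> carrier P; Q Y\<rbrakk> \<Longrightarrow> Q (emb v g \<otimes>\<^bsub>P\<^esub> Y)"
  shows "Q X"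
proof -
  obtain x where x: "x \<in> words" "X = elt x" using assms(1) carrier_P by auto
  have "Q (elt x)" using x(1)
  proof (induction x)
    case (Cons s x)
    then have "elt (s # x) = emb (fst s) (snd s) \<otimes>\<^bsub>P\<^esub> elt x"
      using elt_append[of "[s]" x] by (simp add: emb_def)
    with Cons assms(3) show ?case by (simp add: syllable_def)
  qed (use assms(2) elt_Nil in simp)
  with x show ?thesis by simp
qed

section \<open>How projections change under multiplication\<close>

lemma proj_one: "proj v \<one>\<^bsub>P\<^esub> = \<one>\<^bsub>G v\<^esub>"
  using proj_elt[of "[]" v] by (simp add: elt_Nil nf_def)

text \<open>By \<open>lead_nf_snoc\<close>, moving inside a coset of one vertex group is not noticed
  by the projection to another. All control over edges of the electrification derives from
  this.\<close>

lemma proj_mult_right: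
  assumes "X \<in> carrier P" "u \<in> verts \<Gamma>" "g \<in> carrier (G u)" "u \<noteq> v"
  shows "proj v (X \<otimes>\<^bsub>P\<^esub> emb u g) = proj v X"
  using assms lead_nf_snoc[of _ "(u, g)" v]
  by (auto simp: carrier_P emb_def proj_elt words_iff syllable_def simp flip: elt_append)

lemma proj_mult_left:
  assumes "X \<in> carrier P" "v \<in> verts \<Gamma>" "g \<in> carrier (G v)"
  shows "proj v (emb v g \<otimes>\<^bsub>P\<^esub> X) = g \<otimes>\<^bsub>G v\<^esub> proj v X"
proof -
  obtain x where x: "x \<in> words" "X = elt x" using assms carrier_P by auto
  then show ?thesis using assms lead_act[of "nf x" "(v, g)"] reduced_nf[of x]
    by (simp add: emb_def proj_elt words_iff syllable_def nf_def flip: elt_append)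
qed

lemma proj_mult_left_adj:
  assumes "X \<in> carrier P" "u \<rightarrow>\<^bsub>\<Gamma>\<^esub> v" "g \<in> carrier (G u)"
  shows "proj v (emb u g \<otimes>\<^bsub>P\<^esub> X) = proj v X"
proof -
  obtain x where x: "x \<in> words" "X = elt x" using assms carrier_P by auto
  moreover have "u \<in> verts \<Gamma>" using assms by auto
  ultimately show ?thesis using assms lead_act_adj[of "nf x" "(u, g)" v] reduced_nf[of x]
    by (simp add: emb_def proj_elt words_iff syllable_def nf_def flip: elt_append)
qed

lemma proj_nonadj:
  assumes "X \<in> carrier P" "proj u X \<noteq> \<one>\<^bsub>G u\<^esub>" "u \<noteq> v" "\<not> u \<rightarrow>\<^bsub>\<Gamma>\<^esub> v"
  shows "proj v X = \<one>\<^bsub>G v\<^esub>"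
  using assms lead_nonadj by (auto simp: carrier_P proj_elt)

end

section \<open>Minsquare subgraphs and the core\<close>

definition square :: "('v \<Rightarrow> 'v \<Rightarrow> bool) \<Rightarrow> 'v \<Rightarrow> 'v \<Rightarrow> 'v \<Rightarrow> 'v \<Rightarrow> bool" where
  "square adj a b c d \<longleftrightarrow> distinct [a, b, c, d] \<and> adj a b \<and> adj b c \<and> adj c d \<and> adj d a \<and>
     \<not> adj a c \<and> \<not> adj b d"

text \<open>Only the diagonal \<open>a\<close>, \<open>c\<close> is tested, since a square may be
  rotated to exchange its diagonals. Phrasing this for vertex sets and a bare relation lets a graph
  and its induced subgraphs be compared on the same sets.\<close>

definition closed_under_squares :: "('v \<Rightarrow> 'v \<Rightarrow> bool) \<Rightarrow> 'v set \<Rightarrow> 'v set \<Rightarrow> bool" where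
  "closed_under_squares adj V A \<longleftrightarrow> A \<noteq> {} \<and> A \<subseteq> V \<and>
     (\<forall>a b c d. {a, b, c, d} \<subseteq> V \<and> square adj a b c d \<and> a \<in> A \<and> c \<in> A \<longrightarrow> b \<in> A \<and> d \<in> A)"

definition contains_square :: "('v \<Rightarrow> 'v \<Rightarrow> bool) \<Rightarrow> 'v set \<Rightarrow> bool" where
  "contains_square adj A \<longleftrightarrow> (\<exists>a b c d. {a, b, c, d} \<subseteq> A \<and> square adj a b c d)"

definition minsquare_set :: "('v \<Rightarrow> 'v \<Rightarrow> bool) \<Rightarrow> 'v set \<Rightarrow> 'v set \<Rightarrow> bool" where
  "minsquare_set adj V A \<longleftrightarrow> closed_under_squares adj V A \<and> contains_square adj A \<and>
     (\<forall>B. closed_under_squares adj V B \<and> contains_square adj B \<and> B \<subseteq> A \<longrightarrow> B = A)"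

lemma closed_under_squaresD:
  assumes "closed_under_squares adj V A" "{a, b, c, d} \<subseteq> V" "square adj a b c d" "a \<in> A" "c \<in> A"
  shows "b \<in> A \<and> d \<in> A"
  using assms unfolding closed_under_squares_def by blast

lemma closed_under_squares_Int:
  assumes "closed_under_squares adj V A" "closed_under_squares adj V B" "A \<inter> B \<noteq> {}"
  shows "closed_under_squares adj V (A \<inter> B)"
proof -
  have "b \<in> A \<inter> B \<and> d \<in> A \<inter> B"
    if "{a, b, c, d} \<subseteq> V" "square adj a b c d" "a \<in> A \<inter> B" "c \<in> A \<inter> B" for a b c d
    using closed_under_squaresD[OF assms(1) that(1,2)] closed_under_squaresD[OF assms(2) that(1,2)] that by simp
  then show ?thesis using assms unfolding closed_under_squares_def by blast
qed

section \<open>Translation between induced subgraphs and vertex sets\<close>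

lemma dominates_induced:
  assumes "induced_subgraph \<Lambda> \<Gamma>"
  shows "u \<rightarrow>\<^bsub>\<Lambda>\<^esub> v \<longleftrightarrow> u \<in> verts \<Lambda> \<and> v \<in> verts \<Lambda> \<and> u \<rightarrow>\<^bsub>\<Gamma>\<^esub> v"
proof -
  have h: "arcs \<Lambda> = {e \<in> arcs \<Gamma>. tail \<Gamma> e \<in> verts \<Lambda> \<and> head \<Gamma> e \<in> verts \<Lambda>}"
    "tail \<Lambda> = tail \<Gamma>" "head \<Lambda> = head \<Gamma>"
    using assms by (simp_all add: induced_subgraph_def subgraph_def compatible_def)
  show ?thesis unfolding arcs_ends_conv h by auto
qed

lemma induced_subgraph_eq:
  "induced_subgraph \<Lambda> \<Gamma> \<Longrightarrow> \<Lambda> = \<Gamma> \<restriction> verts \<Lambda>"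
  by (auto simp: induce_subgraph_def induced_subgraph_def subgraph_def compatible_def)

lemma induced_subgraph_restrict:
  "wf_digraph \<Gamma> \<Longrightarrow> A \<subseteq> verts \<Gamma> \<Longrightarrow> induced_subgraph (\<Gamma> \<restriction> A) \<Gamma>"
  by (auto intro: wf_digraph.induced_induce)

lemma subgraph_iff_verts:
  assumes "induced_subgraph S \<Gamma>" "induced_subgraph \<Lambda> \<Gamma>"
  shows "subgraph S \<Lambda> \<longleftrightarrow> verts S \<subseteq> verts \<Lambda>"
  using assms by (auto simp: induced_subgraph_def subgraph_def compatible_def)

lemma induced_square_iff:
  "induced_square S \<Gamma> \<longleftrightarrow> induced_subgraph S \<Gamma> \<and>
     (\<exists>a b c d. verts S = {a, b, c, d} \<and> square (dominates \<Gamma>) a b c d)"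
  unfolding induced_square_def nonempty_induced_subgraph_def square_def by auto

context graph begin

lemma dominates_sym: "u \<rightarrow>\<^bsub>G\<^esub> v \<Longrightarrow> v \<rightarrow>\<^bsub>G\<^esub> u"
  using sym_arcs by (auto simp: symmetric_def sym_def)

lemma dominates_irrefl: "\<not> v \<rightarrow>\<^bsub>G\<^esub> v"
  using no_loops by (auto simp: arcs_ends_conv)

lemma square_rotate: "square (dominates G) a b c d \<Longrightarrow> square (dominates G) b c d a"
  unfolding square_def using dominates_sym by auto

lemma square_complete_iff:
  "square_complete \<Lambda> G \<longleftrightarrow> induced_subgraph \<Lambda> G \<and> closed_under_squares (dominates G) (verts G) (verts \<Lambda>)"
proof safe
  assume *: "square_complete \<Lambda> G"
  then show i: "induced_subgraph \<Lambda> G" by (simp add: square_complete_def nonempty_induced_subgraph_def)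
  show "closed_under_squares (dominates G) (verts G) (verts \<Lambda>)"
    unfolding closed_under_squares_def
  proof (intro conjI allI impI; (elim conjE)?)
    fix a b c d assume sq: "{a, b, c, d} \<subseteq> verts G" "square (dominates G) a b c d" "a \<in> verts \<Lambda>" "c \<in> verts \<Lambda>"
    let ?S = "G \<restriction> {a, b, c, d}"
    have S: "induced_square ?S G" using sq induced_subgraph_restrict[OF wf_digraph sq(1)]
      by (auto simp: induced_square_iff)
    moreover have "a \<noteq> c" "\<not> a \<rightarrow>\<^bsub>G\<^esub> c" using sq by (auto simp: square_def)
    moreover have "a \<in> verts ?S \<inter> verts \<Lambda>" "c \<in> verts ?S \<inter> verts \<Lambda>" using sq by auto
    ultimately have "subgraph ?S \<Lambda>" using * unfolding square_complete_def by blast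
    then show "b \<in> verts \<Lambda>" "d \<in> verts \<Lambda>" by (auto simp: subgraph_def)
  qed (use * in \<open>auto simp: square_complete_def nonempty_induced_subgraph_def induced_subgraph_def subgraph_def\<close>)
next
  assume i: "induced_subgraph \<Lambda> G" and c: "closed_under_squares (dominates G) (verts G) (verts \<Lambda>)"
  show "square_complete \<Lambda> G" unfolding square_complete_def
  proof (intro conjI allI impI; (elim conjE exE)?)
    show "nonempty_induced_subgraph \<Lambda> G"
      using i c by (auto simp: nonempty_induced_subgraph_def closed_under_squares_def)
    fix S x y assume S: "induced_square S G" and xy: "x \<in> verts S \<inter> verts \<Lambda>" "y \<in> verts S \<inter> verts \<Lambda>"
      "x \<noteq> y" "\<not> x \<rightarrow>\<^bsub>G\<^esub> y"
    from S obtain a b c d where v: "verts S = {a, b, c, d}" and sq: "square (dominates G) a b c d"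
      by (auto simp: induced_square_iff)
    have *: "verts S \<subseteq> verts G" using S by (auto simp: induced_square_iff induced_subgraph_def subgraph_def)
    have "(a \<in> verts \<Lambda> \<and> c \<in> verts \<Lambda>) \<or> (b \<in> verts \<Lambda> \<and> d \<in> verts \<Lambda>)"
      using xy sq dominates_sym v unfolding square_def by auto
    moreover have "b \<in> verts \<Lambda> \<and> d \<in> verts \<Lambda>" if "a \<in> verts \<Lambda> \<and> c \<in> verts \<Lambda>"
      using c sq that * v unfolding closed_under_squares_def by blast
    moreover have "{b, c, d, a} \<subseteq> verts G" using * v by auto
    then have "c \<in> verts \<Lambda> \<and> a \<in> verts \<Lambda>" if "b \<in> verts \<Lambda> \<and> d \<in> verts \<Lambda>"
      using c square_rotate[OF sq] that unfolding closed_under_squares_def by blast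
    ultimately have "verts S \<subseteq> verts \<Lambda>" unfolding v by blast
    then show "subgraph S \<Lambda>" using S i subgraph_iff_verts by (auto simp: induced_square_iff)
  qed
qed

lemma contains_induced_square_iff:
  assumes "induced_subgraph \<Lambda> G"
  shows "(\<exists>S. induced_square S \<Lambda>) \<longleftrightarrow> contains_square (dominates G) (verts \<Lambda>)"
proof
  assume "\<exists>S. induced_square S \<Lambda>"
  then obtain S a b c d where "induced_subgraph S \<Lambda>" "verts S = {a,b,c,d}" "square (dominates \<Lambda>) a b c d"
    by (auto simp: induced_square_iff)
  then have "{a,b,c,d} \<subseteq> verts \<Lambda>" "square (dominates G) a b c d"
    by (auto simp: square_def dominates_induced[OF assms] induced_subgraph_def subgraph_def)
  then show "contains_square (dominates G) (verts \<Lambda>)" unfolding contains_square_def by blast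
next
  assume "contains_square (dominates G) (verts \<Lambda>)"
  then obtain a b c d where sq: "{a,b,c,d} \<subseteq> verts \<Lambda>" "square (dominates G) a b c d"
    by (auto simp: contains_square_def)
  have wf: "wf_digraph \<Lambda>" using assms by (auto simp: induced_subgraph_def subgraph_def)
  have "square (dominates \<Lambda>) a b c d" using sq by (auto simp: square_def dominates_induced[OF assms])
  then have "induced_square (\<Lambda> \<restriction> {a,b,c,d}) \<Lambda>"
    using induced_subgraph_restrict[OF wf sq(1)] by (auto simp: induced_square_iff)
  then show "\<exists>S. induced_square S \<Lambda>" ..
qed

lemma minsquare_subgraph_iff:
  "minsquare_subgraph \<Lambda> G \<longleftrightarrow> induced_subgraph \<Lambda> G \<and> minsquare_set (dominates G) (verts G) (verts \<Lambda>)"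
proof -
  have sw: "square_complete_with_square \<Lambda> G \<longleftrightarrow> induced_subgraph \<Lambda> G \<and>
      closed_under_squares (dominates G) (verts G) (verts \<Lambda>) \<and> contains_square (dominates G) (verts \<Lambda>)" for \<Lambda>
    unfolding square_complete_with_square_def square_complete_iff using contains_induced_square_iff by auto
  show ?thesis
  proof safe
    assume *: "minsquare_subgraph \<Lambda> G"
    then show i: "induced_subgraph \<Lambda> G" by (simp add: minsquare_subgraph_def sw)
    show "minsquare_set (dominates G) (verts G) (verts \<Lambda>)" unfolding minsquare_set_def
    proof (intro conjI allI impI; (elim conjE)?)
      fix B assume B: "closed_under_squares (dominates G) (verts G) B" "contains_square (dominates G) B" "B \<subseteq> verts \<Lambda>"
      then have iB: "induced_subgraph (G \<restriction> B) G"
        by (intro induced_subgraph_restrict wf_digraph) (auto simp: closed_under_squares_def)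
      then have "square_complete_with_square (G \<restriction> B) G" "subgraph (G \<restriction> B) \<Lambda>"
        using B i subgraph_iff_verts[OF iB i] by (auto simp: sw)
      then have "G \<restriction> B = \<Lambda>" using * by (auto simp: minsquare_subgraph_def)
      then show "B = verts \<Lambda>" by (metis induce_subgraph_verts)
    qed (use * in \<open>auto simp: minsquare_subgraph_def sw\<close>)
  next
    assume i: "induced_subgraph \<Lambda> G" and m: "minsquare_set (dominates G) (verts G) (verts \<Lambda>)"
    show "minsquare_subgraph \<Lambda> G" unfolding minsquare_subgraph_def sw
    proof (intro conjI allI impI; (elim conjE)?)
      fix \<Lambda>' assume *: "induced_subgraph \<Lambda>' G" "closed_under_squares (dominates G) (verts G) (verts \<Lambda>')"
         "contains_square (dominates G) (verts \<Lambda>')" "subgraph \<Lambda>' \<Lambda>"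
      then have "verts \<Lambda>' = verts \<Lambda>" using m by (auto simp: minsquare_set_def subgraph_def)
      then show "\<Lambda>' = \<Lambda>" using induced_subgraph_eq[OF i] induced_subgraph_eq[OF *(1)] by simp
    qed (use i m in \<open>auto simp: minsquare_set_def\<close>)
  qed
qed

lemma minsquare_graph_iff: "minsquare_graph G \<longleftrightarrow> minsquare_set (dominates G) (verts G) (verts G)"
  unfolding minsquare_graph_def minsquare_subgraph_iff
  by (auto simp: induced_subgraph_def subgraph_def compatible_def wf_digraph)

section \<open>The core and the join decomposition\<close>

definition core :: "'a set" where
  "core = {v \<in> verts G. \<exists>w\<in>verts G. w \<noteq> v \<and> \<not> v \<rightarrow>\<^bsub>G\<^esub> w}"

lemma square_core:
  assumes "{a, b, c, d} \<subseteq> verts G" "square (dominates G) a b c d"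
  shows "{a, b, c, d} \<subseteq> core"
proof -
  have "a \<in> core" "c \<in> core" if "{a, b, c, d} \<subseteq> verts G" "square (dominates G) a b c d" for a b c d
  proof -
    have "a \<noteq> c" "\<not> a \<rightarrow>\<^bsub>G\<^esub> c" "\<not> c \<rightarrow>\<^bsub>G\<^esub> a" using that dominates_sym by (auto simp: square_def)
    with that show "a \<in> core" "c \<in> core" unfolding core_def by auto
  qed
  from this[OF assms] this[OF _ square_rotate[OF assms(2)]] assms(1) show ?thesis by auto
qed

lemma closed_under_squares_core:
  "core \<noteq> {} \<Longrightarrow> closed_under_squares (dominates G) (verts G) core"
  using square_core unfolding closed_under_squares_def by (auto simp: core_def)

text \<open>Squares lie in the core, so intersecting \<open>A\<close> with the core keeps its square
  and keeps it closed under squares; minimality then forbids the intersection from being smaller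
  than \<open>A\<close>.\<close>

lemma minsquare_set_subset_core:
  assumes "minsquare_set (dominates G) (verts G) A"
  shows "A \<subseteq> core"
proof -
  obtain a b c d where sq: "{a,b,c,d} \<subseteq> A" "square (dominates G) a b c d"
    using assms by (auto simp: minsquare_set_def contains_square_def)
  have AV: "A \<subseteq> verts G" using assms by (auto simp: minsquare_set_def closed_under_squares_def)
  have "{a,b,c,d} \<subseteq> core" using sq AV by (intro square_core) auto
  then have "closed_under_squares (dominates G) (verts G) core" using closed_under_squares_core by blast
  then have "closed_under_squares (dominates G) (verts G) (A \<inter> core)"
    using assms sq \<open>{a,b,c,d} \<subseteq> core\<close> by (intro closed_under_squares_Int) (auto simp: minsquare_set_def)
  moreover have "contains_square (dominates G) (A \<inter> core)"
    unfolding contains_square_def using sq \<open>{a,b,c,d} \<subseteq> core\<close> by blast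
  ultimately have "A \<inter> core = A" using assms by (auto simp: minsquare_set_def)
  then show ?thesis by auto
qed

text \<open>Since all squares lie in the core, closure under squares of a subset of the core is the
  same condition relative to the core and relative to the whole graph.\<close>

lemma minsquare_set_core_restrict:
  assumes "A = core \<or> A = verts G"
  shows "minsquare_set (dominates G) A core \<longleftrightarrow> minsquare_set (dominates G) (verts G) core"
proof -
  have "closed_under_squares (dominates G) A B \<longleftrightarrow> closed_under_squares (dominates G) (verts G) B"
    if "B \<subseteq> core" for B
  proof (cases "A = verts G")
    case False
    have *: "({a,b,c,d} \<subseteq> core \<and> square (dominates G) a b c d \<and> R) = ({a,b,c,d} \<subseteq> verts G \<and> square (dominates G) a b c d \<and> R)"
      for a b c d R
    proof -
      have "core \<subseteq> verts G" by (auto simp: core_def)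
      then show ?thesis using square_core[of a b c d] by (meson order_trans)
    qed
    have "B \<subseteq> core \<and> B \<subseteq> verts G" using that by (auto simp: core_def)
    moreover have "A = core" using assms False by simp
    ultimately show ?thesis by (simp only: closed_under_squares_def *)
  qed simp
  then show ?thesis unfolding minsquare_set_def by auto
qed

lemma complete_graph_iff: "complete_graph G \<longleftrightarrow> core = {}"
proof
  assume "complete_graph G"
  then show "core = {}" by (auto simp: complete_graph_def complete_digraph_def core_def)
next
  assume "core = {}"
  then show "complete_graph G" using graph_axioms dominates_irrefl
    by (auto simp: complete_graph_def complete_digraph_def core_def intro: graph.intro)
qed

end

lemma (in graph) graph_induced: "induced_subgraph \<Lambda> G \<Longrightarrow> graph \<Lambda>"
proof -
  assume i: "induced_subgraph \<Lambda> G"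
  then have "symmetric \<Lambda>"
    using dominates_sym dominates_induced[OF i] by (auto simp: symmetric_def sym_def)
  with digraphI_induced[OF i] show ?thesis by (rule digraph.graphI)
qed

lemma minsquare_set_cong:
  assumes "\<And>u v. u \<in> V \<Longrightarrow> v \<in> V \<Longrightarrow> adj u v = adj' u v" "A \<subseteq> V"
  shows "minsquare_set adj V A \<longleftrightarrow> minsquare_set adj' V A"
proof -
  have sq: "square adj a b c d \<longleftrightarrow> square adj' a b c d" if "{a,b,c,d} \<subseteq> V" for a b c d
    using that assms by (auto simp: square_def)
  have *: "({a,b,c,d} \<subseteq> V \<and> square adj a b c d \<and> R) = ({a,b,c,d} \<subseteq> V \<and> square adj' a b c d \<and> R)"
    for a b c d R using sq by blast
  have 1: "closed_under_squares adj V B \<longleftrightarrow> closed_under_squares adj' V B" for B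
    by (simp only: closed_under_squares_def *)
  have 2: "contains_square adj B \<longleftrightarrow> contains_square adj' B" if "B \<subseteq> V" for B
  proof -
    have "({a,b,c,d} \<subseteq> B \<and> square adj a b c d) = ({a,b,c,d} \<subseteq> B \<and> square adj' a b c d)" for a b c d
      using sq[of a b c d] that by (meson order_trans)
    then show ?thesis by (simp only: contains_square_def)
  qed
  have 3: "(closed_under_squares adj V B \<and> contains_square adj B \<and> B \<subseteq> A \<longrightarrow> B = A) =
    (closed_under_squares adj' V B \<and> contains_square adj' B \<and> B \<subseteq> A \<longrightarrow> B = A)" for B
    using 1[of B] 2[of B] assms(2) by auto
  show ?thesis unfolding minsquare_set_def 3 using 1[of A] 2[OF assms(2)] by simp
qed

text \<open>The three alternatives of the first claim are one condition on the core: it is empty, or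
  it is minsquare and either everything or the first factor of a join whose second factor consists
  of the remaining vertices.\<close>

lemma (in graph) core_minsquare_iff:
  "core = {} \<or> minsquare_set (dominates G) (verts G) core \<longleftrightarrow>
     complete_graph G \<or> minsquare_graph G \<or>
     (\<exists>\<Lambda>\<^sub>1 \<Lambda>\<^sub>2. is_join G \<Lambda>\<^sub>1 \<Lambda>\<^sub>2 \<and> minsquare_graph \<Lambda>\<^sub>1 \<and> complete_graph \<Lambda>\<^sub>2)"
  (is "?L \<longleftrightarrow> ?R")
proof
  assume L: ?L
  show ?R
  proof (cases "core = {} \<or> core = verts G")
    case True
    then show ?thesis using L by (auto simp: complete_graph_iff minsquare_graph_iff)
  next
    case False
    let ?A = "G \<restriction> core" and ?B = "G \<restriction> (verts G - core)"
    have cV: "core \<subseteq> verts G" by (auto simp: core_def)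
    have A: "induced_subgraph ?A G" and B: "induced_subgraph ?B G"
      using cV by (auto intro!: induced_subgraph_restrict wf_digraph)
    have across: "x \<rightarrow>\<^bsub>G\<^esub> y" if "x \<in> core" "y \<in> verts G - core" for x y
    proof -
      have "x \<noteq> y" using that by auto
      then have "y \<rightarrow>\<^bsub>G\<^esub> x" using that by (auto simp: core_def)
      then show ?thesis by (rule dominates_sym)
    qed
    have "is_join G ?A ?B" unfolding is_join_def nonempty_induced_subgraph_def
      using A B False cV across by auto
    moreover have "minsquare_graph ?A"
    proof -
      have "minsquare_set (dominates G) core core" using L False minsquare_set_core_restrict[of core] by blast
      moreover have "u \<rightarrow>\<^bsub>?A\<^esub> v \<longleftrightarrow> u \<rightarrow>\<^bsub>G\<^esub> v" if "u \<in> core" "v \<in> core" for u v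
        using that dominates_induced[OF A] by simp
      ultimately have "minsquare_set (dominates ?A) core core"
        using minsquare_set_cong[of core "dominates ?A" "dominates G" core] by blast
      then show ?thesis using graph.minsquare_graph_iff[OF graph_induced[OF A]] by simp
    qed
    moreover have "complete_graph ?B"
    proof -
      have "v \<rightarrow>\<^bsub>?B\<^esub> w" if "v \<in> verts ?B" "w \<in> verts ?B" "w \<noteq> v" for v w
        using that unfolding dominates_induced[OF B] by (auto simp: core_def)
      then have "graph.core ?B = {}" unfolding graph.core_def[OF graph_induced[OF B]] by blast
      then show ?thesis using graph.complete_graph_iff[OF graph_induced[OF B]] by simp
    qed
    ultimately show ?thesis by blast
  qed
next
  assume ?R
  then consider "complete_graph G" | "minsquare_graph G" |
    \<Lambda>1 \<Lambda>2 where "is_join G \<Lambda>1 \<Lambda>2" "minsquare_graph \<Lambda>1" "complete_graph \<Lambda>2" by blast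
  then show ?L
  proof cases
    case 2
    then have m: "minsquare_set (dominates G) (verts G) (verts G)" by (simp add: minsquare_graph_iff)
    then have "core = verts G" using minsquare_set_subset_core by (auto simp: core_def)
    with m show ?thesis by simp
  next
    case 3
    have A: "induced_subgraph \<Lambda>1 G" and B: "induced_subgraph \<Lambda>2 G"
      using 3 by (auto simp: is_join_def nonempty_induced_subgraph_def)
    interpret A: graph \<Lambda>1 using A by (rule graph_induced)
    interpret B: graph \<Lambda>2 using B by (rule graph_induced)
    have m: "minsquare_set (dominates \<Lambda>1) (verts \<Lambda>1) (verts \<Lambda>1)" using 3 A.minsquare_graph_iff by simp
    then have "A.core = verts \<Lambda>1" using A.minsquare_set_subset_core by (auto simp: A.core_def)
    \<comment> \<open>A non-adjacent pair can lie neither in the complete factor nor across the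
      join, so all such pairs lie in the first factor.\<close>
    moreover have "A.core = core"
    proof -
      have B0: "B.core = {}" using 3 B.complete_graph_iff by simp
      have join: "verts G = verts \<Lambda>1 \<union> verts \<Lambda>2" "\<And>x y. x \<in> verts \<Lambda>1 \<Longrightarrow> y \<in> verts \<Lambda>2 \<Longrightarrow> x \<rightarrow>\<^bsub>G\<^esub> y"
        using 3 by (auto simp: is_join_def)
      show ?thesis
        using B0 join dominates_sym unfolding core_def A.core_def B.core_def dominates_induced[OF A] dominates_induced[OF B]
        by blast
    qed
    ultimately have "minsquare_set (dominates \<Lambda>1) core core" "verts \<Lambda>1 = core" using m by simp_all
    then have "minsquare_set (dominates G) core core"
      using minsquare_set_cong[of core "dominates \<Lambda>1" "dominates G" core] dominates_induced[OF A] by blast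
    then show ?thesis using minsquare_set_core_restrict by blast
  qed (simp add: complete_graph_iff)
qed

context graph begin

section \<open>The complement graph and periodic walks through the core\<close>

definition nonadj :: "('a \<times> 'a) set" where
  "nonadj = {(u, v). u \<in> verts G \<and> v \<in> verts G \<and> u \<noteq> v \<and> \<not> u \<rightarrow>\<^bsub>G\<^esub> v}"

lemma sym_nonadj: "sym nonadj"
  using dominates_sym by (auto simp: nonadj_def sym_def)

lemma core_eq_Domain: "core = Domain nonadj"
proof (rule Set.set_eqI)
  show "v \<in> core \<longleftrightarrow> v \<in> Domain nonadj" for v
    by (simp add: core_def nonadj_def Domain_iff) metis
qed

text \<open>Two components of the complement graph with at least two vertices each span squares, and
  these generate the whole core.\<close>

lemma core_connected:
  assumes "\<not> minsquare_set (dominates G) (verts G) core" "x \<in> core" "y \<in> core"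
  shows "(x, y) \<in> nonadj\<^sup>*"
proof (rule ccontr)
  assume xy: "(x, y) \<notin> nonadj\<^sup>*"
  have sym: "(a, b) \<in> nonadj\<^sup>* \<Longrightarrow> (b, a) \<in> nonadj\<^sup>*" for a b
    using symD[OF sym_rtrancl[OF sym_nonadj]] .
  have core: "core \<subseteq> verts G" by (auto simp: core_def)
  \<comment> \<open>Vertices in different components of the complement graph are distinct and
    adjacent, so non-adjacent pairs from two components are the diagonals of a square.\<close>
  have sq: "square (dominates G) a b c d" "{a,b,c,d} \<subseteq> core"
    if "(a, c) \<in> nonadj" "(b, d) \<in> nonadj" "(a, b) \<notin> nonadj\<^sup>*" for a b c d
  proof -
    have "(a, b) \<notin> nonadj\<^sup>*" "(b, c) \<notin> nonadj\<^sup>*" "(c, d) \<notin> nonadj\<^sup>*" "(d, a) \<notin> nonadj\<^sup>*"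
      using that sym by (meson r_into_rtrancl rtrancl_trans)+
    then have "(a, b) \<notin> nonadj" "(b, c) \<notin> nonadj" "(c, d) \<notin> nonadj" "(d, a) \<notin> nonadj"
      "a \<noteq> b" "b \<noteq> c" "c \<noteq> d" "d \<noteq> a" by auto
    then show "square (dominates G) a b c d" using that by (auto simp: square_def nonadj_def)
    show "{a,b,c,d} \<subseteq> core" using that sym_nonadj by (auto simp: core_eq_Domain sym_def)
  qed
  have partner: "\<exists>q. (p, q) \<in> nonadj" if "p \<in> core" for p using that by (auto simp: core_eq_Domain)
  obtain x' y' where x': "(x, x') \<in> nonadj" and y': "(y, y') \<in> nonadj" using partner assms by metis
  have "minsquare_set (dominates G) (verts G) core" unfolding minsquare_set_def
  proof (intro conjI allI impI; (elim conjE)?)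
    show "closed_under_squares (dominates G) (verts G) core" using assms closed_under_squares_core by blast
    show "contains_square (dominates G) core" using sq[OF x' y' xy] by (auto simp: contains_square_def)
    fix B assume B: "closed_under_squares (dominates G) (verts G) B" "contains_square (dominates G) B" "B \<subseteq> core"
    then obtain a b c d where abcd: "{a,b,c,d} \<subseteq> B" "square (dominates G) a b c d" by (auto simp: contains_square_def)
    then have ac: "(a, c) \<in> nonadj" using B core by (auto simp: nonadj_def square_def)
    \<comment> \<open>A closed set containing a non-adjacent pair from one component swallows all
      the other components.\<close>
    have step: "p \<in> B" if "(a, c) \<in> nonadj" "a \<in> B" "c \<in> B" "p \<in> core" "(a, p) \<notin> nonadj\<^sup>*" for a c p
    proof -
      obtain q where q: "(p, q) \<in> nonadj" using partner \<open>p \<in> core\<close> by auto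
      have "square (dominates G) a p c q" "{a,p,c,q} \<subseteq> verts G" using sq[OF that(1) q that(5)] core by auto
      then show ?thesis using B that unfolding closed_under_squares_def by blast
    qed
    have "core \<subseteq> B"
    proof
      fix p assume p: "p \<in> core"
      show "p \<in> B"
      proof (cases "(a, p) \<in> nonadj\<^sup>*")
        case True
        \<comment> \<open>Here \<open>p\<close> is in the component of \<open>a\<close>, so a detour
          is needed: a pair \<open>q\<close>, \<open>q'\<close> in another component is swallowed
          first and then swallows \<open>p\<close>.\<close>
        obtain q where q: "q \<in> core" "(a, q) \<notin> nonadj\<^sup>*"
          using xy assms sym by (meson rtrancl_trans)
        obtain q' where q': "(q, q') \<in> nonadj" using partner q by auto
        have "(a, q') \<notin> nonadj\<^sup>*" "q' \<in> core" using q q' sym_nonadj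
          by (auto simp: core_eq_Domain sym_def intro: rtrancl_into_rtrancl)
        then have "q \<in> B" "q' \<in> B" using step ac abcd q by auto
        moreover have "(q, p) \<notin> nonadj\<^sup>*" using True q sym by (meson rtrancl_trans)
        ultimately show ?thesis using step q' p by blast
      qed (use step ac abcd p in auto)
    qed
    then show "B = core" using B by blast
  qed
  with assms show False by blast
qed

end

lemma covering_closed_walk:
  assumes "finite S" "\<And>s. s \<in> S \<Longrightarrow> (x, s) \<in> R\<^sup>* \<and> (s, x) \<in> R\<^sup>*"
  shows "\<exists>n p. p 0 = x \<and> p n = x \<and> (\<forall>i<n. (p i, p (Suc i)) \<in> R) \<and> S \<subseteq> p ` {..n::nat}"
  using assms
proof (induction S rule: finite_induct)
  case empty
  then show ?case by (intro exI[of _ 0] exI[of _ "\<lambda>_. x"]) auto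
next
  case (insert s S)
  then obtain n p where p: "p 0 = x" "p n = x" "\<And>i. i < n \<Longrightarrow> (p i, p (Suc i)) \<in> R" "S \<subseteq> p ` {..n}" by auto
  obtain k q where q: "q 0 = x" "q k = s" "\<And>i. i < k \<Longrightarrow> (q i, q (Suc i)) \<in> R"
    using insert.prems[of s] by (auto simp: rtrancl_power relpow_fun_conv)
  obtain l r where r: "r 0 = s" "r l = x" "\<And>i. i < l \<Longrightarrow> (r i, r (Suc i)) \<in> R"
    using insert.prems[of s] by (auto simp: rtrancl_power relpow_fun_conv)
  \<comment> \<open>The old closed walk at \<open>x\<close> is followed by a path to
    \<open>s\<close> and a path back to \<open>x\<close>.\<close>
  let ?f = "\<lambda>i. if i \<le> n then p i else if i \<le> n + k then q (i - n) else r (i - (n + k))"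
  have "s \<in> ?f ` {..n + k + l}" using p q by (intro image_eqI[of _ _ "n + k"]) auto
  moreover have "t \<in> ?f ` {..n + k + l}" if "t \<in> S" for t
  proof -
    from that p(4) have "t \<in> p ` {..n}" by blast
    then obtain i where "i \<le> n" "t = p i" by auto
    then show ?thesis by (intro image_eqI[of _ _ i]) auto
  qed
  ultimately have "insert s S \<subseteq> ?f ` {..n + k + l}" by blast
  moreover have "(?f i, ?f (Suc i)) \<in> R" if "i < n + k + l" for i
  proof -
    consider "i < n" | "n \<le> i" "i < n + k" | "n + k \<le> i" by linarith
    then show ?thesis
    proof cases
      case 2
      then have "?f i = q (i - n)" "?f (Suc i) = q (Suc (i - n))" using p q by (auto simp: Suc_diff_le)
      then show ?thesis using q(3)[of "i - n"] 2 by auto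
    next
      case 3
      then have "?f i = r (i - (n + k))" "?f (Suc i) = r (Suc (i - (n + k)))"
        using p q r by (auto simp: Suc_diff_le)
      then show ?thesis using r(3)[of "i - (n + k)"] 3 that by auto
    qed (use p in auto)
  qed
  moreover have "?f 0 = x" "?f (n + k + l) = x" using p(1,2) q(1,2) r(1,2) by auto
  ultimately show ?case by (intro exI[of _ "n + k + l"] exI[of _ ?f] conjI) blast+
qed

text \<open>A closed walk covering the connected complement graph of the core is repeated for ever.
  Its length serves as \<open>r\<close>: any \<open>r\<close> consecutive indices make one full
  turn.\<close>

lemma (in graph) core_walk:
  assumes "core \<noteq> {}" "\<not> minsquare_set (dominates G) (verts G) core"
  obtains p :: "nat \<Rightarrow> 'a" and r where "r > 0" "\<And>i. (p i, p (Suc i)) \<in> nonadj"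
    "\<And>i v. v \<in> core \<Longrightarrow> \<exists>j<r. p (i + j) = v"
proof -
  obtain x where x: "x \<in> core" using assms by auto
  obtain y where y: "(x, y) \<in> nonadj" using x by (auto simp: core_eq_Domain)
  have "finite core" using finite_verts by (auto simp: core_def)
  have "(x, s) \<in> nonadj\<^sup>* \<and> (s, x) \<in> nonadj\<^sup>*" if "s \<in> core" for s
    using core_connected[OF assms(2)] x that by simp
  then have "\<exists>n q. q 0 = x \<and> q n = x \<and> (\<forall>i<n. (q i, q (Suc i)) \<in> nonadj) \<and> core \<subseteq> q ` {..n::nat}"
    by (intro covering_closed_walk \<open>finite core\<close>)
  then obtain n q where "q 0 = x \<and> q n = x \<and> (\<forall>i<n. (q i, q (Suc i)) \<in> nonadj) \<and> core \<subseteq> q ` {..n::nat}"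
    by (elim exE) (rule that)
  then have q: "q 0 = x" "q n = x" "\<And>i. i < n \<Longrightarrow> (q i, q (Suc i)) \<in> nonadj" "core \<subseteq> q ` {..n}"
    by simp_all
  have "y \<in> core" using symD[OF sym_nonadj y] by (auto simp: core_eq_Domain)
  moreover have "y \<noteq> x" using y by (auto simp: nonadj_def)
  ultimately have n: "n > 0" using q(1,4) by (cases n) auto
  show thesis
  proof (rule that[of n "\<lambda>i. q (i mod n)"])
    show "(q (i mod n), q (Suc i mod n)) \<in> nonadj" for i
    proof (cases "Suc (i mod n) = n")
      case True
      then have "Suc i mod n = 0" by (simp add: mod_Suc)
      then show ?thesis using q(1,2) q(3)[of "i mod n"] True n by simp
    next
      case False
      then have "Suc i mod n = Suc (i mod n)" by (simp add: mod_Suc)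
      then show ?thesis using q(3)[of "i mod n"] n by simp
    qed
    fix i v assume "v \<in> core"
    then obtain k where k: "k \<le> n" "q k = v" using q by auto
    define k' where "k' = k mod n"
    have k': "k' < n" "q k' = v" using k n q by (auto simp: k'_def le_less)
    \<comment> \<open>\<open>j\<close> solves \<open>i + j = k'\<close> modulo \<open>n\<close>; the
      outer remainder keeps it below \<open>n\<close>.\<close>
    define j where "j = (k' + (n - i mod n)) mod n"
    have "(i + j) mod n = (i mod n + (k' + (n - i mod n))) mod n"
      by (simp add: j_def mod_simps)
    also have "i mod n + (k' + (n - i mod n)) = k' + n" using mod_less_divisor[OF n, of i] by linarith
    finally have "(i + j) mod n = k'" using k' by simp
    then show "\<exists>j<n. q ((i + j) mod n) = v" using k' n by (intro exI[of _ j]) (auto simp: j_def)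
  qed (rule n)
qed

section \<open>Half-spaces along rays\<close>

locale finite_graph_product = graph_product_data \<Gamma> G
  for \<Gamma> :: "('v,'e) pre_digraph" and G :: "'v \<Rightarrow> ('a,'b) monoid_scheme" +
  assumes nontrivial: "v \<in> verts \<Gamma> \<Longrightarrow> carrier (G v) \<noteq> {\<one>\<^bsub>G v\<^esub>}"
    and finite_G: "v \<in> verts \<Gamma> \<Longrightarrow> finite (carrier (G v))"
begin

lemma nontrivial_element:
  assumes "v \<in> verts \<Gamma>"
  obtains g where "g \<in> carrier (G v)" "g \<noteq> \<one>\<^bsub>G v\<^esub>"
proof -
  interpret group "G v" using assms by (rule group_G)
  show ?thesis using nontrivial[OF assms] one_closed that by blast
qed

lemma emb_inv:
  assumes "v \<in> verts \<Gamma>" "g \<in> carrier (G v)"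
  shows "inv\<^bsub>P\<^esub> emb v g = emb v (inv\<^bsub>G v\<^esub> g)"
proof -
  interpret group "G v" using assms by (intro group_G)
  show ?thesis using assms
    by (intro P.inv_equality) (auto simp: emb_closed emb_one simp flip: emb_mult)
qed

section \<open>The electrification as a Cayley graph with word length \<open>len\<close>\<close>

definition gens :: "('v \<times> 'a) list set set set" where
  "gens = {X. (\<exists>v\<in>verts \<Gamma>. X \<in> vertex_group \<Gamma> G v) \<or>
    (\<exists>\<Lambda>. minsquare_subgraph \<Lambda> \<Gamma> \<and> X \<in> special_subgroup \<Gamma> G \<Lambda>)}"

lemma emb_gens: "v \<in> verts \<Gamma> \<Longrightarrow> g \<in> carrier (G v) \<Longrightarrow> emb v g \<in> gens"
  by (auto simp: gens_def vertex_group_eq)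

lemma vertex_groups_carrier: "A \<subseteq> verts \<Gamma> \<Longrightarrow> (\<Union>v\<in>A. vertex_group \<Gamma> G v) \<subseteq> carrier P"
  by (auto simp: vertex_group_eq emb_closed)

lemma special_carrier: "minsquare_subgraph \<Lambda> \<Gamma> \<Longrightarrow> special_subgroup \<Gamma> G \<Lambda> \<subseteq> carrier P"
  unfolding special_subgroup_def minsquare_subgraph_iff induced_subgraph_def subgraph_def
  by (intro P.generate_incl vertex_groups_carrier) simp

lemma gens_carrier: "gens \<subseteq> carrier P"
  using special_carrier by (auto simp: gens_def vertex_group_eq emb_closed)

primrec wball :: "nat \<Rightarrow> ('v \<times> 'a) list set set set" where
  "wball 0 = {\<one>\<^bsub>P\<^esub>}"
| "wball (Suc n) = wball n \<union> {X \<otimes>\<^bsub>P\<^esub> s | X s. X \<in> wball n \<and> s \<in> gens}"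

lemma wball_carrier: "wball n \<subseteq> carrier P"
  using gens_carrier by (induction n) auto

lemma wball_mult: "X \<in> wball m \<Longrightarrow> Y \<in> wball n \<Longrightarrow> X \<otimes>\<^bsub>P\<^esub> Y \<in> wball (m + n)"
proof (induction n arbitrary: Y)
  case 0
  then have "X \<in> carrier P" using wball_carrier by blast
  with 0 show ?case by simp
next
  case (Suc n)
  then show ?case
  proof (cases "Y \<in> wball n")
    case False
    then obtain Z s where Z: "Y = Z \<otimes>\<^bsub>P\<^esub> s" "Z \<in> wball n" "s \<in> gens" using Suc by auto
    then have "X \<otimes>\<^bsub>P\<^esub> Y = (X \<otimes>\<^bsub>P\<^esub> Z) \<otimes>\<^bsub>P\<^esub> s"
      using Suc wball_carrier gens_carrier by (simp add: P.m_assoc subset_iff)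
    then show ?thesis using Suc Z by auto
  qed auto
qed

lemma gens_wball: "s \<in> gens \<Longrightarrow> s \<in> wball 1"
  using gens_carrier by force

lemma wball_covers: "X \<in> carrier P \<Longrightarrow> \<exists>n. X \<in> wball n"
proof (induction rule: generators_induct)
  case one
  have "\<one>\<^bsub>P\<^esub> \<in> wball 0" by simp
  then show ?case ..
next
  case (mult v g Y)
  then obtain n where "Y \<in> wball n" by auto
  then have "emb v g \<otimes>\<^bsub>P\<^esub> Y \<in> wball (1 + n)"
    using mult by (intro wball_mult gens_wball emb_gens)
  then show ?case ..
qed

definition len where "len X = (LEAST n. X \<in> wball n)"

lemma len_le: "X \<in> wball n \<Longrightarrow> len X \<le> n"
  unfolding len_def by (rule Least_le)

lemma wball_len: "X \<in> carrier P \<Longrightarrow> X \<in> wball (len X)"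
  unfolding len_def using wball_covers by (auto intro: LeastI_ex)

lemma len_mult: "X \<in> carrier P \<Longrightarrow> Y \<in> carrier P \<Longrightarrow> len (X \<otimes>\<^bsub>P\<^esub> Y) \<le> len X + len Y"
  by (intro len_le wball_mult wball_len)

lemma len_one: "len \<one>\<^bsub>P\<^esub> = 0"
  using len_le[of "\<one>\<^bsub>P\<^esub>" 0] by simp

abbreviation E where "E \<equiv> electrification \<Gamma> G"

lemma verts_E: "verts E = carrier P" and tail_E: "tail E = fst" and head_E: "head E = snd"
  by (simp_all add: electrification_def)

lemma arcs_E: "(g, h) \<in> arcs E \<longleftrightarrow> g \<in> carrier P \<and> h \<in> carrier P \<and> g \<noteq> h \<and> inv\<^bsub>P\<^esub> g \<otimes>\<^bsub>P\<^esub> h \<in> gens"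
  by (simp add: electrification_def gens_def)

sublocale E: wf_digraph E
  by unfold_locales (auto simp: verts_E tail_E head_E arcs_E)

lemma awalk_wball:
  assumes "E.awalk g p h"
  shows "inv\<^bsub>P\<^esub> g \<otimes>\<^bsub>P\<^esub> h \<in> wball (length p)"
  using assms
proof (induction p arbitrary: g)
  case Nil
  then show ?case by (auto simp: E.awalk_Nil_iff verts_E)
next
  case (Cons e p)
  then have e: "e \<in> arcs E" "g = fst e" "E.awalk (snd e) p h"
    by (auto simp: E.awalk_Cons_iff tail_E head_E)
  then have c: "g \<in> carrier P" "snd e \<in> carrier P" "inv\<^bsub>P\<^esub> g \<otimes>\<^bsub>P\<^esub> snd e \<in> gens"
    using arcs_E[of "fst e" "snd e"] by auto
  have h: "h \<in> carrier P" using e E.awalk_last_in_verts verts_E by auto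
  have "(inv\<^bsub>P\<^esub> g \<otimes>\<^bsub>P\<^esub> snd e) \<otimes>\<^bsub>P\<^esub> (inv\<^bsub>P\<^esub> snd e \<otimes>\<^bsub>P\<^esub> h) \<in> wball (1 + length p)"
    using c e Cons.IH by (intro wball_mult gens_wball)
  moreover have "(inv\<^bsub>P\<^esub> g \<otimes>\<^bsub>P\<^esub> snd e) \<otimes>\<^bsub>P\<^esub> (inv\<^bsub>P\<^esub> snd e \<otimes>\<^bsub>P\<^esub> h) = inv\<^bsub>P\<^esub> g \<otimes>\<^bsub>P\<^esub> h"
    using c h by (simp add: P.m_assoc P.inv_solve_left flip: P.m_assoc[of "snd e"])
  ultimately show ?case by simp
qed

lemma wball_awalk:
  assumes "X \<in> wball n" "g \<in> carrier P"
  shows "\<exists>p. E.awalk g p (g \<otimes>\<^bsub>P\<^esub> X) \<and> length p \<le> n"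
  using assms(1)
proof (induction n arbitrary: X)
  case 0
  then show ?case using assms(2) by (intro exI[of _ "[]"]) (auto simp: E.awalk_Nil_iff verts_E)
next
  case (Suc n)
  show ?case
  proof (cases "X \<in> wball n")
    case True
    then show ?thesis using Suc.IH le_Suc_eq by blast
  next
    case False
    then obtain Z s where Z: "X = Z \<otimes>\<^bsub>P\<^esub> s" "Z \<in> wball n" "s \<in> gens" using Suc by auto
    then obtain p where p: "E.awalk g p (g \<otimes>\<^bsub>P\<^esub> Z)" "length p \<le> n" using Suc.IH by blast
    have c: "Z \<in> carrier P" "s \<in> carrier P" using Z wball_carrier gens_carrier by auto
    have a: "g \<otimes>\<^bsub>P\<^esub> X = (g \<otimes>\<^bsub>P\<^esub> Z) \<otimes>\<^bsub>P\<^esub> s" using Z c assms(2) by (simp add: P.m_assoc)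
    \<comment> \<open>Arcs join distinct vertices, so the last factor must be non-trivial; a trivial
      one would leave \<open>X\<close> in the smaller ball.\<close>
    have "s \<noteq> \<one>\<^bsub>P\<^esub>" using False Z c by auto
    then have ne: "g \<otimes>\<^bsub>P\<^esub> Z \<noteq> g \<otimes>\<^bsub>P\<^esub> X" unfolding a using c assms(2) P.l_cancel_one by (metis P.m_closed)
    have "inv\<^bsub>P\<^esub> (g \<otimes>\<^bsub>P\<^esub> Z) \<otimes>\<^bsub>P\<^esub> (g \<otimes>\<^bsub>P\<^esub> X) = s" unfolding a using c assms(2)
      by (simp add: P.inv_solve_left')
    then have e: "(g \<otimes>\<^bsub>P\<^esub> Z, g \<otimes>\<^bsub>P\<^esub> X) \<in> arcs E" using ne Z c assms(2) by (simp add: arcs_E)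
    then have "E.awalk g (p @ [(g \<otimes>\<^bsub>P\<^esub> Z, g \<otimes>\<^bsub>P\<^esub> X)]) (g \<otimes>\<^bsub>P\<^esub> X)"
      using p E.arc_implies_awalk[OF e] by (auto simp: tail_E head_E)
    then show ?thesis using p(2) by (intro exI[of _ "p @ [(g \<otimes>\<^bsub>P\<^esub> Z, g \<otimes>\<^bsub>P\<^esub> X)]"]) auto
  qed
qed

lemma awalk_cost_one: "E.awalk_cost (\<lambda>_. 1) p = real (length p)"
  by (induction p) auto

abbreviation dE where "dE \<equiv> graph_dist E"

text \<open>Walks starting at \<open>g\<close> spell products of elements of \<open>gens\<close>.
  These generate the graph product, so the infimum over walks is a finite number and the conversion
  from \<open>ereal\<close> loses nothing.\<close>

lemma dE_eq:
  assumes "g \<in> carrier P" "h \<in> carrier P"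
  shows "dE g h = real (len (inv\<^bsub>P\<^esub> g \<otimes>\<^bsub>P\<^esub> h))"
proof -
  let ?X = "inv\<^bsub>P\<^esub> g \<otimes>\<^bsub>P\<^esub> h"
  have "E.\<mu> (\<lambda>_. 1) g h = ereal (real (len ?X))"
  proof (rule antisym)
    obtain p where p: "E.awalk g p (g \<otimes>\<^bsub>P\<^esub> ?X)" "length p \<le> len ?X"
      using wball_awalk[OF wball_len, of ?X g] assms by auto
    moreover have "g \<otimes>\<^bsub>P\<^esub> ?X = h" using assms by (simp flip: P.m_assoc)
    ultimately have "E.\<mu> (\<lambda>_. 1) g h \<le> ereal (real (length p))"
      using E.min_cost_le_walk_cost[of g p h "\<lambda>_. 1"] by (simp add: awalk_cost_one)
    also have "\<dots> \<le> ereal (real (len ?X))" using p by simp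
    finally show "E.\<mu> (\<lambda>_. 1) g h \<le> ereal (real (len ?X))" .
    show "ereal (real (len ?X)) \<le> E.\<mu> (\<lambda>_. 1) g h"
      unfolding E.\<mu>_def by (rule INF_greatest) (auto simp: awalk_cost_one intro: len_le awalk_wball)
  qed
  then show ?thesis by (simp add: graph_dist_def)
qed

lemma bounded_diameter_iff:
  "bounded_diameter (verts E) dE \<longleftrightarrow> (\<exists>b. \<forall>X\<in>carrier P. len X \<le> b)"
proof
  assume "bounded_diameter (verts E) dE"
  then obtain b where "\<And>g h. g \<in> carrier P \<Longrightarrow> h \<in> carrier P \<Longrightarrow> dE g h \<le> b"
    by (auto simp: bounded_diameter_def verts_E)
  from this[OF P.one_closed] have "\<And>X. X \<in> carrier P \<Longrightarrow> real (len X) \<le> b" by (simp add: dE_eq)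
  then show "\<exists>b. \<forall>X\<in>carrier P. len X \<le> b"
    by (intro exI[of _ "nat \<lfloor>b\<rfloor>"]) (auto simp: le_nat_floor)
next
  assume "\<exists>b. \<forall>X\<in>carrier P. len X \<le> b"
  then obtain b where "\<And>X. X \<in> carrier P \<Longrightarrow> len X \<le> b" by auto
  then show "bounded_diameter (verts E) dE"
    unfolding bounded_diameter_def verts_E by (intro exI[of _ "real b"]) (auto simp: dE_eq)
qed

section \<open>Rays and their prefixes\<close>

primrec pre :: "(nat \<Rightarrow> 'v) \<Rightarrow> (nat \<Rightarrow> 'a) \<Rightarrow> nat \<Rightarrow> ('v \<times> 'a) list set set" where
  "pre W c 0 = \<one>\<^bsub>P\<^esub>"
| "pre W c (Suc n) = pre W c n \<otimes>\<^bsub>P\<^esub> emb (W n) (c n)"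

text \<open>Consecutive syllables lie at distinct non-adjacent vertices, so they can be neither
  exchanged nor merged and every prefix is reduced. The following lemmas express this through
  \<open>proj\<close> instead of through words.\<close>

definition ray :: "(nat \<Rightarrow> 'v) \<Rightarrow> (nat \<Rightarrow> 'a) \<Rightarrow> bool" where
  "ray W c \<longleftrightarrow> (\<forall>i. (W i, W (Suc i)) \<in> nonadj \<and> c i \<in> carrier (G (W i)) \<and> c i \<noteq> \<one>\<^bsub>G (W i)\<^esub>)"

lemma rayD:
  assumes "ray W c"
  shows "W i \<in> verts \<Gamma>" "(W i, W (Suc i)) \<in> nonadj" "c i \<in> carrier (G (W i))" "c i \<noteq> \<one>\<^bsub>G (W i)\<^esub>"
  using assms by (auto simp: ray_def nonadj_def)

lemma ray_shift: "ray W c \<Longrightarrow> ray (\<lambda>i. W (i + k)) (\<lambda>i. c (i + k))"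
  by (auto simp: ray_def)

lemma pre_closed: "ray W c \<Longrightarrow> pre W c n \<in> carrier P"
  by (induction n) (auto simp: emb_closed rayD)

lemma pre_add:
  assumes "ray W c"
  shows "pre W c (m + n) = pre W c m \<otimes>\<^bsub>P\<^esub> pre (\<lambda>i. W (i + m)) (\<lambda>i. c (i + m)) n"
proof (induction n)
  case (Suc n)
  then show ?case using pre_closed[OF assms] pre_closed[OF ray_shift[OF assms]] assms
    by (simp add: P.m_assoc emb_closed rayD add.commute[of n m])
qed (use pre_closed[OF assms] in simp)

lemma pre_Suc_left:
  assumes "ray W c"
  shows "pre W c (Suc n) = emb (W 0) (c 0) \<otimes>\<^bsub>P\<^esub> pre (\<lambda>i. W (i + 1)) (\<lambda>i. c (i + 1)) n"
  using pre_add[OF assms, of 1 n] assms by (simp add: emb_closed rayD)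

text \<open>The rest of the ray starts at a vertex not adjacent to \<open>W 0\<close>, so by
  induction it shows nothing at \<open>W 0\<close>, and the first syllable \<open>c 0\<close> leads.
  A leading syllable at \<open>W 0\<close> excludes one at the non-adjacent vertex
  \<open>u\<close>.\<close>

lemma proj_pre_nonadj:
  assumes "ray W c" "(u, W 0) \<in> nonadj"
  shows "proj u (pre W c n) = \<one>\<^bsub>G u\<^esub>"
  using assms
proof (induction n arbitrary: W c u)
  case (Suc n)
  interpret group "G (W 0)" using rayD[OF Suc.prems(1)] by (intro group_G)
  note sh = ray_shift[OF Suc.prems(1), of 1]
  have "proj (W 0) (pre (\<lambda>i. W (i + 1)) (\<lambda>i. c (i + 1)) n) = \<one>\<^bsub>G (W 0)\<^esub>"
    using Suc.IH[OF sh, of "W 0"] rayD(2)[OF Suc.prems(1), of 0] by simp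
  then have "proj (W 0) (pre W c (Suc n)) = c 0"
    unfolding pre_Suc_left[OF Suc.prems(1)] using rayD[OF Suc.prems(1), of 0] pre_closed[OF sh]
    by (simp add: proj_mult_left)
  then show ?case
    using proj_nonadj[of "pre W c (Suc n)" "W 0" u] pre_closed[OF Suc.prems(1), of "Suc n"] rayD(4)[OF Suc.prems(1), of 0]
      symD[OF sym_nonadj Suc.prems(2)] by (auto simp: nonadj_def)
qed (simp add: proj_one)

lemma proj_pre_first:
  assumes "ray W c"
  shows "proj (W 0) (pre W c (Suc n)) = c 0"
proof -
  interpret group "G (W 0)" using rayD[OF assms] by (intro group_G)
  have "proj (W 0) (pre (\<lambda>i. W (i + 1)) (\<lambda>i. c (i + 1)) n) = \<one>\<^bsub>G (W 0)\<^esub>"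
    using proj_pre_nonadj[OF ray_shift[OF assms, of 1], of "W 0"] rayD(2)[OF assms, of 0] by simp
  then show ?thesis
    unfolding pre_Suc_left[OF assms] using rayD[OF assms, of 0] pre_closed[OF ray_shift[OF assms, of 1]]
    by (simp add: proj_mult_left)
qed

lemma proj_pre_adj:
  assumes "ray W c" "W 0 \<rightarrow>\<^bsub>\<Gamma>\<^esub> v"
  shows "proj v (pre W c n) = \<one>\<^bsub>G v\<^esub>"
  using assms
proof (induction n arbitrary: W c)
  case (Suc n)
  note sh = ray_shift[OF Suc.prems(1), of 1]
  have "proj v (pre W c (Suc n)) = proj v (pre (\<lambda>i. W (i + 1)) (\<lambda>i. c (i + 1)) n)"
    unfolding pre_Suc_left[OF Suc.prems(1)] using rayD[OF Suc.prems(1), of 0] pre_closed[OF sh] Suc.prems(2)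
    by (simp add: proj_mult_left_adj)
  also have "\<dots> = \<one>\<^bsub>G v\<^esub>"
  proof (cases "W 1 \<rightarrow>\<^bsub>\<Gamma>\<^esub> v")
    case True
    then show ?thesis using Suc.IH[OF sh] by simp
  next
    case False
    \<comment> \<open>The vertex \<open>W 1\<close> cannot be \<open>v\<close> itself, because
      \<open>v\<close> is adjacent to \<open>W 0\<close> and \<open>W 1\<close> is not.\<close>
    have "(W 0, W 1) \<in> nonadj" using rayD(2)[OF Suc.prems(1), of 0] by simp
    then have "(v, W 1) \<in> nonadj" using False Suc.prems(2) dominates_sym by (auto simp: nonadj_def)
    then show ?thesis using proj_pre_nonadj[OF sh] by simp
  qed
  finally show ?case .
qed (simp add: proj_one)

text \<open>This keeps the legs of a tripod apart: a ray with a different first syllable never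
  enters the first half-space of the given ray.\<close>

lemma proj_pre_other:
  assumes "ray W c" "ray W' c'" "(W' 0, c' 0) \<noteq> (W 0, c 0)"
  shows "proj (W 0) (pre W' c' n) \<noteq> c 0"
proof (cases n)
  case 0
  then show ?thesis using rayD(4)[OF assms(1), of 0] by (simp add: proj_one)
next
  case (Suc k)
  consider "W' 0 = W 0" | "W' 0 \<rightarrow>\<^bsub>\<Gamma>\<^esub> W 0" | "(W 0, W' 0) \<in> nonadj"
    using rayD(1)[OF assms(1), of 0] rayD(1)[OF assms(2), of 0] dominates_sym[of "W 0" "W' 0"]
    unfolding nonadj_def mem_Collect_eq prod.case by metis
  then show ?thesis
  proof cases
    case 1
    then show ?thesis using proj_pre_first[OF assms(2), of k] Suc assms(3) by auto
  qed (use proj_pre_adj[OF assms(2)] proj_pre_nonadj[OF assms(2)] rayD(4)[OF assms(1), of 0] in auto)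
qed

section \<open>Nested half-spaces and depth along a ray\<close>

definition halfspace where
  "halfspace W c m = {X \<in> carrier P. proj (W m) (inv\<^bsub>P\<^esub> pre W c m \<otimes>\<^bsub>P\<^esub> X) = c m}"

text \<open>An element led by a syllable at \<open>W (Suc m)\<close> has no leading syllable at the
  non-adjacent vertex \<open>W m\<close>. Multiplying it on the left by \<open>c m\<close> therefore
  produces exactly the syllable \<open>c m\<close> at \<open>W m\<close>.\<close>

lemma halfspace_Suc:
  assumes "ray W c"
  shows "halfspace W c (Suc m) \<subseteq> halfspace W c m"
proof
  fix X assume "X \<in> halfspace W c (Suc m)"
  then have X: "X \<in> carrier P" "proj (W (Suc m)) (inv\<^bsub>P\<^esub> pre W c (Suc m) \<otimes>\<^bsub>P\<^esub> X) = c (Suc m)"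
    by (auto simp: halfspace_def)
  interpret group "G (W m)" using rayD[OF assms] by (intro group_G)
  let ?Y = "inv\<^bsub>P\<^esub> pre W c (Suc m) \<otimes>\<^bsub>P\<^esub> X"
  have Y: "?Y \<in> carrier P" using X pre_closed[OF assms, of "Suc m"] by (simp del: pre.simps)
  have "proj (W m) ?Y = \<one>\<^bsub>G (W m)\<^esub>"
    using proj_nonadj[OF Y, of "W (Suc m)" "W m"] X rayD(4)[OF assms, of "Suc m"]
      symD[OF sym_nonadj rayD(2)[OF assms, of m]] by (auto simp: nonadj_def)
  moreover have "inv\<^bsub>P\<^esub> pre W c m \<otimes>\<^bsub>P\<^esub> X = emb (W m) (c m) \<otimes>\<^bsub>P\<^esub> ?Y"
    using X pre_closed[OF assms, of m] rayD[OF assms, of m]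
    by (simp add: P.inv_mult_group emb_closed flip: P.m_assoc)
  ultimately have "proj (W m) (inv\<^bsub>P\<^esub> pre W c m \<otimes>\<^bsub>P\<^esub> X) = c m"
    using Y rayD[OF assms, of m] by (simp add: proj_mult_left del: pre.simps)
  with X show "X \<in> halfspace W c m" by (simp add: halfspace_def)
qed

lemma halfspace_mono: "ray W c \<Longrightarrow> m \<le> n \<Longrightarrow> halfspace W c n \<subseteq> halfspace W c m"
  by (rule lift_Suc_antimono_le) (use halfspace_Suc in auto)

lemma pre_halfspace:
  assumes "ray W c" "m < n"
  shows "pre W c n \<in> halfspace W c m"
proof -
  obtain k where n: "n = m + Suc k" using assms less_iff_Suc_add by auto
  note sh = ray_shift[OF assms(1), of m]
  have "inv\<^bsub>P\<^esub> pre W c m \<otimes>\<^bsub>P\<^esub> pre W c n = pre (\<lambda>i. W (i + m)) (\<lambda>i. c (i + m)) (Suc k)"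
    unfolding n pre_add[OF assms(1)] using pre_closed[OF assms(1)] pre_closed[OF sh, of "Suc k"]
    by (simp del: pre.simps flip: P.m_assoc)
  then show ?thesis using proj_pre_first[OF sh, of k] pre_closed[OF assms(1)]
    by (simp add: halfspace_def del: pre.simps)
qed

text \<open>By nestedness \<open>X\<close> lies in precisely the first \<open>depth W c M X\<close>
  of the first \<open>M\<close> half-spaces. The cut-off \<open>M\<close> makes the set finite
  without an argument that only finitely many half-spaces contain \<open>X\<close>.\<close>

definition depth where
  "depth W c M X = card {m. m < M \<and> X \<in> halfspace W c m}"

lemma depth_less_iff:
  assumes "ray W c"
  shows "m < depth W c M X \<longleftrightarrow> m < M \<and> X \<in> halfspace W c m"
proof -
  let ?S = "{m. m < M \<and> X \<in> halfspace W c m}"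
  have fin: "finite ?S" by simp
  have down: "j \<in> ?S" if "i \<in> ?S" "j \<le> i" for i j using that halfspace_mono[OF assms that(2)] by auto
  show ?thesis
  proof
    assume "m < M \<and> X \<in> halfspace W c m"
    then have "{..m} \<subseteq> ?S" using down by auto
    from card_mono[OF fin this] show "m < depth W c M X" by (simp add: depth_def)
  next
    assume m: "m < depth W c M X"
    show "m < M \<and> X \<in> halfspace W c m"
    proof (rule ccontr)
      assume "\<not> (m < M \<and> X \<in> halfspace W c m)"
      then have notin: "m \<notin> ?S" by blast
      have "i < m" if i: "i \<in> ?S" for i
      proof (rule ccontr)
        assume "\<not> i < m"
        then have "m \<in> ?S" by (intro down[OF i]) simp
        with notin show False by blast
      qed
      then have "?S \<subseteq> {..<m}" by auto
      from card_mono[OF _ this] m show False by (simp add: depth_def)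
    qed
  qed
qed

lemma depth_pre:
  assumes "ray W c" "n \<le> M"
  shows "depth W c M (pre W c n) \<ge> n"
proof (rule ccontr)
  let ?d = "depth W c M (pre W c n)"
  assume "\<not> ?thesis"
  then have "?d < n" by simp
  then have "?d < M \<and> pre W c n \<in> halfspace W c ?d" using pre_halfspace[OF assms(1)] assms(2) by simp
  then have "?d < ?d" by (rule iffD2[OF depth_less_iff[OF assms(1)]])
  then show False by simp
qed

lemma depth_other:
  assumes "ray W c" "ray W' c'" "(W' 0, c' 0) \<noteq> (W 0, c 0)"
  shows "depth W c M (pre W' c' n) = 0"
proof -
  have "pre W' c' n \<notin> halfspace W c 0"
    using proj_pre_other[OF assms] pre_closed[OF assms(2)] by (simp add: halfspace_def)
  then show ?thesis using depth_less_iff[OF assms(1), of 0] by auto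
qed

lemma depth_one: "ray W c \<Longrightarrow> depth W c M \<one>\<^bsub>P\<^esub> = 0"
  using depth_less_iff[of W c 0 M "\<one>\<^bsub>P\<^esub>"] rayD(4)[of W c 0] by (auto simp: halfspace_def proj_one)

text \<open>Among the \<open>r\<close> half-spaces that begin at index \<open>depth W c M Y\<close>
  one carries the label \<open>v\<close>. If \<open>X\<close> were deeper by more than
  \<open>r\<close> it would lie in that half-space, hence so would \<open>Y\<close>, although its
  index is not below the depth of \<open>Y\<close>.\<close>

lemma depth_agree:
  assumes "ray W c" "\<And>i. \<exists>j<r. W (i + j) = v"
    and "\<And>m. W m = v \<Longrightarrow> X \<in> halfspace W c m \<longleftrightarrow> Y \<in> halfspace W c m"
  shows "depth W c M X \<le> depth W c M Y + r"
proof (rule ccontr)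
  assume *: "\<not> ?thesis"
  obtain j where j: "j < r" "W (depth W c M Y + j) = v" using assms(2) by blast
  let ?m = "depth W c M Y + j"
  have "?m < depth W c M X" using * j by simp
  then have "?m < depth W c M Y" using assms(3)[OF j(2)] by (simp add: depth_less_iff[OF assms(1)])
  then show False by simp
qed

section \<open>Generators that are invisible at a core vertex\<close>

definition invisible :: "'v \<Rightarrow> ('v \<times> 'a) list set set \<Rightarrow> bool" where
  "invisible v s \<longleftrightarrow> s \<in> carrier P \<and> (\<forall>X\<in>carrier P. proj v (X \<otimes>\<^bsub>P\<^esub> s) = proj v X)"

text \<open>Every vertex group of \<open>A\<close> is invisible at \<open>v\<close> by
  \<open>proj_mult_right\<close>. Since \<open>invisible\<close> quantifies over all left factors,
  it passes to products and so to the generated subgroup.\<close>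

lemma invisible_generate:
  assumes "A \<subseteq> verts \<Gamma>" "v \<notin> A" "s \<in> generate P (\<Union>u\<in>A. vertex_group \<Gamma> G u)"
  shows "invisible v s"
proof -
  have emb: "invisible v (emb u g)" if "u \<in> A" "g \<in> carrier (G u)" for u g
  proof -
    have "u \<in> verts \<Gamma>" "u \<noteq> v" using that assms by auto
    then show ?thesis using that proj_mult_right emb_closed by (simp add: invisible_def)
  qed
  show ?thesis using assms(3)
  proof (induction rule: generate.induct)
    case one
    then show ?case by (simp add: invisible_def)
  next
    case (incl h)
    then show ?case using emb by (auto simp: vertex_group_eq)
  next
    case (inv h)
    then obtain u g where u: "u \<in> A" "g \<in> carrier (G u)" "h = emb u g" by (auto simp: vertex_group_eq)
    moreover have "inv\<^bsub>G u\<^esub> g \<in> carrier (G u)" using u assms group_G by (auto intro!: group.inv_closed)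
    ultimately show ?case using emb emb_inv assms(1) by auto
  next
    case (eng h1 h2)
    then show ?case by (auto simp: invisible_def simp flip: P.m_assoc)
  qed
qed

text \<open>The core has at least two vertices, so a single vertex group misses one of them. A
  minsquare subgraph lies inside the core and cannot exhaust it, as otherwise the core would be
  minsquare.\<close>

lemma gens_invisible:
  assumes "core \<noteq> {}" "\<not> minsquare_set (dominates \<Gamma>) (verts \<Gamma>) core" "s \<in> gens"
  shows "\<exists>v\<in>core. invisible v s"
proof -
  obtain a b where "(a, b) \<in> nonadj" using assms(1) by (auto simp: core_eq_Domain)
  then have ab: "a \<in> core" "b \<in> core" "a \<noteq> b"
    using symD[OF sym_nonadj, of a b] by (auto simp: core_eq_Domain nonadj_def)
  consider u where "u \<in> verts \<Gamma>" "s \<in> vertex_group \<Gamma> G u"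
    | \<Lambda> where "minsquare_subgraph \<Lambda> \<Gamma>" "s \<in> special_subgroup \<Gamma> G \<Lambda>"
    using assms(3) by (auto simp: gens_def)
  then show ?thesis
  proof cases
    case 1
    then have "s \<in> generate P (\<Union>u\<in>{u}. vertex_group \<Gamma> G u)" by (auto intro: generate.incl)
    moreover obtain v where "v \<in> core" "v \<noteq> u" using ab by metis
    ultimately show ?thesis using invisible_generate[of "{u}" v s] 1 by auto
  next
    case 2
    then have m: "minsquare_set (dominates \<Gamma>) (verts \<Gamma>) (verts \<Lambda>)" by (simp add: minsquare_subgraph_iff)
    have "verts \<Lambda> \<noteq> core" using m assms(2) by metis
    moreover have sub: "verts \<Lambda> \<subseteq> core" using m by (rule minsquare_set_subset_core)
    ultimately obtain v where v: "v \<in> core" "v \<notin> verts \<Lambda>" by blast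
    have "verts \<Lambda> \<subseteq> verts \<Gamma>" using sub by (auto simp: core_def)
    then have "invisible v s" using invisible_generate[of "verts \<Lambda>" v s] 2 v(2)
      by (simp add: special_subgroup_def)
    with v(1) show ?thesis ..
  qed
qed

lemma invisible_halfspace:
  assumes "ray W c" "invisible (W m) s" "X \<in> carrier P"
  shows "X \<otimes>\<^bsub>P\<^esub> s \<in> halfspace W c m \<longleftrightarrow> X \<in> halfspace W c m"
proof -
  have "inv\<^bsub>P\<^esub> pre W c m \<otimes>\<^bsub>P\<^esub> (X \<otimes>\<^bsub>P\<^esub> s) = (inv\<^bsub>P\<^esub> pre W c m \<otimes>\<^bsub>P\<^esub> X) \<otimes>\<^bsub>P\<^esub> s"
    using assms pre_closed[OF assms(1)] by (simp add: P.m_assoc invisible_def)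
  then show ?thesis using assms pre_closed[OF assms(1)] by (simp add: halfspace_def invisible_def)
qed

text \<open>Each generator preserves the half-spaces labelled by some core vertex, and such labels
  recur within \<open>r\<close> steps. Hence every factor moves the depth by at most
  \<open>r\<close>.\<close>

lemma depth_wball:
  assumes "ray W c" "\<And>i v. v \<in> core \<Longrightarrow> \<exists>j<r. W (i + j) = v"
    and "core \<noteq> {}" "\<not> minsquare_set (dominates \<Gamma>) (verts \<Gamma>) core" "X \<in> carrier P" "Y \<in> wball n"
  shows "depth W c M X \<le> depth W c M (X \<otimes>\<^bsub>P\<^esub> Y) + r * n \<and> depth W c M (X \<otimes>\<^bsub>P\<^esub> Y) \<le> depth W c M X + r * n"
  using assms(6)
proof (induction n arbitrary: Y)
  case (Suc n)
  show ?case
  proof (cases "Y \<in> wball n")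
    case False
    then obtain Z s where Z: "Y = Z \<otimes>\<^bsub>P\<^esub> s" "Z \<in> wball n" "s \<in> gens" using Suc by auto
    have c: "Z \<in> carrier P" "s \<in> carrier P" using Z wball_carrier gens_carrier by auto
    have a: "X \<otimes>\<^bsub>P\<^esub> Y = (X \<otimes>\<^bsub>P\<^esub> Z) \<otimes>\<^bsub>P\<^esub> s" using Z c assms(5) by (simp add: P.m_assoc)
    obtain v where v: "v \<in> core" "invisible v s" using gens_invisible assms(3,4) Z by blast
    have XZ: "X \<otimes>\<^bsub>P\<^esub> Z \<in> carrier P" using c assms(5) by simp
    have agree: "X \<otimes>\<^bsub>P\<^esub> Y \<in> halfspace W c m \<longleftrightarrow> X \<otimes>\<^bsub>P\<^esub> Z \<in> halfspace W c m" if "W m = v" for m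
      unfolding a using invisible_halfspace[OF assms(1) _ XZ] v that by blast
    have "depth W c M (X \<otimes>\<^bsub>P\<^esub> Y) \<le> depth W c M (X \<otimes>\<^bsub>P\<^esub> Z) + r"
      using depth_agree[OF assms(1) assms(2)[OF v(1)]] agree by blast
    moreover have "depth W c M (X \<otimes>\<^bsub>P\<^esub> Z) \<le> depth W c M (X \<otimes>\<^bsub>P\<^esub> Y) + r"
      using depth_agree[OF assms(1) assms(2)[OF v(1)]] agree by blast
    ultimately show ?thesis using Suc.IH[OF Z(2)] by simp
  qed (use Suc.IH in fastforce)
qed (use assms(5) in auto)

lemma depth_dist:
  assumes "ray W c" "\<And>i v. v \<in> core \<Longrightarrow> \<exists>j<r. W (i + j) = v"
    and "core \<noteq> {}" "\<not> minsquare_set (dominates \<Gamma>) (verts \<Gamma>) core" "X \<in> carrier P" "Y \<in> carrier P"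
  shows "real (depth W c M X) \<le> real (depth W c M Y) + real r * dE X Y"
proof -
  let ?Z = "inv\<^bsub>P\<^esub> X \<otimes>\<^bsub>P\<^esub> Y"
  have "X \<otimes>\<^bsub>P\<^esub> ?Z = Y" using assms by (simp flip: P.m_assoc)
  then have "depth W c M X \<le> depth W c M Y + r * len ?Z"
    using depth_wball[OF assms(1-5) wball_len, of ?Z] assms by simp
  then have "real (depth W c M X) \<le> real (depth W c M Y + r * len ?Z)" by (rule of_nat_mono)
  then show ?thesis using assms by (simp add: dE_eq)
qed

end

section \<open>Bounded diameter and tripods\<close>

lemma discrete_ivt:
  fixes f :: "nat \<Rightarrow> real"
  assumes "\<And>t. \<bar>f (Suc t) - f t\<bar> \<le> K" "f 0 \<le> y" "y \<le> f n"
  shows "\<exists>t. \<bar>f t - y\<bar> \<le> K"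
  using assms(3)
proof (induction n)
  case 0
  then have "\<bar>f 0 - y\<bar> \<le> K" using assms(1)[of 0] assms(2) by linarith
  then show ?case ..
next
  case (Suc n)
  show ?case
  proof (cases "y \<le> f n")
    case False
    then have "\<bar>f n - y\<bar> \<le> K" using assms(1)[of n] Suc.prems by linarith
    then show ?thesis ..
  qed (use Suc.IH in blast)
qed

text \<open>Two coarsely continuous rays in the line which leave their common origin on the same side
  come close to each other.\<close>

lemma rays_same_side:
  fixes A B :: "nat \<Rightarrow> real"
  assumes "\<And>t. \<bar>A (Suc t) - A t\<bar> \<le> K" "\<And>t. \<bar>B (Suc t) - B t\<bar> \<le> K" "A 0 = B 0"
    and "\<And>t. \<bar>A n - B t\<bar> > K" "\<And>t. \<bar>B n - A t\<bar> > K"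
  shows "\<not> (A 0 < A n \<and> B 0 < B n)"
proof (rule notI, elim conjE)
  assume *: "A 0 < A n" "B 0 < B n"
  show False
  proof (cases "A n \<le> B n")
    case True
    then obtain t where "\<bar>B t - A n\<bar> \<le> K" using discrete_ivt[of B K "A n" n] assms(2,3) * by auto
    then show False using assms(4)[of t] by linarith
  next
    case False
    then obtain t where "\<bar>A t - B n\<bar> \<le> K" using discrete_ivt[of A K "B n" n] assms(1,3) * by auto
    then show False using assms(5)[of t] by linarith
  qed
qed

text \<open>No leg ends at the common origin, because its end is far from the start of another leg.
  Two of the three ends lie on the same side of the origin, which \<open>rays_same_side\<close>
  excludes, after a reflection if the side is the negative one.\<close>

lemma no_tripod_in_line:
  fixes F :: "nat \<Rightarrow> nat \<Rightarrow> real"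
  assumes step: "\<And>i t. i < 3 \<Longrightarrow> \<bar>F i (Suc t) - F i t\<bar> \<le> K"
    and origin: "\<And>i. i < 3 \<Longrightarrow> F i 0 = F 0 0"
    and apart: "\<And>i j t. i < 3 \<Longrightarrow> j < 3 \<Longrightarrow> i \<noteq> j \<Longrightarrow> \<bar>F i n - F j t\<bar> > K"
  shows False
proof -
  have "K \<ge> 0" using step[of 0 0] by linarith
  then have ne: "F i n \<noteq> F 0 0" if "i < 3" for i
  proof (cases "i = 0")
    case True
    then show ?thesis using apart[of 0 1 0] origin[of 1] \<open>K \<ge> 0\<close> by auto
  next
    case False
    then show ?thesis using apart[of i 0 0] that \<open>K \<ge> 0\<close> by auto
  qed
  have pos: "\<not> (F 0 0 < F i n \<and> F 0 0 < F j n)" if "i < 3" "j < 3" "i \<noteq> j" for i j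
    using rays_same_side[of "F i" K "F j" n] step apart that origin[of i] origin[of j] by metis
  have neg: "\<not> (F i n < F 0 0 \<and> F j n < F 0 0)" if "i < 3" "j < 3" "i \<noteq> j" for i j
  proof -
    have "\<bar>- F k (Suc t) - - F k t\<bar> \<le> K" if "k < 3" for k t using step[OF that, of t] by linarith
    moreover have "\<bar>- F k n - - F l t\<bar> > K" if "k < 3" "l < 3" "k \<noteq> l" for k l t
      using apart[OF that, of t] by linarith
    ultimately have "\<not> (- F i 0 < - F i n \<and> - F j 0 < - F j n)"
      using that origin[of i] origin[of j] by (intro rays_same_side[of "\<lambda>t. - F i t" K "\<lambda>t. - F j t" n]) auto
    then show ?thesis using that origin[of i] origin[of j] by simp
  qed
  have "F i n < F 0 0 \<or> F 0 0 < F i n" if "i < 3" for i using ne[OF that] by linarith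
  from this[of 0] this[of 1] this[of 2] show False
    using pos[of 0 1] pos[of 0 2] pos[of 1 2] neg[of 0 1] neg[of 0 2] neg[of 1 2] by auto
qed

lemma quasi_lineE:
  assumes "quasi_line X d"
  obtains f :: "'x \<Rightarrow> real" and L C where "L \<ge> 1" "C \<ge> 0"
    "\<And>x y. x \<in> X \<Longrightarrow> y \<in> X \<Longrightarrow> d x y / L - C \<le> \<bar>f x - f y\<bar>"
    "\<And>x y. x \<in> X \<Longrightarrow> y \<in> X \<Longrightarrow> \<bar>f x - f y\<bar> \<le> L * d x y + C"
    "\<And>y. \<exists>x\<in>X. \<bar>f x - y\<bar> \<le> C"
proof -
  obtain f where "quasi_isometry X d (UNIV :: real set) dist f" using assms by (auto simp: quasi_line_def)
  then obtain L C where "L \<ge> 1" "C \<ge> 0"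
    "\<forall>x\<in>X. \<forall>y\<in>X. d x y / L - C \<le> dist (f x) (f y) \<and> dist (f x) (f y) \<le> L * d x y + C"
    "\<forall>y\<in>UNIV. \<exists>x\<in>X. dist (f x) y \<le> C"
    unfolding quasi_isometry_def by (elim conjE exE) (rule that)
  then show thesis using that[of L C f] by (simp add: dist_real_def)
qed

context finite_graph_product begin

section \<open>The finite factor spanned by the vertices outside the core\<close>

primrec prods :: "'v list \<Rightarrow> ('v \<times> 'a) list set set set" where
  "prods [] = {\<one>\<^bsub>P\<^esub>}"
| "prods (k # ks) = (\<lambda>(g, Y). emb k g \<otimes>\<^bsub>P\<^esub> Y) ` (carrier (G k) \<times> prods ks)"

lemma prods_carrier: "set ks \<subseteq> verts \<Gamma> \<Longrightarrow> prods ks \<subseteq> carrier P"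
  by (induction ks) (auto simp: emb_closed subset_iff)

lemma finite_prods: "set ks \<subseteq> verts \<Gamma> \<Longrightarrow> finite (prods ks)"
  by (induction ks) (auto simp: finite_G)

lemma prods_wball: "set ks \<subseteq> verts \<Gamma> \<Longrightarrow> X \<in> prods ks \<Longrightarrow> X \<in> wball (length ks)"
proof (induction ks arbitrary: X)
  case (Cons k ks)
  then obtain g Y where X: "X = emb k g \<otimes>\<^bsub>P\<^esub> Y" "g \<in> carrier (G k)" "Y \<in> prods ks" by auto
  then have "emb k g \<otimes>\<^bsub>P\<^esub> Y \<in> wball (1 + length ks)"
    using Cons by (intro wball_mult gens_wball emb_gens) auto
  with X show ?case by (simp del: wball.simps)
qed simp

lemma one_prods: "set ks \<subseteq> verts \<Gamma> \<Longrightarrow> \<one>\<^bsub>P\<^esub> \<in> prods ks"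
proof (induction ks)
  case (Cons k ks)
  interpret group "G k" using Cons by (intro group_G) auto
  show ?case using Cons by (auto simp: emb_one intro!: image_eqI[of _ _ "(\<one>\<^bsub>G k\<^esub>, \<one>\<^bsub>P\<^esub>)"])
qed simp

lemma prods_commute:
  assumes "set ks \<subseteq> verts \<Gamma>" "\<And>k. k \<in> set ks \<Longrightarrow> u \<rightarrow>\<^bsub>\<Gamma>\<^esub> k" "u \<in> verts \<Gamma>" "g \<in> carrier (G u)" "X \<in> prods ks"
  shows "emb u g \<otimes>\<^bsub>P\<^esub> X = X \<otimes>\<^bsub>P\<^esub> emb u g"
  using assms(1,2,5)
proof (induction ks arbitrary: X)
  case Nil
  then show ?case using assms by (simp add: emb_closed)
next
  case (Cons k ks)
  then obtain h Y where X: "X = emb k h \<otimes>\<^bsub>P\<^esub> Y" "h \<in> carrier (G k)" "Y \<in> prods ks" by auto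
  have c: "Y \<in> carrier P" "emb k h \<in> carrier P" "emb u g \<in> carrier P"
    using X Cons prods_carrier[of ks] assms by (auto simp: emb_closed)
  have "emb u g \<otimes>\<^bsub>P\<^esub> X = emb k h \<otimes>\<^bsub>P\<^esub> (emb u g \<otimes>\<^bsub>P\<^esub> Y)"
    using emb_commute[of u k g h] c X Cons.prems(2)[of k] assms(4) by (simp flip: P.m_assoc)
  also have "emb u g \<otimes>\<^bsub>P\<^esub> Y = Y \<otimes>\<^bsub>P\<^esub> emb u g" using Cons X by simp
  finally show ?case using c X by (simp add: P.m_assoc)
qed

text \<open>The new factor commutes past the entries at other vertices and is merged into an entry
  at its own vertex.\<close>

lemma prods_mult:
  assumes "set ks \<subseteq> verts \<Gamma>" "\<And>k l. k \<in> set ks \<Longrightarrow> l \<in> set ks \<Longrightarrow> k \<noteq> l \<Longrightarrow> k \<rightarrow>\<^bsub>\<Gamma>\<^esub> l"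
    and "v \<in> set ks" "g \<in> carrier (G v)" "X \<in> prods ks"
  shows "emb v g \<otimes>\<^bsub>P\<^esub> X \<in> prods ks"
  using assms(1,2,3,5)
proof (induction ks arbitrary: X)
  case (Cons k ks)
  then obtain h Y where X: "X = emb k h \<otimes>\<^bsub>P\<^esub> Y" "h \<in> carrier (G k)" "Y \<in> prods ks" by auto
  have v: "v \<in> verts \<Gamma>" using Cons by auto
  have c: "Y \<in> carrier P" "emb k h \<in> carrier P" "emb v g \<in> carrier P"
    using X Cons prods_carrier[of ks] assms v by (auto simp: emb_closed)
  show ?case
  proof (cases "v = k")
    case True
    interpret group "G v" using v by (rule group_G)
    have "emb v g \<otimes>\<^bsub>P\<^esub> X = emb k (g \<otimes>\<^bsub>G k\<^esub> h) \<otimes>\<^bsub>P\<^esub> Y"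
      using True X c v assms(4) by (simp add: emb_mult P.m_assoc)
    moreover have "g \<otimes>\<^bsub>G k\<^esub> h \<in> carrier (G k)" using m_closed X(2) True assms(4) by blast
    ultimately show ?thesis using X(3) by force
  next
    case False
    then have "v \<in> set ks" "v \<rightarrow>\<^bsub>\<Gamma>\<^esub> k" using Cons by auto
    then have "emb v g \<otimes>\<^bsub>P\<^esub> X = emb k h \<otimes>\<^bsub>P\<^esub> (emb v g \<otimes>\<^bsub>P\<^esub> Y)" "emb v g \<otimes>\<^bsub>P\<^esub> Y \<in> prods ks"
      using emb_commute[of v k g h] c X assms(4) Cons by (simp_all flip: P.m_assoc)
    then show ?thesis using X(2) by auto
  qed
qed simp

definition cone :: "'v list" where
  "cone = (SOME ks. set ks = verts \<Gamma> - core)"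

lemma set_cone: "set cone = verts \<Gamma> - core"
  unfolding cone_def by (rule someI_ex) (simp add: finite_list)

lemma adj_cone: "u \<in> verts \<Gamma> \<Longrightarrow> k \<in> set cone \<Longrightarrow> u \<noteq> k \<Longrightarrow> u \<rightarrow>\<^bsub>\<Gamma>\<^esub> k"
  using dominates_sym[of k u] unfolding set_cone core_def by auto

abbreviation core_group where
  "core_group \<equiv> generate P (\<Union>v\<in>core. vertex_group \<Gamma> G v)"

lemma core_verts: "core \<subseteq> verts \<Gamma>"
  by (auto simp: core_def)

text \<open>Core generators commute past the factor from \<open>prods cone\<close>, and the other
  generators are absorbed by it. \<open>Q\<close> need not be a subgroup, so that the core subgroup
  and an explicit description of the dihedral group can both be inserted.\<close>

lemma cone_core_decomp:
  assumes "X \<in> carrier P" "\<one>\<^bsub>P\<^esub> \<in> Q" "Q \<subseteq> carrier P"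
    and "\<And>v g p. v \<in> core \<Longrightarrow> g \<in> carrier (G v) \<Longrightarrow> p \<in> Q \<Longrightarrow> emb v g \<otimes>\<^bsub>P\<^esub> p \<in> Q"
  shows "\<exists>k\<in>prods cone. \<exists>p\<in>Q. X = k \<otimes>\<^bsub>P\<^esub> p"
  using assms(1)
proof (induction rule: generators_induct)
  case one
  have "\<one>\<^bsub>P\<^esub> \<in> prods cone" by (rule one_prods) (simp add: set_cone)
  with assms(2) show ?case by (metis P.r_one P.one_closed)
next
  case (mult v g Y)
  then obtain k p where k: "k \<in> prods cone" "p \<in> Q" "Y = k \<otimes>\<^bsub>P\<^esub> p" by auto
  have cone: "set cone \<subseteq> verts \<Gamma>" by (simp add: set_cone)
  have c: "k \<in> carrier P" "p \<in> carrier P" "emb v g \<in> carrier P"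
    using k prods_carrier[OF cone] assms(3) mult by (auto simp: emb_closed)
  show ?case
  proof (cases "v \<in> core")
    case True
    then have "emb v g \<otimes>\<^bsub>P\<^esub> k = k \<otimes>\<^bsub>P\<^esub> emb v g"
      using mult k cone by (intro prods_commute[of cone]) (auto simp: set_cone intro!: adj_cone)
    then have "emb v g \<otimes>\<^bsub>P\<^esub> Y = k \<otimes>\<^bsub>P\<^esub> (emb v g \<otimes>\<^bsub>P\<^esub> p)" using c k by (simp flip: P.m_assoc)
    then show ?thesis using k assms(4)[OF True] mult by blast
  next
    case False
    then have "emb v g \<otimes>\<^bsub>P\<^esub> k \<in> prods cone"
      using mult k cone by (intro prods_mult) (auto simp: set_cone intro!: adj_cone)
    moreover have "emb v g \<otimes>\<^bsub>P\<^esub> Y = (emb v g \<otimes>\<^bsub>P\<^esub> k) \<otimes>\<^bsub>P\<^esub> p" using c k by (simp add: P.m_assoc)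
    ultimately show ?thesis using k by blast
  qed
qed

text \<open>One edge is spent for each vertex outside the core, and one for the whole core subgroup,
  which is a minsquare subgroup or trivial.\<close>

lemma bounded_if_minsquare:
  assumes "core = {} \<or> minsquare_set (dominates \<Gamma>) (verts \<Gamma>) core" "X \<in> carrier P"
  shows "len X \<le> length cone + 1"
proof -
  have sub: "(\<Union>v\<in>core. vertex_group \<Gamma> G v) \<subseteq> carrier P" by (rule vertex_groups_carrier) (rule core_verts)
  have "\<exists>k\<in>prods cone. \<exists>p\<in>core_group. X = k \<otimes>\<^bsub>P\<^esub> p"
  proof (rule cone_core_decomp[OF assms(2)])
    show "core_group \<subseteq> carrier P" using sub by (rule P.generate_incl)
    show "emb v g \<otimes>\<^bsub>P\<^esub> p \<in> core_group" if "v \<in> core" "g \<in> carrier (G v)" "p \<in> core_group" for v g p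
    proof -
      have "emb v g \<in> (\<Union>v\<in>core. vertex_group \<Gamma> G v)" using that by (auto simp: vertex_group_eq)
      then show ?thesis using that by (intro generate.eng[OF generate.incl])
    qed
  qed (rule generate.one)
  then obtain k p where k: "k \<in> prods cone" "p \<in> core_group" "X = k \<otimes>\<^bsub>P\<^esub> p" by blast
  have "p \<in> wball 1"
  proof (cases "core = {}")
    case True
    then have "p = \<one>\<^bsub>P\<^esub>" using k P.generate_empty by auto
    then show ?thesis by simp
  next
    case False
    have "minsquare_subgraph (\<Gamma> \<restriction> core) \<Gamma>"
      unfolding minsquare_subgraph_iff using assms False core_verts induced_subgraph_restrict[OF wf_digraph, of core]
      by simp
    then have "p \<in> gens" using k by (auto simp: gens_def special_subgroup_def)
    then show ?thesis by (rule gens_wball)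
  qed
  moreover have "k \<in> wball (length cone)" using k by (intro prods_wball) (auto simp: set_cone)
  ultimately show ?thesis unfolding k(3) by (intro len_le wball_mult)
qed

section \<open>Linear growth along rays and its consequences\<close>

lemma core_rays:
  assumes "core \<noteq> {}" "\<not> minsquare_set (dominates \<Gamma>) (verts \<Gamma>) core"
  obtains r where "r > 0"
    "\<And>v g. v \<in> core \<Longrightarrow> g \<in> carrier (G v) \<Longrightarrow> g \<noteq> \<one>\<^bsub>G v\<^esub> \<Longrightarrow>
       \<exists>W c. ray W c \<and> W 0 = v \<and> c 0 = g \<and> (\<forall>i. \<forall>v\<in>core. \<exists>j<r. W (i + j) = v)"
proof -
  obtain p r where p: "r > 0" "\<And>i. (p i, p (Suc i)) \<in> nonadj" "\<And>i v. v \<in> core \<Longrightarrow> \<exists>j<r. p (i + j) = v"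
    by (rule core_walk[OF assms]) (rule that)
  show thesis
  proof (rule that[OF p(1)])
    fix v g assume v: "v \<in> core" "g \<in> carrier (G v)" "g \<noteq> \<one>\<^bsub>G v\<^esub>"
    obtain j where j: "p j = v" using p(3)[OF v(1), of 0] by auto
    define W where "W i = p (i + j)" for i
    \<comment> \<open>Only the first syllable is prescribed, since it alone distinguishes the legs
      of a tripod; later ones are arbitrary non-trivial elements.\<close>
    define c where "c i = (if i = 0 then g else SOME h. h \<in> carrier (G (W i)) \<and> h \<noteq> \<one>\<^bsub>G (W i)\<^esub>)" for i
    have W: "(W i, W (Suc i)) \<in> nonadj" for i using p(2)[of "i + j"] by (simp add: W_def)
    have "c i \<in> carrier (G (W i)) \<and> c i \<noteq> \<one>\<^bsub>G (W i)\<^esub>" for i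
    proof (cases "i = 0")
      case True
      then show ?thesis using v j by (simp add: c_def W_def)
    next
      case False
      have "W i \<in> verts \<Gamma>" using W[of i] by (simp add: nonadj_def)
      then have "\<exists>h. h \<in> carrier (G (W i)) \<and> h \<noteq> \<one>\<^bsub>G (W i)\<^esub>" using nontrivial_element by metis
      from someI_ex[OF this] show ?thesis using False by (simp add: c_def)
    qed
    then have "ray W c" using W by (simp add: ray_def)
    moreover have "\<exists>l<r. W (i + l) = u" if "u \<in> core" for i u
      using p(3)[OF that, of "i + j"] by (simp add: W_def ac_simps)
    ultimately show "\<exists>W c. ray W c \<and> W 0 = v \<and> c 0 = g \<and> (\<forall>i. \<forall>v\<in>core. \<exists>j<r. W (i + j) = v)"
      using j by (intro exI[of _ W] exI[of _ c]) (simp add: W_def[of 0] c_def[of 0])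
  qed
qed

lemma pre_one_dist:
  assumes "ray W c" "\<And>i v. v \<in> core \<Longrightarrow> \<exists>j<r. W (i + j) = v"
    and "core \<noteq> {}" "\<not> minsquare_set (dominates \<Gamma>) (verts \<Gamma>) core"
  shows "real n \<le> real r * dE (pre W c n) \<one>\<^bsub>P\<^esub>"
  using depth_dist[OF assms pre_closed[OF assms(1)] P.one_closed, of n n] depth_pre[OF assms(1), of n n]
    depth_one[OF assms(1), of n] by simp

lemma pre_pre_dist:
  assumes "ray W c" "\<And>i v. v \<in> core \<Longrightarrow> \<exists>j<r. W (i + j) = v"
    and "core \<noteq> {}" "\<not> minsquare_set (dominates \<Gamma>) (verts \<Gamma>) core"
    and "ray W' c'" "(W' 0, c' 0) \<noteq> (W 0, c 0)"
  shows "real n \<le> real r * dE (pre W c n) (pre W' c' t)"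
  using depth_dist[OF assms(1-4) pre_closed[OF assms(1)] pre_closed[OF assms(5)], of n n t]
    depth_pre[OF assms(1), of n n] depth_other[OF assms(1,5,6), of n t] by simp

lemma bounded_iff:
  "bounded_diameter (verts E) dE \<longleftrightarrow> core = {} \<or> minsquare_set (dominates \<Gamma>) (verts \<Gamma>) core"
proof
  assume "bounded_diameter (verts E) dE"
  then obtain b where b: "\<And>X Y. X \<in> carrier P \<Longrightarrow> Y \<in> carrier P \<Longrightarrow> dE X Y \<le> b"
    by (auto simp: bounded_diameter_def verts_E)
  show "core = {} \<or> minsquare_set (dominates \<Gamma>) (verts \<Gamma>) core"
  proof (rule ccontr)
    assume "\<not> ?thesis"
    then have *: "core \<noteq> {}" "\<not> minsquare_set (dominates \<Gamma>) (verts \<Gamma>) core" by auto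
    obtain r where r: "\<And>v g. v \<in> core \<Longrightarrow> g \<in> carrier (G v) \<Longrightarrow> g \<noteq> \<one>\<^bsub>G v\<^esub> \<Longrightarrow>
       \<exists>W c. ray W c \<and> W 0 = v \<and> c 0 = g \<and> (\<forall>i. \<forall>v\<in>core. \<exists>j<r. W (i + j) = v)"
      using core_rays[OF *] by metis
    obtain v where v: "v \<in> core" using * by auto
    then obtain g where "g \<in> carrier (G v)" "g \<noteq> \<one>\<^bsub>G v\<^esub>" using nontrivial_element core_verts by blast
    then obtain W c where W: "ray W c" "\<And>i v. v \<in> core \<Longrightarrow> \<exists>j<r. W (i + j) = v" using r[OF v] by blast
    obtain n :: nat where n: "real n > real r * b" using reals_Archimedean2 by blast
    have "real n \<le> real r * dE (pre W c n) \<one>\<^bsub>P\<^esub>" by (rule pre_one_dist[OF W *])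
    also have "\<dots> \<le> real r * b" using b pre_closed[OF W(1)] by (intro mult_left_mono) auto
    finally show False using n by simp
  qed
next
  assume "core = {} \<or> minsquare_set (dominates \<Gamma>) (verts \<Gamma>) core"
  then show "bounded_diameter (verts E) dE" unfolding bounded_diameter_iff using bounded_if_minsquare by blast
qed

lemma quasi_line_unbounded:
  assumes "quasi_line (verts E) dE"
  shows "\<not> bounded_diameter (verts E) dE"
proof
  assume "bounded_diameter (verts E) dE"
  then obtain b where b: "\<And>X Y. X \<in> carrier P \<Longrightarrow> Y \<in> carrier P \<Longrightarrow> dE X Y \<le> b"
    by (auto simp: bounded_diameter_def verts_E)
  obtain f :: "('v \<times> 'a) list set set \<Rightarrow> real" and L C where f: "L \<ge> 1"
    "\<And>X Y. X \<in> carrier P \<Longrightarrow> Y \<in> carrier P \<Longrightarrow> \<bar>f X - f Y\<bar> \<le> L * dE X Y + C"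
    "\<And>y. \<exists>X\<in>carrier P. \<bar>f X - y\<bar> \<le> C"
    using quasi_lineE[OF assms] unfolding verts_E by metis
  \<comment> \<open>Values of \<open>f\<close> stay within \<open>L * b + C\<close> of
    \<open>f\<close> at the identity, and coarse surjectivity allows another error \<open>C\<close>;
    this point is one unit beyond both.\<close>
  define y where "y = f \<one>\<^bsub>P\<^esub> + L * b + 2 * C + 1"
  obtain X where X: "X \<in> carrier P" "\<bar>f X - y\<bar> \<le> C" using f(3) by blast
  have "\<bar>f X - f \<one>\<^bsub>P\<^esub>\<bar> \<le> L * dE X \<one>\<^bsub>P\<^esub> + C" using f(2) X by simp
  also have "\<dots> \<le> L * b + C" using f(1) b X by (simp add: mult_left_mono)
  finally show False using X(2) by (simp add: y_def abs_le_iff)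
qed

text \<open>The three rays start with different syllables, so each end is outside the half-spaces of
  the other rays and far from all of their points. Their images in the line would form a tripod
  there.\<close>

lemma tripod_not_quasi_line:
  assumes "quasi_line (verts E) dE" "core \<noteq> {}" "\<not> minsquare_set (dominates \<Gamma>) (verts \<Gamma>) core"
    and S: "\<And>i. i < 3 \<Longrightarrow> v i \<in> core \<and> g i \<in> carrier (G (v i)) \<and> g i \<noteq> \<one>\<^bsub>G (v i)\<^esub>"
    and distinct: "\<And>i j. i < 3 \<Longrightarrow> j < 3 \<Longrightarrow> i \<noteq> j \<Longrightarrow> (v i, g i) \<noteq> (v j, g (j::nat))"
  shows False
proof -
  obtain f :: "('v \<times> 'a) list set set \<Rightarrow> real" and L C where f: "L \<ge> 1"
    "\<And>X Y. X \<in> carrier P \<Longrightarrow> Y \<in> carrier P \<Longrightarrow> dE X Y / L - C \<le> \<bar>f X - f Y\<bar>"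
    "\<And>X Y. X \<in> carrier P \<Longrightarrow> Y \<in> carrier P \<Longrightarrow> \<bar>f X - f Y\<bar> \<le> L * dE X Y + C"
    using quasi_lineE[OF assms(1)] unfolding verts_E by metis
  obtain r where r: "r > 0" "\<And>v g. v \<in> core \<Longrightarrow> g \<in> carrier (G v) \<Longrightarrow> g \<noteq> \<one>\<^bsub>G v\<^esub> \<Longrightarrow>
     \<exists>W c. ray W c \<and> W 0 = v \<and> c 0 = g \<and> (\<forall>i. \<forall>v\<in>core. \<exists>j<r. W (i + j) = v)"
    using core_rays[OF assms(2,3)] by metis
  then have "\<forall>i. \<exists>W c. i < 3 \<longrightarrow> ray W c \<and> W 0 = v i \<and> c 0 = g i \<and> (\<forall>i. \<forall>v\<in>core. \<exists>j<r. W (i + j) = v)"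
    using S by metis
  then obtain W c where W: "\<And>i. i < 3 \<Longrightarrow> ray (W i) (c i)" "\<And>i. i < 3 \<Longrightarrow> W i 0 = v i"
    "\<And>i. i < 3 \<Longrightarrow> c i 0 = g i" "\<And>i k u. i < 3 \<Longrightarrow> u \<in> core \<Longrightarrow> \<exists>j<r. W i (k + j) = u" by metis
  define F where "F i t = f (pre (W i) (c i) t)" for i t
  \<comment> \<open>The distance between different legs is at least \<open>n / r\<close>. With this
    choice it exceeds \<open>(L + 2 * C) * L\<close>, so the images are more than
    \<open>L + C\<close> apart, which is the bound on a single step in the line.\<close>
  obtain n :: nat where n: "real n > (L + 2 * C) * L * r" using reals_Archimedean2 by blast
  show False
  proof (rule no_tripod_in_line[of F "L + C" n])
    fix i t :: nat assume i: "i < 3"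
    have pc: "pre (W i) (c i) k \<in> carrier P" for k using pre_closed W(1)[OF i] by blast
    have s: "emb (W i t) (c i t) \<in> gens" "emb (W i t) (c i t) \<in> carrier P"
      using rayD[OF W(1)[OF i]] by (auto intro: emb_gens emb_closed)
    then have "inv\<^bsub>P\<^esub> pre (W i) (c i) t \<otimes>\<^bsub>P\<^esub> pre (W i) (c i) (Suc t) \<in> wball 1"
      using pc[of t] by (simp add: gens_wball[unfolded One_nat_def] del: wball.simps flip: P.m_assoc)
    then have "dE (pre (W i) (c i) t) (pre (W i) (c i) (Suc t)) \<le> 1"
      using len_le pc by (simp add: dE_eq del: pre.simps)
    then have "L * dE (pre (W i) (c i) t) (pre (W i) (c i) (Suc t)) \<le> L" using f(1) by simp
    then show "\<bar>F i (Suc t) - F i t\<bar> \<le> L + C"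
      using f(3)[OF pc[of t] pc[of "Suc t"]] unfolding F_def by linarith
  next
    fix i j t :: nat assume ij: "i < 3" "j < 3" "i \<noteq> j"
    have ne: "(W j 0, c j 0) \<noteq> (W i 0, c i 0)" using distinct[OF ij(2,1)] ij W(2,3) by auto
    have "real n \<le> real r * dE (pre (W i) (c i) n) (pre (W j) (c j) t)"
      using pre_pre_dist[OF W(1)[OF ij(1)] W(4)[OF ij(1)] assms(2,3) W(1)[OF ij(2)] ne] .
    with n have "real r * ((L + 2 * C) * L) < real r * dE (pre (W i) (c i) n) (pre (W j) (c j) t)"
      by (simp add: mult.commute)
    then have "(L + 2 * C) * L < dE (pre (W i) (c i) n) (pre (W j) (c j) t)"
      using r(1) by simp
    then have "L + 2 * C < dE (pre (W i) (c i) n) (pre (W j) (c j) t) / L"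
      using f(1) by (simp add: pos_less_divide_eq)
    then show "L + C < \<bar>F i n - F j t\<bar>"
      using f(2)[OF pre_closed[OF W(1)[OF ij(1)], of n] pre_closed[OF W(1)[OF ij(2)], of t]]
      unfolding F_def by linarith
  qed (simp add: F_def)
qed

text \<open>A third non-trivial syllable over the core would start a third leg of a tripod. As
  \<open>a\<close> and \<open>b\<close> already supply one syllable each, neither a further core
  vertex nor a further group element is possible.\<close>

lemma quasi_line_core:
  assumes "quasi_line (verts E) dE"
  obtains a b x y where "core = {a, b}" "(a, b) \<in> nonadj"
    "carrier (G a) = {\<one>\<^bsub>G a\<^esub>, x}" "x \<noteq> \<one>\<^bsub>G a\<^esub>" "carrier (G b) = {\<one>\<^bsub>G b\<^esub>, y}" "y \<noteq> \<one>\<^bsub>G b\<^esub>"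
proof -
  have c: "core \<noteq> {}" "\<not> minsquare_set (dominates \<Gamma>) (verts \<Gamma>) core"
    using quasi_line_unbounded[OF assms] bounded_iff by auto
  obtain a b where ab: "(a, b) \<in> nonadj" using c by (auto simp: core_eq_Domain)
  then have abc: "a \<in> core" "b \<in> core" "a \<noteq> b"
    using symD[OF sym_nonadj, of a b] by (auto simp: core_eq_Domain nonadj_def)
  obtain x where x: "x \<in> carrier (G a)" "x \<noteq> \<one>\<^bsub>G a\<^esub>" using nontrivial_element abc core_verts by blast
  obtain y where y: "y \<in> carrier (G b)" "y \<noteq> \<one>\<^bsub>G b\<^esub>" using nontrivial_element abc core_verts by blast
  have two: "(u, h) = (a, x) \<or> (u, h) = (b, y)" if "u \<in> core" "h \<in> carrier (G u)" "h \<noteq> \<one>\<^bsub>G u\<^esub>" for u h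
  proof (rule ccontr)
    assume ne: "\<not> ?thesis"
    define v where "v i = (if i = 0 then a else if i = 1 then b else u)" for i :: nat
    define g where "g i = (if i = 0 then x else if i = 1 then y else h)" for i :: nat
    show False
    proof (rule tripod_not_quasi_line[OF assms c, of v g])
      show "v i \<in> core \<and> g i \<in> carrier (G (v i)) \<and> g i \<noteq> \<one>\<^bsub>G (v i)\<^esub>" for i
        using abc x y that by (simp add: v_def g_def)
      show "(v i, g i) \<noteq> (v j, g j)" if "i < 3" "j < 3" "i \<noteq> j" for i j
        using that ne abc by (auto simp: v_def g_def split: if_splits)
    qed
  qed
  have one: "\<one>\<^bsub>G u\<^esub> \<in> carrier (G u)" if "u \<in> core" for u
    using that core_verts group_G group.is_monoid monoid.one_closed by blast
  have "core = {a, b}"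
  proof -
    have "u = a \<or> u = b" if "u \<in> core" for u
      using nontrivial_element[of u] two[OF that] that core_verts by blast
    with abc show ?thesis by blast
  qed
  moreover have "carrier (G a) = {\<one>\<^bsub>G a\<^esub>, x}" "carrier (G b) = {\<one>\<^bsub>G b\<^esub>, y}"
    using two abc x y one by blast+
  ultimately show thesis using that ab x y by blast
qed

end

section \<open>Virtually cyclic graph products\<close>

lemma (in group) infinite_cyclic_generate:
  assumes x: "x \<in> carrier G" and "\<And>n::nat. n > 0 \<Longrightarrow> x [^] n \<noteq> \<one>"
  shows "subgroup_generated G (generate G {x}) \<cong> integer_group"
proof -
  let ?K = "subgroup_generated G (generate G {x})"
  have K: "carrier ?K = range (\<lambda>n::int. x [^] n)"
  proof -
    have "subgroup (generate G {x}) G" using x by (intro generate_is_subgroup) auto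
    then have "carrier ?K = generate G {x}" by (rule subgroup.carrier_subgroup_generated_subgroup)
    then show ?thesis using generate_pow[OF x] by auto
  qed
  have inj: "m = n" if "x [^] (m::int) = x [^] (n::int)" for m n
  proof (rule ccontr)
    assume "m \<noteq> n"
    have *: "x [^] (m - n) = \<one>" "x [^] (n - m) = \<one>" using that x by (simp_all add: int_pow_diff)
    define k where "k = nat \<bar>m - n\<bar>"
    have "x [^] (int k) = \<one>" unfolding k_def using * by (cases "m \<le> n") auto
    then have "x [^] k = \<one>" by (simp add: int_pow_int)
    moreover have "k > 0" using \<open>m \<noteq> n\<close> by (simp add: k_def)
    ultimately show False using assms(2) by blast
  qed
  have "(\<lambda>n::int. x [^] n) \<in> iso integer_group ?K"
    unfolding iso_def bij_betw_def hom_def using x inj by (auto simp: K int_pow_mult inj_on_def)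
  then have "integer_group \<cong> ?K" by (auto simp: is_iso_def)
  then show ?thesis by (rule group.iso_sym[OF group_integer_group])
qed

lemma (in group) virtually_infinite_cyclicE:
  assumes "virtually_infinite_cyclic G"
  obtains H \<phi> where "subgroup H G" "finite (rcosets H)" "bij_betw \<phi> H (UNIV :: int set)"
    "\<And>x y. x \<in> H \<Longrightarrow> y \<in> H \<Longrightarrow> \<phi> (x \<otimes> y) = \<phi> x + \<phi> y"
proof -
  obtain H where H: "subgroup H G" "finite (rcosets H)" "subgroup_generated G H \<cong> integer_group"
    using assms by (auto simp: virtually_infinite_cyclic_def)
  then obtain \<phi> where \<phi>: "\<phi> \<in> iso (subgroup_generated G H) integer_group" by (auto simp: is_iso_def)
  have "carrier (subgroup_generated G H) = H" using H(1) by (rule subgroup.carrier_subgroup_generated_subgroup)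
  with \<phi> show thesis by (intro that[OF H(1,2), of \<phi>]) (auto simp: iso_def hom_def)
qed

text \<open>Pigeonhole: two powers of \<open>x\<close> lie in the same coset of \<open>H\<close>,
  and their quotient is a positive power in \<open>H\<close>.\<close>

lemma (in group) power_in_finite_index:
  assumes H: "subgroup H G" "finite (rcosets H)" and x: "x \<in> carrier G"
  obtains k :: nat where "k > 0" "x [^] k \<in> H"
proof -
  have "range (\<lambda>n::nat. H #> (x [^] n)) \<subseteq> rcosets H" using x H(1) by (auto intro!: rcosetsI subgroup.subset)
  then have "finite (range (\<lambda>n::nat. H #> (x [^] n)))" using H(2) finite_subset by blast
  then have "\<not> inj (\<lambda>n::nat. H #> (x [^] n))" using finite_imageD infinite_UNIV_nat by blast
  then obtain i j :: nat where ij: "H #> (x [^] i) = H #> (x [^] j)" "i < j"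
    unfolding inj_def by (metis linorder_neqE_nat)
  have "x [^] j \<in> H #> (x [^] i)" unfolding ij(1) using x H(1) by (intro rcos_self) auto
  then obtain h where h: "h \<in> H" "x [^] j = h \<otimes> x [^] i" by (auto simp: r_coset_def)
  have "x [^] (j - i) \<otimes> x [^] i = h \<otimes> x [^] i" using h ij(2) x by (simp add: nat_pow_mult)
  then have "x [^] (j - i) = h" using x h H(1) subgroup.subset[OF H(1)] by (simp add: subset_iff)
  with h ij show thesis by (intro that[of "j - i"]) auto
qed

context finite_graph_product begin

text \<open>The power is the prefix of length \<open>2 * n\<close> of the ray alternating between
  \<open>a\<close> and \<open>b\<close>, so its first syllable survives. In particular the product
  has infinite order.\<close>

lemma proj_alternating:
  assumes "(a, b) \<in> nonadj" "g \<in> carrier (G a)" "g \<noteq> \<one>\<^bsub>G a\<^esub>" "h \<in> carrier (G b)" "h \<noteq> \<one>\<^bsub>G b\<^esub>" "n > 0"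
  shows "proj a ((emb a g \<otimes>\<^bsub>P\<^esub> emb b h) [^]\<^bsub>P\<^esub> (n::nat)) = g"
proof -
  let ?W = "\<lambda>i::nat. if even i then a else b" and ?c = "\<lambda>i::nat. if even i then g else h"
  have r: "ray ?W ?c" using assms symD[OF sym_nonadj assms(1)] by (auto simp: ray_def)
  have "a \<in> verts \<Gamma>" "b \<in> verts \<Gamma>" using assms by (auto simp: nonadj_def)
  then have c: "emb a g \<in> carrier P" "emb b h \<in> carrier P" using assms by (auto intro: emb_closed)
  have pow: "pre ?W ?c (2 * n) = (emb a g \<otimes>\<^bsub>P\<^esub> emb b h) [^]\<^bsub>P\<^esub> n" for n
    by (induction n) (use c in \<open>simp_all add: P.m_assoc\<close>)
  obtain k where k: "2 * n = Suc k" using assms(6) by (cases n) auto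
  have "proj (?W 0) (pre ?W ?c (2 * n)) = ?c 0" unfolding k by (rule proj_pre_first[OF r])
  then show ?thesis unfolding pow by simp
qed

lemma core_pair_virtually_infinite_cyclic:
  assumes core: "core = {a, b}" and ab: "(a, b) \<in> nonadj"
    and Ga: "carrier (G a) = {\<one>\<^bsub>G a\<^esub>, x}" "x \<noteq> \<one>\<^bsub>G a\<^esub>" and Gb: "carrier (G b) = {\<one>\<^bsub>G b\<^esub>, y}" "y \<noteq> \<one>\<^bsub>G b\<^esub>"
  shows "virtually_infinite_cyclic P"
proof -
  have V: "a \<in> verts \<Gamma>" "b \<in> verts \<Gamma>" using ab by (auto simp: nonadj_def)
  define A B where "A = emb a x" and "B = emb b y"
  define t where "t = A \<otimes>\<^bsub>P\<^esub> B"
  have c[simp]: "A \<in> carrier P" "B \<in> carrier P" "t \<in> carrier P"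
    using V Ga Gb by (auto simp: A_def B_def t_def intro!: emb_closed)
  have sq: "emb v g \<otimes>\<^bsub>P\<^esub> emb v g = \<one>\<^bsub>P\<^esub>" if "v \<in> verts \<Gamma>" "carrier (G v) = {\<one>\<^bsub>G v\<^esub>, g}" "g \<noteq> \<one>\<^bsub>G v\<^esub>" for v g
  proof -
    interpret group "G v" using that by (intro group_G)
    have g: "g \<in> carrier (G v)" using that by simp
    then have "g \<otimes>\<^bsub>G v\<^esub> g \<in> {\<one>\<^bsub>G v\<^esub>, g}" using that(2) by (metis m_closed)
    moreover have "g \<otimes>\<^bsub>G v\<^esub> g \<noteq> g" using g that(3) by simp
    ultimately have "g \<otimes>\<^bsub>G v\<^esub> g = \<one>\<^bsub>G v\<^esub>" by blast
    then show ?thesis using that(1) g emb_mult[of v g g] by (simp add: emb_one)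
  qed
  have A2: "A \<otimes>\<^bsub>P\<^esub> A = \<one>\<^bsub>P\<^esub>" and B2: "B \<otimes>\<^bsub>P\<^esub> B = \<one>\<^bsub>P\<^esub>"
    using sq V Ga Gb by (auto simp: A_def B_def)
  have invA: "inv\<^bsub>P\<^esub> A = A" and invB: "inv\<^bsub>P\<^esub> B = B" using P.inv_equality[OF A2] P.inv_equality[OF B2] by simp_all
  have Bt: "B = A \<otimes>\<^bsub>P\<^esub> t" using A2 by (simp add: t_def flip: P.m_assoc)
  have invt: "inv\<^bsub>P\<^esub> t = B \<otimes>\<^bsub>P\<^esub> A" using invA invB by (simp add: t_def P.inv_mult_group)
  let ?H = "generate P {t}"
  have H: "subgroup ?H P" by (intro P.generate_is_subgroup) auto
  note Hsub = subgroup.subset[OF H]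
  \<comment> \<open>Conjugation by the involution \<open>A\<close> inverts \<open>t\<close>, so
    \<open>A\<close> can be moved past \<open>?H\<close>.\<close>
  have conj: "\<exists>p'\<in>?H. A \<otimes>\<^bsub>P\<^esub> p = p' \<otimes>\<^bsub>P\<^esub> A" if "p \<in> ?H" for p
    using that
  proof (induction rule: generate.induct)
    case one
    show ?case by (intro bexI[of _ "\<one>\<^bsub>P\<^esub>"]) (auto intro: generate.one)
  next
    case (incl h)
    have "A \<otimes>\<^bsub>P\<^esub> t = inv\<^bsub>P\<^esub> t \<otimes>\<^bsub>P\<^esub> A" using A2 by (simp add: invt P.m_assoc flip: Bt)
    then show ?case using incl by (intro bexI[of _ "inv\<^bsub>P\<^esub> t"]) (auto intro: generate.inv)
  next
    case (inv h)
    have "A \<otimes>\<^bsub>P\<^esub> inv\<^bsub>P\<^esub> t = t \<otimes>\<^bsub>P\<^esub> A" unfolding invt by (simp add: t_def P.m_assoc)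
    then show ?case using inv by (intro bexI[of _ t]) (auto intro: generate.incl)
  next
    case (eng h1 h2)
    then obtain p1 p2 where p: "p1 \<in> ?H" "A \<otimes>\<^bsub>P\<^esub> h1 = p1 \<otimes>\<^bsub>P\<^esub> A" "p2 \<in> ?H" "A \<otimes>\<^bsub>P\<^esub> h2 = p2 \<otimes>\<^bsub>P\<^esub> A" by auto
    have cc: "h1 \<in> carrier P" "h2 \<in> carrier P" "p1 \<in> carrier P" "p2 \<in> carrier P" using eng p Hsub by auto
    have "A \<otimes>\<^bsub>P\<^esub> (h1 \<otimes>\<^bsub>P\<^esub> h2) = (A \<otimes>\<^bsub>P\<^esub> h1) \<otimes>\<^bsub>P\<^esub> h2" using cc by (simp add: P.m_assoc)
    also have "\<dots> = p1 \<otimes>\<^bsub>P\<^esub> (A \<otimes>\<^bsub>P\<^esub> h2)" using cc p by (simp add: P.m_assoc)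
    also have "\<dots> = (p1 \<otimes>\<^bsub>P\<^esub> p2) \<otimes>\<^bsub>P\<^esub> A" using cc p by (simp add: P.m_assoc)
    finally show ?case using p by (intro bexI[of _ "p1 \<otimes>\<^bsub>P\<^esub> p2"]) (auto intro: generate.eng)
  qed
  \<comment> \<open>This is the dihedral group generated by \<open>A\<close> and \<open>B\<close>,
    written with \<open>1\<close> and \<open>A\<close> as representatives modulo the translations
    \<open>?H\<close>. Stability under \<open>A\<close> and \<open>t\<close> gives stability under
    \<open>B = A t\<close>, as \<open>cone_core_decomp\<close> demands.\<close>
  define D where "D = {p \<otimes>\<^bsub>P\<^esub> h | p h. p \<in> ?H \<and> h \<in> {\<one>\<^bsub>P\<^esub>, A}}"
  have DI: "p \<otimes>\<^bsub>P\<^esub> h \<in> D" if "p \<in> ?H" "h \<in> {\<one>\<^bsub>P\<^esub>, A}" for p h using that by (auto simp: D_def)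
  have D_A: "A \<otimes>\<^bsub>P\<^esub> d \<in> D" if dD: "d \<in> D" for d
  proof -
    obtain p h where d: "d = p \<otimes>\<^bsub>P\<^esub> h" "p \<in> ?H" "h \<in> {\<one>\<^bsub>P\<^esub>, A}" using dD by (auto simp: D_def)
    obtain p' where p': "p' \<in> ?H" "A \<otimes>\<^bsub>P\<^esub> p = p' \<otimes>\<^bsub>P\<^esub> A" using conj d by auto
    have cc: "p \<in> carrier P" "p' \<in> carrier P" "h \<in> carrier P" using d p' Hsub by auto
    have "A \<otimes>\<^bsub>P\<^esub> d = p' \<otimes>\<^bsub>P\<^esub> (A \<otimes>\<^bsub>P\<^esub> h)" using cc p' d by (simp flip: P.m_assoc)
    moreover have "h = \<one>\<^bsub>P\<^esub> \<or> h = A" using d(3) by simp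
    then have "A \<otimes>\<^bsub>P\<^esub> h \<in> {\<one>\<^bsub>P\<^esub>, A}" by (elim disjE) (simp_all add: A2)
    ultimately show ?thesis using DI p' by simp
  qed
  have D_t: "t \<otimes>\<^bsub>P\<^esub> d \<in> D" if dD: "d \<in> D" for d
  proof -
    obtain p h where d: "d = p \<otimes>\<^bsub>P\<^esub> h" "p \<in> ?H" "h \<in> {\<one>\<^bsub>P\<^esub>, A}" using dD by (auto simp: D_def)
    then have "t \<otimes>\<^bsub>P\<^esub> d = (t \<otimes>\<^bsub>P\<^esub> p) \<otimes>\<^bsub>P\<^esub> h" using Hsub by (auto simp: P.m_assoc)
    moreover have "t \<otimes>\<^bsub>P\<^esub> p \<in> ?H" using d(2) by (intro generate.eng generate.incl[of t]) simp_all
    ultimately show ?thesis using DI d by simp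
  qed
  have Dc: "D \<subseteq> carrier P" using Hsub by (auto simp: D_def)
  have D1: "\<one>\<^bsub>P\<^esub> \<in> D" using DI[of "\<one>\<^bsub>P\<^esub>" "\<one>\<^bsub>P\<^esub>"] by (simp add: generate.one)
  have decomp: "\<exists>k\<in>prods cone. \<exists>p\<in>D. X = k \<otimes>\<^bsub>P\<^esub> p" if "X \<in> carrier P" for X
  proof (rule cone_core_decomp[OF that D1 Dc])
    fix v g p assume *: "v \<in> core" "g \<in> carrier (G v)" "p \<in> D"
    have pc: "p \<in> carrier P" using * Dc by auto
    have "v = a \<and> (g = \<one>\<^bsub>G a\<^esub> \<or> g = x) \<or> v = b \<and> (g = \<one>\<^bsub>G b\<^esub> \<or> g = y)"
    proof -
      have "v = a \<or> v = b" using *(1) core by simp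
      then show ?thesis using *(2) Ga(1) Gb(1) by (elim disjE) simp_all
    qed
    then consider "emb v g = \<one>\<^bsub>P\<^esub>" | "emb v g = A" | "emb v g = B"
      unfolding A_def B_def using emb_one V by metis
    then show "emb v g \<otimes>\<^bsub>P\<^esub> p \<in> D"
    proof cases
      case 3
      have "B \<otimes>\<^bsub>P\<^esub> p = A \<otimes>\<^bsub>P\<^esub> (t \<otimes>\<^bsub>P\<^esub> p)" using pc by (simp add: Bt P.m_assoc)
      then show ?thesis using 3 D_A D_t * by simp
    qed (use * pc D_A in simp_all)
  qed
  \<comment> \<open>Writing the inverse of \<open>X\<close> as \<open>k p h\<close> gives
    \<open>X = h p^-1 k^-1\<close>, because \<open>h\<close> is its own inverse. Moving
    \<open>h\<close> past the element of \<open>?H\<close> leaves \<open>h k^-1\<close> as coset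
    representative, and there are finitely many of these.\<close>
  let ?Q = "(\<lambda>(h, k). ?H #>\<^bsub>P\<^esub> (h \<otimes>\<^bsub>P\<^esub> inv\<^bsub>P\<^esub> k)) ` ({\<one>\<^bsub>P\<^esub>, A} \<times> prods cone)"
  have "rcosets\<^bsub>P\<^esub> ?H \<subseteq> ?Q"
  proof
    fix C assume "C \<in> rcosets\<^bsub>P\<^esub> ?H"
    then obtain X where X: "X \<in> carrier P" "C = ?H #>\<^bsub>P\<^esub> X" by (auto simp: RCOSETS_def)
    then obtain k p h where d: "k \<in> prods cone" "p \<in> ?H" "h \<in> {\<one>\<^bsub>P\<^esub>, A}" "inv\<^bsub>P\<^esub> X = k \<otimes>\<^bsub>P\<^esub> (p \<otimes>\<^bsub>P\<^esub> h)"
      using decomp[of "inv\<^bsub>P\<^esub> X"] by (auto simp: D_def)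
    have kc: "k \<in> carrier P" using d prods_carrier[of cone] by (auto simp: set_cone)
    have pc: "p \<in> carrier P" "inv\<^bsub>P\<^esub> p \<in> ?H" using d Hsub H by (auto intro: subgroup.m_inv_closed)
    have "h = \<one>\<^bsub>P\<^esub> \<or> h = A" using d(3) by simp
    then have hc: "h \<in> carrier P" "inv\<^bsub>P\<^esub> h = h" using invA by (metis P.one_closed P.inv_one c(1))+
    have "X = inv\<^bsub>P\<^esub> (k \<otimes>\<^bsub>P\<^esub> (p \<otimes>\<^bsub>P\<^esub> h))" using d(4) X by (metis P.inv_inv)
    also have "\<dots> = (h \<otimes>\<^bsub>P\<^esub> inv\<^bsub>P\<^esub> p) \<otimes>\<^bsub>P\<^esub> inv\<^bsub>P\<^esub> k" using kc pc hc by (simp add: P.inv_mult_group)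
    finally have X': "X = (h \<otimes>\<^bsub>P\<^esub> inv\<^bsub>P\<^esub> p) \<otimes>\<^bsub>P\<^esub> inv\<^bsub>P\<^esub> k" .
    obtain p' where p': "p' \<in> ?H" "h \<otimes>\<^bsub>P\<^esub> inv\<^bsub>P\<^esub> p = p' \<otimes>\<^bsub>P\<^esub> h"
      using \<open>h = \<one>\<^bsub>P\<^esub> \<or> h = A\<close> conj[OF pc(2)] pc P.l_one P.r_one P.inv_closed by metis
    have "p' \<in> carrier P" using p' Hsub by auto
    then have X2: "X = p' \<otimes>\<^bsub>P\<^esub> (h \<otimes>\<^bsub>P\<^esub> inv\<^bsub>P\<^esub> k)" using X' p' kc hc by (simp add: P.m_assoc)
    then have "X \<in> ?H #>\<^bsub>P\<^esub> (h \<otimes>\<^bsub>P\<^esub> inv\<^bsub>P\<^esub> k)" using p' by (auto simp: r_coset_def)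
    then have "C = ?H #>\<^bsub>P\<^esub> (h \<otimes>\<^bsub>P\<^esub> inv\<^bsub>P\<^esub> k)" using X P.repr_independence[OF _ _ H] kc hc by simp
    then show "C \<in> ?Q" using d by force
  qed
  moreover have "finite ?Q" using finite_prods[of cone] by (simp add: set_cone)
  ultimately have fin: "finite (rcosets\<^bsub>P\<^esub> ?H)" by (rule finite_subset)
  have "t [^]\<^bsub>P\<^esub> n \<noteq> \<one>\<^bsub>P\<^esub>" if "n > 0" for n :: nat
    using proj_alternating[OF ab _ Ga(2) _ Gb(2) that] Ga Gb by (auto simp: t_def A_def B_def proj_one)
  then have "subgroup_generated P ?H \<cong> integer_group" by (intro P.infinite_cyclic_generate) auto
  with H fin show ?thesis by (auto simp: virtually_infinite_cyclic_def)
qed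

text \<open>In a square the diagonals generate independent infinite cyclic subgroups.\<close>

lemma virtually_infinite_cyclic_no_square:
  assumes "virtually_infinite_cyclic P"
  shows "\<not> contains_square (dominates \<Gamma>) (verts \<Gamma>)"
proof
  assume "contains_square (dominates \<Gamma>) (verts \<Gamma>)"
  then obtain a b c d where sub: "{a, b, c, d} \<subseteq> verts \<Gamma>" and sq: "square (dominates \<Gamma>) a b c d"
    by (auto simp: contains_square_def)
  then have ac: "(a, c) \<in> nonadj" and bd: "(b, d) \<in> nonadj" and ne: "a \<noteq> b" "a \<noteq> d"
    by (auto simp: square_def nonadj_def)
  obtain ga gb gc gd where g: "ga \<in> carrier (G a)" "ga \<noteq> \<one>\<^bsub>G a\<^esub>" "gb \<in> carrier (G b)" "gb \<noteq> \<one>\<^bsub>G b\<^esub>"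
    "gc \<in> carrier (G c)" "gc \<noteq> \<one>\<^bsub>G c\<^esub>" "gd \<in> carrier (G d)" "gd \<noteq> \<one>\<^bsub>G d\<^esub>"
    using nontrivial_element sub by (metis insert_subset)
  define x y where "x = emb a ga \<otimes>\<^bsub>P\<^esub> emb c gc" and "y = emb b gb \<otimes>\<^bsub>P\<^esub> emb d gd"
  have xy: "x \<in> carrier P" "y \<in> carrier P" using sub g by (auto simp: x_def y_def emb_closed)
  have xn: "proj a (x [^]\<^bsub>P\<^esub> n) \<noteq> \<one>\<^bsub>G a\<^esub>" if "n > 0" for n :: nat
    unfolding x_def using proj_alternating[OF ac g(1,2,5,6) that] g by simp
  have yn: "y [^]\<^bsub>P\<^esub> n \<noteq> \<one>\<^bsub>P\<^esub>" if "n > 0" for n :: nat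
    unfolding y_def using proj_alternating[OF bd g(3,4,7,8) that] g by (auto simp: proj_one)
  let ?Y = "generate P (\<Union>v\<in>{b, d}. vertex_group \<Gamma> G v)"
  \<comment> \<open>The subgroup \<open>?Y\<close> contains the powers of \<open>y\<close> but is
    invisible at \<open>a\<close>, whereas positive powers of \<open>x\<close> project non-trivially
    to \<open>a\<close>.\<close>
  have Y: "subgroup ?Y P" using sub by (intro P.generate_is_subgroup vertex_groups_carrier) auto
  have projY: "proj a z = \<one>\<^bsub>G a\<^esub>" if "z \<in> ?Y" for z
  proof -
    have "invisible a z" using that sub ne by (intro invisible_generate[of "{b, d}"]) auto
    then have "z \<in> carrier P" "proj a (\<one>\<^bsub>P\<^esub> \<otimes>\<^bsub>P\<^esub> z) = proj a \<one>\<^bsub>P\<^esub>"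
      unfolding invisible_def using P.one_closed by blast+
    then show ?thesis by (simp add: proj_one)
  qed
  have "emb b gb \<in> ?Y" "emb d gd \<in> ?Y" using g by (auto intro!: generate.incl simp: vertex_group_eq)
  then have yY: "y \<in> ?Y" unfolding y_def by (rule generate.eng)
  have ynY: "y [^]\<^bsub>P\<^esub> n \<in> ?Y" for n :: nat
  proof (induction n)
    case 0
    show ?case unfolding P.nat_pow_0 by (rule generate.one)
  next
    case (Suc n)
    show ?case unfolding P.nat_pow_Suc by (rule generate.eng[OF Suc yY])
  qed
  obtain H \<phi> where H: "subgroup H P" "finite (rcosets\<^bsub>P\<^esub> H)" and bij: "bij_betw \<phi> H (UNIV :: int set)"
    and \<phi>: "\<And>u v. u \<in> H \<Longrightarrow> v \<in> H \<Longrightarrow> \<phi> (u \<otimes>\<^bsub>P\<^esub> v) = \<phi> u + \<phi> v"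
    using P.virtually_infinite_cyclicE[OF assms] by metis
  have inj: "u = v" if "u \<in> H" "v \<in> H" "\<phi> u = \<phi> v" for u v
    using that bij by (auto simp: bij_betw_def inj_on_def)
  have oneH: "\<one>\<^bsub>P\<^esub> \<in> H" using H(1) by (rule subgroup.one_closed)
  have \<phi>1: "\<phi> \<one>\<^bsub>P\<^esub> = 0" using \<phi>[OF oneH oneH] by simp
  have \<phi>inv: "\<phi> (inv\<^bsub>P\<^esub> u) = - \<phi> u" if "u \<in> H" for u
    using \<phi>[OF that subgroup.m_inv_closed[OF H(1) that]] \<phi>1 that subgroup.subset[OF H(1)] by auto
  have \<phi>pow: "u [^]\<^bsub>P\<^esub> n \<in> H \<and> \<phi> (u [^]\<^bsub>P\<^esub> n) = int n * \<phi> u" if u: "u \<in> H" for u and n :: nat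
  proof (induction n)
    case (Suc n)
    then show ?case using u \<phi> subgroup.m_closed[OF H(1)] by (simp add: algebra_simps)
  qed (use oneH \<phi>1 in simp)
  obtain k :: nat where k: "k > 0" "x [^]\<^bsub>P\<^esub> k \<in> H" by (rule P.power_in_finite_index[OF H xy(1)])
  obtain l :: nat where l: "l > 0" "y [^]\<^bsub>P\<^esub> l \<in> H" by (rule P.power_in_finite_index[OF H xy(2)])
  define p q where "p = \<phi> (x [^]\<^bsub>P\<^esub> k)" and "q = \<phi> (y [^]\<^bsub>P\<^esub> l)"
  have "q \<noteq> 0" using inj[OF l(2) oneH] yn[OF l(1)] \<phi>1 by (auto simp: q_def)
  \<comment> \<open>The exponents make the images \<open>\<bar>q\<bar> * p\<close> and
    \<open>\<bar>p\<bar> * q\<close> agree up to sign, so that \<open>x\<close> to the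
    \<open>m\<close> equals \<open>y\<close> to the \<open>n\<close> or its inverse. Since
    \<open>q\<close> is non-zero, \<open>m\<close> is positive; \<open>p\<close> may vanish.\<close>
  define m n where "m = k * nat \<bar>q\<bar>" and "n = l * nat \<bar>p\<bar>"
  have xm: "x [^]\<^bsub>P\<^esub> m = (x [^]\<^bsub>P\<^esub> k) [^]\<^bsub>P\<^esub> nat \<bar>q\<bar>"
    and yn': "y [^]\<^bsub>P\<^esub> n = (y [^]\<^bsub>P\<^esub> l) [^]\<^bsub>P\<^esub> nat \<bar>p\<bar>"
    by (simp_all only: m_def n_def P.nat_pow_pow[OF xy(1)] P.nat_pow_pow[OF xy(2)])
  have abs: "int (nat \<bar>q\<bar>) = \<bar>q\<bar>" "int (nat \<bar>p\<bar>) = \<bar>p\<bar>" by simp_all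
  have mn: "x [^]\<^bsub>P\<^esub> m \<in> H" "\<phi> (x [^]\<^bsub>P\<^esub> m) = \<bar>q\<bar> * p" "y [^]\<^bsub>P\<^esub> n \<in> H" "\<phi> (y [^]\<^bsub>P\<^esub> n) = \<bar>p\<bar> * q"
    using \<phi>pow[OF k(2), of "nat \<bar>q\<bar>"] \<phi>pow[OF l(2), of "nat \<bar>p\<bar>"]
    unfolding xm yn' abs p_def[symmetric] q_def[symmetric] by blast+
  have "\<bar>q\<bar> * p = \<bar>p\<bar> * q \<or> \<bar>q\<bar> * p = - (\<bar>p\<bar> * q)" by (auto simp: abs_if)
  then have "x [^]\<^bsub>P\<^esub> m = y [^]\<^bsub>P\<^esub> n \<or> x [^]\<^bsub>P\<^esub> m = inv\<^bsub>P\<^esub> (y [^]\<^bsub>P\<^esub> n)"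
    using inj[OF mn(1,3)] inj[OF mn(1) subgroup.m_inv_closed[OF H(1) mn(3)]] mn \<phi>inv[OF mn(3)] by auto
  then have "x [^]\<^bsub>P\<^esub> m \<in> ?Y" using ynY subgroup.m_inv_closed[OF Y] by auto
  then have "proj a (x [^]\<^bsub>P\<^esub> m) = \<one>\<^bsub>G a\<^esub>" by (rule projY)
  moreover have "m > 0" using k \<open>q \<noteq> 0\<close> by (simp add: m_def)
  ultimately show False using xn by blast
qed

section \<open>From a virtually infinite cyclic group to the line\<close>

lemma finite_gens:
  assumes "\<not> contains_square (dominates \<Gamma>) (verts \<Gamma>)"
  shows "finite gens"
proof -
  have "\<not> minsquare_subgraph \<Lambda> \<Gamma>" for \<Lambda>
  proof
    assume "minsquare_subgraph \<Lambda> \<Gamma>"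
    then have "contains_square (dominates \<Gamma>) (verts \<Lambda>)" "verts \<Lambda> \<subseteq> verts \<Gamma>"
      by (simp_all add: minsquare_subgraph_iff minsquare_set_def closed_under_squares_def)
    then show False using assms unfolding contains_square_def by (meson order_trans)
  qed
  then have "gens = (\<Union>v\<in>verts \<Gamma>. emb v ` carrier (G v))" by (auto simp: gens_def vertex_group_eq)
  then show ?thesis by (simp add: finite_G)
qed

text \<open>The quasi-isometry reads off the integer coordinate of the \<open>H\<close>-part of an
  element: \<open>X\<close> is split as \<open>\<kappa> X\<close> in \<open>H\<close> times a
  representative \<open>\<rho> X\<close> of its right coset. Finitely many representatives and
  generators bound the change along an edge.\<close>

lemma virtually_infinite_cyclic_quasi_line:
  assumes "virtually_infinite_cyclic P" "finite gens"
  shows "quasi_line (verts E) dE"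
proof -
  obtain H \<phi> where H: "subgroup H P" "finite (rcosets\<^bsub>P\<^esub> H)" and bij: "bij_betw \<phi> H (UNIV :: int set)"
    and \<phi>: "\<And>u v. u \<in> H \<Longrightarrow> v \<in> H \<Longrightarrow> \<phi> (u \<otimes>\<^bsub>P\<^esub> v) = \<phi> u + \<phi> v"
    using P.virtually_infinite_cyclicE[OF assms(1)] by metis
  note Hsub = subgroup.subset[OF H(1)] and Hm = subgroup.m_closed[OF H(1)] and Hinv = subgroup.m_inv_closed[OF H(1)]
  have inj: "u = v" if "u \<in> H" "v \<in> H" "\<phi> u = \<phi> v" for u v
    using that bij by (auto simp: bij_betw_def inj_on_def)
  have surj: "\<exists>u\<in>H. \<phi> u = n" for n
  proof -
    have "n \<in> \<phi> ` H" using bij by (simp add: bij_betw_def)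
    then show ?thesis by auto
  qed
  have oneH: "\<one>\<^bsub>P\<^esub> \<in> H" using H(1) by (rule subgroup.one_closed)
  have \<phi>1: "\<phi> \<one>\<^bsub>P\<^esub> = 0" using \<phi>[OF oneH oneH] by simp
  have \<phi>inv: "\<phi> (inv\<^bsub>P\<^esub> u) = - \<phi> u" if "u \<in> H" for u
    using \<phi>[OF that Hinv[OF that]] \<phi>1 that Hsub by auto
  define \<rho> where "\<rho> X = (SOME q. q \<in> H #>\<^bsub>P\<^esub> X)" for X
  define \<kappa> where "\<kappa> X = X \<otimes>\<^bsub>P\<^esub> inv\<^bsub>P\<^esub> \<rho> X" for X
  define f where "f X = \<phi> (\<kappa> X)" for X
  have \<rho>: "\<rho> X \<in> H #>\<^bsub>P\<^esub> X" if "X \<in> carrier P" for X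
    unfolding \<rho>_def using P.rcos_self[OF that H(1)] by (rule someI)
  have \<rho>c: "\<rho> X \<in> carrier P" if "X \<in> carrier P" for X
    using \<rho>[OF that] Hsub that by (auto simp: r_coset_def)
  have \<kappa>: "\<kappa> X \<in> H" if X: "X \<in> carrier P" for X
  proof -
    obtain h where h: "h \<in> H" "\<rho> X = h \<otimes>\<^bsub>P\<^esub> X" using \<rho>[OF X] by (auto simp: r_coset_def)
    then have "\<kappa> X = inv\<^bsub>P\<^esub> h" using X Hsub unfolding \<kappa>_def by (auto simp: P.inv_mult_group subset_iff simp flip: P.m_assoc)
    then show ?thesis using h Hinv by simp
  qed
  have \<kappa>\<rho>: "X = \<kappa> X \<otimes>\<^bsub>P\<^esub> \<rho> X" if X: "X \<in> carrier P" for X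
    using X \<rho>c[OF X] by (simp add: \<kappa>_def P.m_assoc)
  have coset: "H #>\<^bsub>P\<^esub> (h \<otimes>\<^bsub>P\<^esub> X) = H #>\<^bsub>P\<^esub> X" if "h \<in> H" "X \<in> carrier P" for h X
    using that Hsub P.coset_mult_assoc[OF Hsub, of h X] P.coset_join2[of h H] H(1) by auto
  \<comment> \<open>\<open>\<rho>\<close> depends only on the coset, so right multiplication by
    \<open>s\<close> changes \<open>f\<close> by an amount determined by the representative of
    \<open>X\<close> and \<open>s\<close>.\<close>
  have f_mult: "f (X \<otimes>\<^bsub>P\<^esub> s) = f X + f (\<rho> X \<otimes>\<^bsub>P\<^esub> s)" if X: "X \<in> carrier P" and s: "s \<in> carrier P" for X s
  proof -
    have c: "\<kappa> X \<in> carrier P" "\<rho> X \<in> carrier P" using \<kappa>[OF X] \<rho>c[OF X] Hsub by auto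
    have Xs: "X \<otimes>\<^bsub>P\<^esub> s = \<kappa> X \<otimes>\<^bsub>P\<^esub> (\<rho> X \<otimes>\<^bsub>P\<^esub> s)" using \<kappa>\<rho>[OF X] c s by (metis P.m_assoc)
    have "H #>\<^bsub>P\<^esub> (X \<otimes>\<^bsub>P\<^esub> s) = H #>\<^bsub>P\<^esub> (\<rho> X \<otimes>\<^bsub>P\<^esub> s)" unfolding Xs using coset[OF \<kappa>[OF X]] c s by simp
    then have "\<rho> (X \<otimes>\<^bsub>P\<^esub> s) = \<rho> (\<rho> X \<otimes>\<^bsub>P\<^esub> s)" by (simp add: \<rho>_def)
    then have "\<kappa> (X \<otimes>\<^bsub>P\<^esub> s) = \<kappa> X \<otimes>\<^bsub>P\<^esub> \<kappa> (\<rho> X \<otimes>\<^bsub>P\<^esub> s)"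
      using Xs c s \<rho>c[of "\<rho> X \<otimes>\<^bsub>P\<^esub> s"] by (simp add: \<kappa>_def P.m_assoc)
    then show ?thesis unfolding f_def using \<phi> \<kappa>[OF X] \<kappa>[of "\<rho> X \<otimes>\<^bsub>P\<^esub> s"] c s by simp
  qed
  define Q where "Q = \<rho> ` carrier P"
  have "Q \<subseteq> (\<lambda>C. SOME q. q \<in> C) ` (rcosets\<^bsub>P\<^esub> H)"
    unfolding Q_def \<rho>_def using P.rcosetsI[OF Hsub] by blast
  then have finQ: "finite Q" using H(2) finite_surj by blast
  have "\<exists>b. \<forall>q\<in>Q. \<forall>s\<in>gens. \<bar>f (q \<otimes>\<^bsub>P\<^esub> s)\<bar> \<le> b"
  proof -
    have "finite ((\<lambda>(q, s). \<bar>f (q \<otimes>\<^bsub>P\<^esub> s)\<bar>) ` (Q \<times> gens))" using finQ assms(2) by simp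
    then have "bdd_above ((\<lambda>(q, s). \<bar>f (q \<otimes>\<^bsub>P\<^esub> s)\<bar>) ` (Q \<times> gens))" by (rule bdd_above_finite)
    then show ?thesis unfolding bdd_above_def by auto
  qed
  then obtain D0 where D0: "\<And>q s. q \<in> Q \<Longrightarrow> s \<in> gens \<Longrightarrow> \<bar>f (q \<otimes>\<^bsub>P\<^esub> s)\<bar> \<le> D0" by auto
  define D where "D = max 0 D0"
  have D: "D \<ge> 0" "\<And>q s. q \<in> Q \<Longrightarrow> s \<in> gens \<Longrightarrow> \<bar>f (q \<otimes>\<^bsub>P\<^esub> s)\<bar> \<le> D"
    using D0 by (auto simp: D_def le_max_iff_disj)
  have upper: "\<bar>f (X \<otimes>\<^bsub>P\<^esub> Y) - f X\<bar> \<le> D * int n" if "X \<in> carrier P" "Y \<in> wball n" for X Y n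
    using that
  proof (induction n arbitrary: Y)
    case (Suc n)
    show ?case
    proof (cases "Y \<in> wball n")
      case True
      then have "\<bar>f (X \<otimes>\<^bsub>P\<^esub> Y) - f X\<bar> \<le> D * int n" using Suc by blast
      also have "\<dots> \<le> D * int (Suc n)" using D(1) by (simp add: algebra_simps)
      finally show ?thesis .
    next
      case False
      then obtain Z s where Z: "Y = Z \<otimes>\<^bsub>P\<^esub> s" "Z \<in> wball n" "s \<in> gens" using Suc by auto
      have c: "Z \<in> carrier P" "s \<in> carrier P" using Z wball_carrier gens_carrier by auto
      have "X \<otimes>\<^bsub>P\<^esub> Y = (X \<otimes>\<^bsub>P\<^esub> Z) \<otimes>\<^bsub>P\<^esub> s" using Z c Suc.prems(1) by (simp add: P.m_assoc)
      then have "f (X \<otimes>\<^bsub>P\<^esub> Y) = f (X \<otimes>\<^bsub>P\<^esub> Z) + f (\<rho> (X \<otimes>\<^bsub>P\<^esub> Z) \<otimes>\<^bsub>P\<^esub> s)"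
        using f_mult c Suc.prems(1) by simp
      moreover have "\<bar>f (\<rho> (X \<otimes>\<^bsub>P\<^esub> Z) \<otimes>\<^bsub>P\<^esub> s)\<bar> \<le> D" using D(2) Z c Suc.prems(1) by (simp add: Q_def)
      moreover have "\<bar>f (X \<otimes>\<^bsub>P\<^esub> Z) - f X\<bar> \<le> D * int n" using Suc.IH Suc.prems(1) Z by blast
      moreover have "D * int (Suc n) = D * int n + D" by (simp add: algebra_simps)
      ultimately show ?thesis by linarith
    qed
  qed simp
  obtain t where t: "t \<in> H" "\<phi> t = 1" using surj by blast
  define M1 where "M1 = max (len t) (len (inv\<^bsub>P\<^esub> t))"
  have tc: "t \<in> carrier P" "inv\<^bsub>P\<^esub> t \<in> H" using t Hsub Hinv by auto
  have len_step: "len h \<le> M1 * n" if "h \<in> H" "\<bar>\<phi> h\<bar> = int n" for h n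
    using that
  proof (induction n arbitrary: h)
    case 0
    then have "h = \<one>\<^bsub>P\<^esub>" using inj oneH \<phi>1 by simp
    then show ?case by (simp add: len_one)
  next
    case (Suc n)
    \<comment> \<open>\<open>u\<close> is whichever of \<open>t\<close> and its inverse brings the
      coordinate of \<open>h\<close> closer to zero.\<close>
    obtain u where u: "u \<in> H" "u \<in> {t, inv\<^bsub>P\<^esub> t}" "\<bar>\<phi> h - \<phi> u\<bar> = int n"
    proof (cases "\<phi> h > 0")
      case True
      then show ?thesis using that[of t] t Suc.prems(2) by auto
    next
      case False
      then show ?thesis using that[of "inv\<^bsub>P\<^esub> t"] t \<phi>inv[OF t(1)] tc Suc.prems(2) by auto
    qed
    have "\<phi> (h \<otimes>\<^bsub>P\<^esub> inv\<^bsub>P\<^esub> u) = \<phi> h - \<phi> u" using \<phi> \<phi>inv u Suc.prems(1) Hinv by simp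
    then have IH: "len (h \<otimes>\<^bsub>P\<^esub> inv\<^bsub>P\<^esub> u) \<le> M1 * n" using Suc.IH u Suc.prems(1) Hm Hinv by simp
    have c: "h \<in> carrier P" "u \<in> carrier P" using u Suc.prems(1) Hsub by auto
    then have "h = (h \<otimes>\<^bsub>P\<^esub> inv\<^bsub>P\<^esub> u) \<otimes>\<^bsub>P\<^esub> u" by (simp add: P.m_assoc)
    then have "len h \<le> len (h \<otimes>\<^bsub>P\<^esub> inv\<^bsub>P\<^esub> u) + len u" using c len_mult[of "h \<otimes>\<^bsub>P\<^esub> inv\<^bsub>P\<^esub> u" u] by simp
    moreover have "len u \<le> M1" using u(2) by (auto simp: M1_def)
    ultimately show ?case using IH by simp
  qed
  have "\<exists>b. \<forall>q\<in>Q. len q \<le> b \<and> len (inv\<^bsub>P\<^esub> q) \<le> b"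
  proof -
    have "finite (len ` (Q \<union> (\<lambda>q. inv\<^bsub>P\<^esub> q) ` Q))" using finQ by simp
    then have "bdd_above (len ` (Q \<union> (\<lambda>q. inv\<^bsub>P\<^esub> q) ` Q))" by (rule bdd_above_finite)
    then show ?thesis unfolding bdd_above_def by auto
  qed
  then obtain M where M: "\<And>q. q \<in> Q \<Longrightarrow> len q \<le> M" "\<And>q. q \<in> Q \<Longrightarrow> len (inv\<^bsub>P\<^esub> q) \<le> M" by auto
  \<comment> \<open>The element is an inverse representative, an element of \<open>H\<close> and a
    representative. The outer two have length at most \<open>M\<close>, and the middle one is
    measured by \<open>len_step\<close>.\<close>
  have lower: "len (inv\<^bsub>P\<^esub> X \<otimes>\<^bsub>P\<^esub> Y) \<le> 2 * M + M1 * nat \<bar>f X - f Y\<bar>" if X: "X \<in> carrier P" and Y: "Y \<in> carrier P" for X Y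
  proof -
    let ?h = "inv\<^bsub>P\<^esub> \<kappa> X \<otimes>\<^bsub>P\<^esub> \<kappa> Y"
    have h: "?h \<in> H" using \<kappa> X Y Hm Hinv by simp
    have "\<phi> ?h = f Y - f X" using \<phi> \<phi>inv \<kappa> X Y Hinv by (simp add: f_def)
    then have 1: "len ?h \<le> M1 * nat \<bar>f X - f Y\<bar>" using len_step[OF h] by (simp add: abs_minus_commute)
    have c: "\<kappa> X \<in> carrier P" "\<rho> X \<in> carrier P" "\<kappa> Y \<in> carrier P" "\<rho> Y \<in> carrier P"
      using \<kappa> \<rho>c X Y Hsub by auto
    have "inv\<^bsub>P\<^esub> X \<otimes>\<^bsub>P\<^esub> Y = inv\<^bsub>P\<^esub> (\<kappa> X \<otimes>\<^bsub>P\<^esub> \<rho> X) \<otimes>\<^bsub>P\<^esub> (\<kappa> Y \<otimes>\<^bsub>P\<^esub> \<rho> Y)" using \<kappa>\<rho>[OF X] \<kappa>\<rho>[OF Y] by simp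
    also have "\<dots> = inv\<^bsub>P\<^esub> \<rho> X \<otimes>\<^bsub>P\<^esub> (?h \<otimes>\<^bsub>P\<^esub> \<rho> Y)" using c by (simp add: P.inv_mult_group P.m_assoc)
    finally have "len (inv\<^bsub>P\<^esub> X \<otimes>\<^bsub>P\<^esub> Y) \<le> len (inv\<^bsub>P\<^esub> \<rho> X) + (len ?h + len (\<rho> Y))"
      using len_mult[of "inv\<^bsub>P\<^esub> \<rho> X" "?h \<otimes>\<^bsub>P\<^esub> \<rho> Y"] len_mult[of ?h "\<rho> Y"] c by simp
    moreover have "len (inv\<^bsub>P\<^esub> \<rho> X) \<le> M" "len (\<rho> Y) \<le> M" using M X Y by (auto simp: Q_def)
    ultimately show ?thesis using 1 by linarith
  qed
  \<comment> \<open>\<open>L\<close> covers the change of \<open>f\<close> per edge and the cost in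
    length per unit of \<open>f\<close>. \<open>C\<close> covers the two representatives and the
    rounding of a real number to an integer.\<close>
  define L where "L = max 1 (max (real_of_int D) (real M1))"
  define C where "C = 2 * real M + 1"
  have LC: "L \<ge> 1" "C \<ge> 0" "C \<ge> 1" "real_of_int D \<le> L" "real M1 \<le> L" by (auto simp: L_def C_def)
  have "quasi_isometry (verts E) dE (UNIV :: real set) dist (\<lambda>X. real_of_int (f X))"
    unfolding quasi_isometry_def verts_E
  proof (rule conjI, simp, rule exI[of _ L], rule conjI, rule LC(1), rule exI[of _ C], intro conjI ballI)
    fix X Y assume X: "X \<in> carrier P" and Y: "Y \<in> carrier P"
    let ?d = "dE X Y" and ?e = "\<bar>real_of_int (f X) - real_of_int (f Y)\<bar>"
    have "real (len (inv\<^bsub>P\<^esub> X \<otimes>\<^bsub>P\<^esub> Y)) \<le> real (2 * M + M1 * nat \<bar>f X - f Y\<bar>)"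
      using lower[OF X Y] by (rule of_nat_mono)
    then have "?d \<le> 2 * real M + real M1 * ?e" using X Y by (simp add: dE_eq)
    also have "\<dots> \<le> L * (2 * real M) + L * ?e"
      using LC by (intro add_mono mult_right_mono) (auto simp: mult_le_cancel_right1)
    finally have "?d / L \<le> 2 * real M + ?e" using LC(1) by (simp add: divide_le_eq algebra_simps)
    then show "?d / L - C \<le> dist (real_of_int (f X)) (real_of_int (f Y))" by (simp add: dist_real_def C_def)
    let ?Z = "inv\<^bsub>P\<^esub> X \<otimes>\<^bsub>P\<^esub> Y"
    have Z: "?Z \<in> carrier P" "X \<otimes>\<^bsub>P\<^esub> ?Z = Y" using X Y by (simp_all flip: P.m_assoc)
    have "\<bar>f Y - f X\<bar> \<le> D * int (len ?Z)" using upper[OF X wball_len[OF Z(1)]] Z(2) by simp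
    then have "real_of_int \<bar>f Y - f X\<bar> \<le> real_of_int (D * int (len ?Z))" by (rule of_int_le_iff[THEN iffD2])
    then have "?e \<le> real_of_int D * ?d" using X Y by (simp add: dE_eq abs_minus_commute)
    also have "\<dots> \<le> L * ?d" using LC X Y by (intro mult_right_mono) (auto simp: dE_eq)
    finally show "dist (real_of_int (f X)) (real_of_int (f Y)) \<le> L * ?d + C" using LC by (simp add: dist_real_def)
  next
    fix y :: real
    \<comment> \<open>The chosen representative of \<open>H\<close> need not be the identity, so its
      coordinate is added here to cancel the one subtracted by \<open>\<kappa>\<close>.\<close>
    obtain u where u: "u \<in> H" "\<phi> u = \<lfloor>y\<rfloor> + \<phi> (\<rho> \<one>\<^bsub>P\<^esub>)" using surj by blast
    have "H #>\<^bsub>P\<^esub> u = H #>\<^bsub>P\<^esub> \<one>\<^bsub>P\<^esub>" using coset[OF u(1) P.one_closed] u Hsub by auto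
    then have \<rho>u: "\<rho> u = \<rho> \<one>\<^bsub>P\<^esub>" by (simp add: \<rho>_def)
    have "\<rho> \<one>\<^bsub>P\<^esub> \<in> H" using \<rho>[OF P.one_closed] P.coset_join2[OF P.one_closed H(1) oneH] by simp
    then have "f u = \<lfloor>y\<rfloor>" unfolding f_def \<kappa>_def \<rho>u using \<phi> \<phi>inv u Hinv by simp
    then have "dist (real_of_int (f u)) y \<le> C" using LC(3) by (simp add: dist_real_def) linarith
    then show "\<exists>X\<in>carrier P. dist (real_of_int (f X)) y \<le> C" using u Hsub by blast
  qed (use LC in auto)
  then show ?thesis by (auto simp: quasi_line_def)
qed

end

theorem theoremD:
  fixes \<Gamma> :: "('v,'e) pre_digraph" and G :: "'v \<Rightarrow> ('a,'b) monoid_scheme"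
  assumes "graph \<Gamma>"
    and "\<And>v. v \<in> verts \<Gamma> \<Longrightarrow> group (G v)"
    and "\<And>v. v \<in> verts \<Gamma> \<Longrightarrow> carrier (G v) \<noteq> {\<one>\<^bsub>G v\<^esub>}"
    and "\<And>v. v \<in> verts \<Gamma> \<Longrightarrow> finite (carrier (G v))"
  shows "(bounded_diameter (verts (electrification \<Gamma> G)) (graph_dist (electrification \<Gamma> G)) \<longleftrightarrow>
            complete_graph \<Gamma> \<or> minsquare_graph \<Gamma> \<or>
            (\<exists>\<Lambda>\<^sub>1 \<Lambda>\<^sub>2. is_join \<Gamma> \<Lambda>\<^sub>1 \<Lambda>\<^sub>2 \<and> minsquare_graph \<Lambda>\<^sub>1 \<and> complete_graph \<Lambda>\<^sub>2)) \<and>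
         (quasi_line (verts (electrification \<Gamma> G)) (graph_dist (electrification \<Gamma> G)) \<longleftrightarrow>
            virtually_infinite_cyclic (graph_product \<Gamma> G))"
proof -
  interpret graph \<Gamma> by fact
  interpret finite_graph_product \<Gamma> G
  proof (intro finite_graph_product.intro graph_product_data.intro vertex_groups.intro
      finite_graph_product_axioms.intro)
    show "graph \<Gamma>" by fact
  qed (fact dominates_sym dominates_irrefl assms)+
  show ?thesis
  proof
    show "bounded_diameter (verts E) dE \<longleftrightarrow> complete_graph \<Gamma> \<or> minsquare_graph \<Gamma> \<or>
      (\<exists>\<Lambda>\<^sub>1 \<Lambda>\<^sub>2. is_join \<Gamma> \<Lambda>\<^sub>1 \<Lambda>\<^sub>2 \<and> minsquare_graph \<Lambda>\<^sub>1 \<and> complete_graph \<Lambda>\<^sub>2)"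
      using bounded_iff core_minsquare_iff by simp
    show "quasi_line (verts E) dE \<longleftrightarrow> virtually_infinite_cyclic P"
    proof
      assume "quasi_line (verts E) dE"
      then show "virtually_infinite_cyclic P"
        by (rule quasi_line_core) (rule core_pair_virtually_infinite_cyclic)
    next
      assume "virtually_infinite_cyclic P"
      then show "quasi_line (verts E) dE"
        by (intro virtually_infinite_cyclic_quasi_line finite_gens virtually_infinite_cyclic_no_square)
    qed
  qed
qed

end
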